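(* Assume that the data of the stochastic team problem ($\mathcal{P}$) described in the context satisfy conditions (A)–(F) stated in the context. Then the maximum in problem ($\mathcal{P}$) is attained (i.e. there exists an optimal feasible program), and there exist functions $p_t$, $q_t$ ($t\in T$) that are stochastic Lagrange multipliers relaxing the constraints $g_t(\omega,x^t(\omega))\ge 0$ a.s. and $x_t-E_tx_t=0$ ($t\in T$). That is: for each $t\in T$, $p_t:\Omega\to W_t$ is a non-negative $\mathcal{F}_t$-measurable integrable function, $q_t:\Omega\to V_t$ is an $\mathcal{F}$-measurable integrable function, and, with $$L(x):=F(x)+\sum_{t\in T}E\,p_t g_t(x^t)+\sum_{t\in T}E\,q_t(x_t-E_tx_t),\qquad x\in X,$$ for all programs $x\in X$ and each solution $\bar x$ to problem ($\mathcal{P}$) one has $$L(x)\le L(\bar x)\qquad\text{and}\qquad E\,p_tg_t(\bar x^t)=0\ \text{ for each } t\in T.$$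
   Context: **Model.** $(\Omega,\mathcal{F},P)$ is a probability space, $E$ is expectation with respect to $P$, "a.s." is with respect to $P$. $T$ is a finite set of decision makers acting at times $0,1,\dots,N$; $n(t)\in\{0,\dots,N\}$ is the time at which $t\in T$ acts, and $T_n:=\{t: n(t)=n\}\ne\emptyset$ for each $n$. $T$ carries a partial order $\preccurlyeq$ (write $t\prec s$ if $t\preccurlyeq s$, $t\ne s$) such that $t\prec s$ implies $n(t)<n(s)$. To each $t\in T$ corresponds a $\sigma$-algebra $\mathcal{F}_t\subseteq\mathcal{F}$, with $\mathcal{F}_t\subseteq\mathcal{F}_s$ whenever $t\prec s$. $E_t\xi:=E(\xi\mid\mathcal{F}_t)$. For each $t$: $V_t$ is a vector space of finite dimension $m_t$ (identified with $\mathbb{R}^{m_t}$), $W_t$ is a vector space of finite dimension $l_t$ (identified with $\mathbb{R}^{l_t}$), and $A_t(\omega)\subseteq V_t$ is given for each $\omega\in\Omega$. Inequalities between vectors (strict and non-strict) are coordinate-wise; products such as $p_tg_t$ and $q_tx_t$ are scalar products. Put $V^t=\prod_{i\preccurlyeq t}V_i$, $\mathcal{B}^t$ = Borel $\sigma$-algebra of $V^t$, $A^t(\omega)=\prod_{i\preccurlyeq t}A_i(\omega)$, and for $a=(a_i)_{i\in T}$ put $a^t=(a_i)_{i\preccurlyeq t}$ (likewise $x^t=(x_i)_{i\preccurlyeq t}$). For each $t$ a function $g_t(\omega,a^t)$, $\omega\in\Omega$, $a^t\in V^t$, with values in $W_t$ is given. The argument $\omega$ is often omitted: $g_t(x^t)$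 means $g_t(\omega,x^t(\omega))$. A *program* is a collection $x=(x_t)_{t\in T}$ of $\mathcal{F}$-measurable functions $x_t:\Omega\to V_t$ with $x_t(\omega)\in A_t(\omega)$ a.s. for each $t$; $X$ is the set of all programs. $H\subseteq X$ is the set of *adapted* programs: those with $x_t$ being $\mathcal{F}_t$-measurable for every $t$. A real-valued functional $F$ on $X$ is given. **Problem ($\mathcal{P}$):** maximize $F(x)$ over all *feasible* programs, i.e. over all adapted programs $x\in H$ with $g_t(\omega,x^t(\omega))\ge0$ a.s. for all $t\in T$. A solution is a feasible program attaining the maximum. (The adaptedness requirement is represented as $x_t-E_tx_t=0$.) For $s\in T$, an adapted program $x$ is called *$s$-feasible* if $g_t(\omega,x^t(\omega))\ge 0$ a.s. for all $t\prec s$. **Conditions.** (A) For each $t$, the set $A_t(\omega)$ is convex, closed, uniformly bounded (in $\omega$), and depends $\mathcal{F}_t$-measurably on $\omega$: for each point $a\in V_t$ the distance between $a$ and $A_t(\omega)$ is an $\mathcal{F}_t$-measurable function of $\omega$. (B) Each $g_t(\omega,a^t)$ is measurable with respect to $\mathcal{F}_t\times\mathcal{B}^t$. For every $t$ and $\omega$, $g_t(\omega,a^t)$ is continuous and (coordinate-wise) concave in $a^t\in A^t(\omega)$. There is a number $c$ such that $|g_t(\omega,a^t)|\le c$ for all $\omega,t,a^t$. (C) $F$ is concave on $X$ and continuous on $X$ with respect to a.s. convergence. (D) There exist an adapted program $(\mathring{x}_t)\in H$ and a real number $\theta>0$ such that for any $t$ and $\omega$ the set $A_t(\omega)$ contains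 a ball of radius $\theta$ centred at $\mathring{x}_t(\omega)$. (E) There exist an adapted program $\hat x=(\hat x_t)\in H$ and constant vectors $\kappa_t>0$ in $W_t$ such that $g_t(\hat x^t)\ge\kappa_t$ a.s. for all $t\in T$. (F) For every $s\in T$ and each $s$-feasible adapted program $(x_t)\in H$ there exists $(\tilde x_t)\in H$ such that $x_t=\tilde x_t$ for $t\ne s$ and $g_s(\tilde x^s)\ge0$ a.s. *)

theory Defs
  imports "HOL-Probability.Probability"
begin

text \<open>
  The decision makers are the elements of a finite partially ordered type \<open>'t\<close>.

  The finite-dimensional spaces \<open>V\<^sub>t\<close> and \<open>W\<^sub>t\<close>, whose dimensions vary with \<open>t\<close>, are the
  coordinate subspaces of \<open>real^'v\<close> and \<open>real^'w\<close> belonging to the sets of coordinates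
  \<open>vcoords D t\<close> and \<open>wcoords D t\<close>; thus \<open>m\<^sub>t = card (vcoords D t)\<close> and \<open>l\<^sub>t = card (wcoords D t)\<close>.
  As the number of decision makers is finite and \<open>'v\<close>, \<open>'w\<close> are arbitrary, all families of
  dimensions are covered.  Similarly, the product of the \<open>V\<^sub>i\<close>, \<open>i \<le> t\<close>, is the subspace of
  \<open>(real^'v)^'t\<close> of those vectors whose components at all other \<open>i\<close> vanish.
\<close>

type_synonym ('t, 'v) profile = "(real^'v, 't) vec"

record ('o, 't::finite, 'v::finite, 'w::finite) team =
  pspace :: "'o measure"
  horizon :: nat
  acttime :: "'t \<Rightarrow> nat"
  info :: "'t \<Rightarrow> 'o measure"
  vcoords :: "'t \<Rightarrow> 'v set"
  wcoords :: "'t \<Rightarrow> 'w set"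
  actions :: "'t \<Rightarrow> 'o \<Rightarrow> (real^'v) set"
  constr :: "'t \<Rightarrow> 'o \<Rightarrow> ('t, 'v) profile \<Rightarrow> real^'w"
  payoff :: "('t \<Rightarrow> 'o \<Rightarrow> real^'v) \<Rightarrow> real"

definition coord_space :: "'i set \<Rightarrow> (real^'i) set" where
  "coord_space I = {v. \<forall>i. i \<notin> I \<longrightarrow> v $ i = 0}"

definition Vsp :: "('o, 't::{finite,order}, 'v::finite, 'w::finite) team \<Rightarrow> 't \<Rightarrow> (real^'v) set" where
  "Vsp D t = coord_space (vcoords D t)"

definition Wsp :: "('o, 't::{finite,order}, 'v::finite, 'w::finite) team \<Rightarrow> 't \<Rightarrow> (real^'w) set" where
  "Wsp D t = coord_space (wcoords D t)"

definition prod_upto :: "'t::{finite,order} \<Rightarrow> ('t \<Rightarrow> (real^'v) set) \<Rightarrow> ('t, 'v) profile set" where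
  "prod_upto t S = {a. (\<forall>i\<le>t. a $ i \<in> S i) \<and> (\<forall>i. \<not> i \<le> t \<longrightarrow> a $ i = 0)}"

definition Vupto :: "('o, 't::{finite,order}, 'v::finite, 'w::finite) team \<Rightarrow> 't \<Rightarrow> ('t, 'v) profile set" where
  "Vupto D t = prod_upto t (Vsp D)"

definition Aupto :: "('o, 't::{finite,order}, 'v::finite, 'w::finite) team \<Rightarrow> 't \<Rightarrow> 'o \<Rightarrow> ('t, 'v) profile set" where
  "Aupto D t \<omega> = prod_upto t (\<lambda>i. actions D i \<omega>)"

definition upto_vec :: "'t::{finite,order} \<Rightarrow> ('t \<Rightarrow> 'o \<Rightarrow> real^'v) \<Rightarrow> 'o \<Rightarrow> ('t, 'v) profile" where
  "upto_vec t x \<omega> = (\<chi> i. if i \<le> t then x i \<omega> else 0)"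

definition constr_at ::
  "('o, 't::{finite,order}, 'v::finite, 'w::finite) team \<Rightarrow> 't \<Rightarrow> ('t \<Rightarrow> 'o \<Rightarrow> real^'v) \<Rightarrow> 'o \<Rightarrow> real^'w" where
  "constr_at D t x \<omega> = constr D t \<omega> (upto_vec t x \<omega>)"

definition team_model :: "('o, 't::{finite,order}, 'v::finite, 'w::finite) team \<Rightarrow> bool" where
  "team_model D \<longleftrightarrow>
     prob_space (pspace D) \<and>
     (\<forall>t. acttime D t \<le> horizon D) \<and>
     (\<forall>k\<le>horizon D. {t. acttime D t = k} \<noteq> {}) \<and>
     (\<forall>t s. t < s \<longrightarrow> acttime D t < acttime D s) \<and>
     (\<forall>t. subalgebra (pspace D) (info D t)) \<and>
     (\<forall>t s. t < s \<longrightarrow> sets (info D t) \<subseteq> sets (info D s)) \<and>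
     (\<forall>t. \<forall>\<omega>\<in>space (pspace D). actions D t \<omega> \<subseteq> Vsp D t) \<and>
     (\<forall>t. \<forall>\<omega>\<in>space (pspace D). \<forall>a\<in>Vupto D t. constr D t \<omega> a \<in> Wsp D t)"

definition programs :: "('o, 't::{finite,order}, 'v::finite, 'w::finite) team \<Rightarrow> ('t \<Rightarrow> 'o \<Rightarrow> real^'v) set" where
  "programs D = {x. \<forall>t.
     x t \<in> borel_measurable (pspace D) \<and>
     (\<forall>\<omega>\<in>space (pspace D). x t \<omega> \<in> Vsp D t) \<and>
     (AE \<omega> in pspace D. x t \<omega> \<in> actions D t \<omega>)}"

definition adapted :: "('o, 't::{finite,order}, 'v::finite, 'w::finite) team \<Rightarrow> ('t \<Rightarrow> 'o \<Rightarrow> real^'v) set" where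
  "adapted D = {x \<in> programs D. \<forall>t. x t \<in> borel_measurable (info D t)}"

text \<open>
  The order on \<open>real^'w\<close> is the coordinate-wise one.  On \<open>W\<^sub>t\<close> this is the order of \<open>W\<^sub>t\<close>, because
  the coordinates outside \<open>wcoords D t\<close> are 0.
\<close>

definition feasible :: "('o, 't::{finite,order}, 'v::finite, 'w::finite) team \<Rightarrow> ('t \<Rightarrow> 'o \<Rightarrow> real^'v) set" where
  "feasible D = {x \<in> adapted D. \<forall>t. AE \<omega> in pspace D. 0 \<le> constr_at D t x \<omega>}"

definition feasible_before ::
  "('o, 't::{finite,order}, 'v::finite, 'w::finite) team \<Rightarrow> 't \<Rightarrow> ('t \<Rightarrow> 'o \<Rightarrow> real^'v) set" where
  "feasible_before D s = {x \<in> adapted D. \<forall>t<s. AE \<omega> in pspace D. 0 \<le> constr_at D t x \<omega>}"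

definition solution ::
  "('o, 't::{finite,order}, 'v::finite, 'w::finite) team \<Rightarrow> ('t \<Rightarrow> 'o \<Rightarrow> real^'v) \<Rightarrow> bool" where
  "solution D x \<longleftrightarrow> x \<in> feasible D \<and> (\<forall>y\<in>feasible D. payoff D y \<le> payoff D x)"

definition cond_A :: "('o, 't::{finite,order}, 'v::finite, 'w::finite) team \<Rightarrow> bool" where
  "cond_A D \<longleftrightarrow> (\<forall>t.
     (\<forall>\<omega>\<in>space (pspace D). convex (actions D t \<omega>) \<and> closed (actions D t \<omega>)) \<and>
     (\<exists>K. \<forall>\<omega>\<in>space (pspace D). \<forall>a\<in>actions D t \<omega>. norm a \<le> K) \<and>
     (\<forall>a\<in>Vsp D t. (\<lambda>\<omega>. infdist a (actions D t \<omega>)) \<in> borel_measurable (info D t)))"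

definition cond_B :: "('o, 't::{finite,order}, 'v::finite, 'w::finite) team \<Rightarrow> bool" where
  "cond_B D \<longleftrightarrow>
     (\<forall>t. (\<lambda>(\<omega>, a). constr D t \<omega> a)
        \<in> borel_measurable (info D t \<Otimes>\<^sub>M restrict_space borel (Vupto D t))) \<and>
     (\<forall>t. \<forall>\<omega>\<in>space (pspace D).
        continuous_on (Aupto D t \<omega>) (constr D t \<omega>) \<and>
        (\<forall>i\<in>wcoords D t. concave_on (Aupto D t \<omega>) (\<lambda>a. constr D t \<omega> a $ i))) \<and>
     (\<exists>c. \<forall>t. \<forall>\<omega>\<in>space (pspace D). \<forall>a\<in>Vupto D t. norm (constr D t \<omega> a) \<le> c)"

text \<open>
  Applied to constant sequences, the continuity requirement makes \<open>payoff D\<close> insensitive to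
  changes of a program on a null set.
\<close>

definition cond_C :: "('o, 't::{finite,order}, 'v::finite, 'w::finite) team \<Rightarrow> bool" where
  "cond_C D \<longleftrightarrow>
     (\<forall>x\<in>programs D. \<forall>y\<in>programs D. \<forall>u\<in>{0..1}.
        (1 - u) * payoff D x + u * payoff D y
          \<le> payoff D (\<lambda>t \<omega>. (1 - u) *\<^sub>R x t \<omega> + u *\<^sub>R y t \<omega>)) \<and>
     (\<forall>x\<in>programs D. \<forall>X. (\<forall>k::nat. X k \<in> programs D) \<longrightarrow>
        (\<forall>t. AE \<omega> in pspace D. (\<lambda>k. X k t \<omega>) \<longlonglongrightarrow> x t \<omega>) \<longrightarrow>
        (\<lambda>k. payoff D (X k)) \<longlonglongrightarrow> payoff D x)"

definition cond_D :: "('o, 't::{finite,order}, 'v::finite, 'w::finite) team \<Rightarrow> bool" where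
  "cond_D D \<longleftrightarrow> (\<exists>x\<in>adapted D. \<exists>\<theta>>0. \<forall>t. \<forall>\<omega>\<in>space (pspace D).
     ball (x t \<omega>) \<theta> \<inter> Vsp D t \<subseteq> actions D t \<omega>)"

definition cond_E :: "('o, 't::{finite,order}, 'v::finite, 'w::finite) team \<Rightarrow> bool" where
  "cond_E D \<longleftrightarrow> (\<exists>x\<in>adapted D. \<exists>\<kappa>. \<forall>t.
     \<kappa> t \<in> Wsp D t \<and> (\<forall>i\<in>wcoords D t. 0 < \<kappa> t $ i) \<and>
     (AE \<omega> in pspace D. \<kappa> t \<le> constr_at D t x \<omega>))"

definition cond_F :: "('o, 't::{finite,order}, 'v::finite, 'w::finite) team \<Rightarrow> bool" where
  "cond_F D \<longleftrightarrow> (\<forall>s. \<forall>x\<in>feasible_before D s. \<exists>y\<in>adapted D.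
     (\<forall>t. t \<noteq> s \<longrightarrow> (\<forall>\<omega>\<in>space (pspace D). x t \<omega> = y t \<omega>)) \<and>
     (AE \<omega> in pspace D. 0 \<le> constr_at D s y \<omega>))"

definition vec_cond_exp :: "'o measure \<Rightarrow> 'o measure \<Rightarrow> ('o \<Rightarrow> real^'i) \<Rightarrow> 'o \<Rightarrow> real^'i" where
  "vec_cond_exp M G f \<omega> = (\<chi> i. real_cond_exp M G (\<lambda>\<omega>. f \<omega> $ i) \<omega>)"

definition lagrangian ::
  "('o, 't::{finite,order}, 'v::finite, 'w::finite) team \<Rightarrow> ('t \<Rightarrow> 'o \<Rightarrow> real^'w) \<Rightarrow> ('t \<Rightarrow> 'o \<Rightarrow> real^'v)
     \<Rightarrow> ('t \<Rightarrow> 'o \<Rightarrow> real^'v) \<Rightarrow> real" where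
  "lagrangian D p q x =
     payoff D x
     + (\<Sum>t\<in>UNIV. \<integral>\<omega>. p t \<omega> \<bullet> constr_at D t x \<omega> \<partial>pspace D)
     + (\<Sum>t\<in>UNIV. \<integral>\<omega>. q t \<omega> \<bullet> (x t \<omega> - vec_cond_exp (pspace D) (info D t) (x t) \<omega>) \<partial>pspace D)"

definition multipliers ::
  "('o, 't::{finite,order}, 'v::finite, 'w::finite) team \<Rightarrow> ('t \<Rightarrow> 'o \<Rightarrow> real^'w) \<Rightarrow> ('t \<Rightarrow> 'o \<Rightarrow> real^'v) \<Rightarrow> bool" where
  "multipliers D p q \<longleftrightarrow>
     (\<forall>t. p t \<in> borel_measurable (info D t) \<and> integrable (pspace D) (p t) \<and>
        (\<forall>\<omega>\<in>space (pspace D). p t \<omega> \<in> Wsp D t \<and> 0 \<le> p t \<omega>)) \<and>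
     (\<forall>t. q t \<in> borel_measurable (pspace D) \<and> integrable (pspace D) (q t) \<and>
        (\<forall>\<omega>\<in>space (pspace D). q t \<omega> \<in> Vsp D t)) \<and>
     (\<forall>x\<in>programs D. \<forall>z. solution D z \<longrightarrow>
        lagrangian D p q x \<le> lagrangian D p q z \<and>
        (\<forall>t. (\<integral>\<omega>. p t \<omega> \<bullet> constr_at D t z \<omega> \<partial>pspace D) = 0))"

end

theory Submission imports Defs begin

text \<open>
  Constraints are relaxed one at a time, later decision makers first, and the information
  constraint last.  A quadratic penalty yields bounded multipliers that are correct up to an error
  tending to 0; the interior points of (D) and (E) bound them in \<open>L\<^sup>1\<close>.  The approximate multipliers
  form convex sets, and minimising a strictly convex functional over these gives a sequence that
  converges almost everywhere.  No uniform integrability is needed: before passing to the limit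
  a program is modified on the small set where the multipliers are unbounded, by the recourse of (F)
  for \<open>g\<^sub>s\<close> and by the conditional expectations \<open>E\<^sub>t x\<^sub>t\<close> for the information constraint.
  The payoff, being continuous for almost sure convergence, does not feel this change in the limit.
\<close>

section \<open>Selection of convergent sequences and a penalty estimate\<close>

text \<open>An L1-bounded sequence of approximate multipliers may lose mass to sets of vanishing
  probability, so an upper bound on the payoff plus multiplier terms need not survive the limit. The
  lost mass has to be shown harmless for each kind of constraint, and this fixes the order. Changing
  \<open>x_s\<close> affects only the constraints \<open>g_t\<close> with s \<le> t; once those
  strictly above \<open>s\<close> have been moved into the payoff, the recourse of (F) leaves every
  other enforced constraint intact. While programs stay adapted, the penalty multiplier of
  \<open>g_s\<close> is a multiple of the negative part of \<open>g_s\<close> at an adapted program,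
  hence measurable for the information of \<open>s\<close>; this is why adaptedness is relaxed only
  at the end. The function sqrt(1 + |y|^2) grows linearly, so its expectation is finite for
  integrable functions, and its strict convexity degenerates only for large arguments, which
  Markov's inequality makes improbable.\<close>

definition hyp :: "'b::real_inner \<Rightarrow> real" where
  "hyp y = sqrt (1 + y \<bullet> y)"

lemma hyp_ge_1: "1 \<le> hyp y"
  by (simp add: hyp_def)

lemma hyp_le_norm: "hyp y \<le> 1 + norm y"
proof -
  have "sqrt (1 + y \<bullet> y) \<le> sqrt ((1 + norm y)\<^sup>2)"
    by (rule real_sqrt_le_mono) (simp add: power2_eq_square algebra_simps dot_square_norm)
  then show ?thesis by (simp add: hyp_def)
qed

lemma hyp_measurable [measurable]: "hyp \<in> borel_measurable (borel :: 'b::euclidean_space measure)"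
  unfolding hyp_def by measurable

text \<open>Read \<open>hyp a\<close> as the length of the vector (1, a). Then \<open>s\<close> is
  the product of the lengths of (1, a) and (1, b), \<open>t\<close> is their inner product, and s^2
  - t^2 equals |a - b|^2 plus the Cauchy-Schwarz defect of \<open>a\<close> and \<open>b\<close>.
  With A, B, m the values of \<open>hyp\<close> at \<open>a\<close>, \<open>b\<close> and the
  midpoint, (A + B)^2 - (2m)^2 = 2(s - t), so the midpoint gap controls s - t. The prefactor is the
  price of linear growth: it is harmless only where \<open>hyp a\<close> and \<open>hyp b\<close>
  are bounded.\<close>

lemma hyp_strict_convexity:
  fixes a b :: "'b::real_inner"
  shows "(norm (a - b))\<^sup>2 \<le> 4 * (hyp a * hyp b * (hyp a + hyp b)) *
    (hyp a / 2 + hyp b / 2 - hyp ((1/2) *\<^sub>R (a + b)))"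
proof -
  let ?A = "hyp a" and ?B = "hyp b" and ?m = "hyp ((1/2) *\<^sub>R (a + b))"
  define s t where "s = ?A * ?B" and "t = 1 + a \<bullet> b"
  have A: "?A * ?A = 1 + a \<bullet> a" and B: "?B * ?B = 1 + b \<bullet> b"
    and m: "?m * ?m = 1 + ((a + b) \<bullet> (a + b)) / 4"
    by (auto simp: hyp_def real_sqrt_mult_self)
  have pos: "?A \<ge> 1" "?B \<ge> 1" "?m \<ge> 1" by (rule hyp_ge_1)+
  have s1: "1 \<le> s" using mult_mono[of 1 ?A 1 ?B] pos by (simp add: s_def)
  have m2: "(?A + ?B - 2 * ?m) * (?A + ?B + 2 * ?m) = 2 * (s - t)"
  proof -
    have e: "(a + b) \<bullet> (a + b) = a \<bullet> a + b \<bullet> b + 2 * (a \<bullet> b)"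
      by (simp add: inner_add_left inner_add_right inner_commute)
    have "(?A + ?B - 2 * ?m) * (?A + ?B + 2 * ?m) = ?A * ?A + ?B * ?B + 2 * s - 4 * (?m * ?m)"
      by (simp add: s_def algebra_simps)
    also have "\<dots> = 2 * (s - t)"
      unfolding A B m e t_def by (simp add: field_simps)
    finally show ?thesis .
  qed
  have "s * s = (1 + a \<bullet> a) * (1 + b \<bullet> b)"
    using A B unfolding s_def by (metis mult.commute mult.left_commute)
  then have "s * s - t * t = (norm (a - b))\<^sup>2 + ((a \<bullet> a) * (b \<bullet> b) - (a \<bullet> b)\<^sup>2)"
    unfolding t_def power2_norm_eq_inner
    by (simp add: inner_diff_left inner_diff_right inner_commute power2_eq_square algebra_simps)
  moreover have "(a \<bullet> b)\<^sup>2 \<le> (a \<bullet> a) * (b \<bullet> b)"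
    by (rule Cauchy_Schwarz_ineq)
  ultimately have st: "(norm (a - b))\<^sup>2 \<le> (s - t) * (s + t)"
    by (simp add: algebra_simps)
  have "0 \<le> (s - t) * (s + t)" using st zero_le_power2 order_trans by blast
  then have ts: "t \<le> s" using s1
    by (auto simp: zero_le_mult_iff)
  have "(norm (a - b))\<^sup>2 \<le> (s - t) * (2 * s)"
    using st ts by (smt (verit) mult_left_mono)
  moreover have "s - t \<le> (?A + ?B - 2 * ?m) * (?A + ?B)"
  proof -
    have "0 \<le> ?A + ?B - 2 * ?m"
      using m2 ts pos by (smt (verit) zero_le_mult_iff)
    then have "(?A + ?B - 2 * ?m) * (?A + ?B + 2 * ?m) \<le> (?A + ?B - 2 * ?m) * (2 * (?A + ?B))"
      by (intro mult_left_mono) auto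
    then show ?thesis using m2 by (simp add: algebra_simps)
  qed
  then have "(s - t) * (2 * s) \<le> (?A + ?B - 2 * ?m) * (?A + ?B) * (2 * s)"
    using s1 by (intro mult_right_mono) auto
  ultimately show ?thesis
    by (simp add: s_def algebra_simps)
qed

lemma convergent_if_summable_steps:
  fixes f :: "nat \<Rightarrow> 'b::banach"
  assumes "\<forall>\<^sub>F n in sequentially. norm (f (Suc n) - f n) \<le> (1/2) ^ n"
  shows "convergent f"
proof -
  have "summable (\<lambda>n. f (Suc n) - f n)"
    by (rule summable_comparison_test_ev[OF assms]) (simp add: summable_geometric)
  then have "(\<lambda>n. \<Sum>k<n. f (Suc k) - f k) \<longlonglongrightarrow> (\<Sum>k. f (Suc k) - f k)"
    by (rule summable_LIMSEQ)
  then have "(\<lambda>n. (f n - f 0) + f 0) \<longlonglongrightarrow> (\<Sum>k. f (Suc k) - f k) + f 0"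
    unfolding sum_lessThan_telescope by (intro tendsto_add tendsto_const)
  then show ?thesis by (auto simp: convergent_def)
qed

lemma (in finite_measure) integrable_hyp:
  fixes f :: "'a \<Rightarrow> 'b::euclidean_space"
  assumes "integrable M f"
  shows "integrable M (\<lambda>\<omega>. hyp (f \<omega>))"
proof (rule Bochner_Integration.integrable_bound[where f="\<lambda>\<omega>. 1 + norm (f \<omega>)"])
  show "integrable M (\<lambda>\<omega>. 1 + norm (f \<omega>))" using assms by auto
  show "(\<lambda>\<omega>. hyp (f \<omega>)) \<in> borel_measurable M" using assms by measurable
  show "AE \<omega> in M. norm (hyp (f \<omega>)) \<le> norm (1 + norm (f \<omega>))"
    using hyp_le_norm hyp_ge_1 by (auto intro!: AE_I2 simp: abs_if) (smt (verit) hyp_ge_1 norm_ge_zero)+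
qed

text \<open>
  A substitute for Komlos' theorem and weak compactness: nearly minimising the strictly convex
  functional \<open>E sqrt(1 + |f|\<^sup>2)\<close> over the sets \<open>C n\<close> yields a sequence that is Cauchy in probability.
\<close>

lemma (in prob_space) AE_convergent_selection:
  fixes C :: "nat \<Rightarrow> ('a \<Rightarrow> 'b::euclidean_space) set"
  assumes dec: "decseq C"
    and ne: "\<And>n. C n \<noteq> {}"
    and int: "\<And>n f. f \<in> C n \<Longrightarrow> integrable M f"
    and bnd: "\<And>n f. f \<in> C n \<Longrightarrow> (\<integral>\<omega>. norm (f \<omega>) \<partial>M) \<le> B"
    and mid: "\<And>n f g. f \<in> C n \<Longrightarrow> g \<in> C n \<Longrightarrow> (\<lambda>\<omega>. (1/2) *\<^sub>R (f \<omega> + g \<omega>)) \<in> C n"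
  shows "\<exists>f h. (\<forall>n. f n \<in> C n) \<and> integrable M h \<and> (AE \<omega> in M. (\<lambda>n. f n \<omega>) \<longlonglongrightarrow> h \<omega>)"
proof -
  define \<Phi> where "\<Phi> f = (\<integral>\<omega>. hyp (f \<omega>) \<partial>M)" for f :: "'a \<Rightarrow> 'b"
  define d where "d n = Inf (\<Phi> ` C n)" for n
  note ih = integrable_hyp[OF int]
  have \<Phi>0: "0 \<le> \<Phi> f" for f unfolding \<Phi>_def
    using hyp_ge_1 by (intro integral_nonneg_AE AE_I2) (smt (verit) hyp_ge_1)
  have bb: "bdd_below (\<Phi> ` C n)" for n by (rule bdd_belowI[of _ 0]) (use \<Phi>0 in auto)
  have \<Phi>B: "\<Phi> f \<le> 1 + B" if "f \<in> C n" for f n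
  proof -
    have "\<Phi> f \<le> (\<integral>\<omega>. 1 + norm (f \<omega>) \<partial>M)" unfolding \<Phi>_def
      using ih[OF that] int[OF that] hyp_le_norm by (intro integral_mono) auto
    also have "\<dots> = 1 + (\<integral>\<omega>. norm (f \<omega>) \<partial>M)"
      using int[OF that] by (simp add: prob_space)
    finally show ?thesis using bnd[OF that] by simp
  qed
  have B0: "0 \<le> B" using ne[of 0] bnd[of _ 0]
    by (metis all_not_in_conv integral_nonneg_AE AE_I2 norm_ge_zero order_trans)
  have dle: "d n \<le> \<Phi> f" if "f \<in> C n" for f n
    unfolding d_def using bb that by (intro cInf_lower) auto
  have incd: "incseq d"
    unfolding d_def using dec ne bb
    by (intro monoI cInf_superset_mono image_mono) (auto simp: decseq_def)
  have dB: "d n \<le> 1 + B" for n using ne[of n] dle \<Phi>B by (metis all_not_in_conv order_trans)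
  obtain dl where dlim: "d \<longlonglongrightarrow> dl" and dl: "\<And>n. d n \<le> dl"
    using incseq_convergent[OF incd, of "1 + B"] dB by (metis)
  \<comment> \<open>64 = 2 * 4 * 8: below, Markov's inequality divides by (1/4)^k, the square of the
    step size, and multiplies by 8^k, the cube of the truncation level 2^k; a summable factor
    (1/2)^k has to remain.\<close>
  define e where "e k = (1/64::real) ^ k" for k :: nat
  have e0: "0 < e k" for k by (simp add: e_def)
  have "\<exists>n\<ge>k. dl - e k \<le> d n" for k
  proof -
    have "\<forall>\<^sub>F n in sequentially. dl - e k < d n"
      using order_tendstoD(1)[OF dlim, of "dl - e k"] e0[of k] by simp
    then obtain n0 where "\<And>n. n \<ge> n0 \<Longrightarrow> dl - e k < d n" unfolding eventually_sequentially by auto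
    then show ?thesis by (intro exI[of _ "max n0 k"]) (auto intro: less_imp_le)
  qed
  then obtain N where N: "\<And>k. N k \<ge> k" "\<And>k. dl - e k \<le> d (N k)" by metis
  have "\<exists>f\<in>C (N k). \<Phi> f < d (N k) + e k" for k
    using cInf_lessD[of "\<Phi> ` C (N k)" "d (N k) + e k"] ne[of "N k"] e0[of k] unfolding d_def by auto
  then obtain f where f: "\<And>k. f k \<in> C (N k)" "\<And>k. \<Phi> (f k) < d (N k) + e k" by metis
  have fC: "f k \<in> C k" for k using f(1)[of k] N(1)[of k] dec by (auto simp: decseq_def)
  have fint [simp]: "integrable M (f k)" for k using int f(1) by blast
  have [measurable]: "f k \<in> borel_measurable M" for k using fint[of k] by (rule borel_measurable_integrable)
  have hint [simp]: "integrable M (\<lambda>\<omega>. hyp (f k \<omega>))" for k using integrable_hyp fint by blast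
  define mm where "mm k = (\<lambda>\<omega>. (1/2) *\<^sub>R (f k \<omega> + f (Suc k) \<omega>))" for k
  define gap where "gap k = (\<lambda>\<omega>. hyp (f k \<omega>) / 2 + hyp (f (Suc k) \<omega>) / 2 - hyp (mm k \<omega>))" for k
  have mmi: "integrable M (\<lambda>\<omega>. hyp (mm k \<omega>))" for k
    unfolding mm_def by (intro integrable_hyp) auto
  have gapi [simp]: "integrable M (gap k)" for k unfolding gap_def using mmi by auto
  have [measurable]: "gap k \<in> borel_measurable M" for k using gapi[of k] by (rule borel_measurable_integrable)
  have gapE: "(\<integral>\<omega>. gap k \<omega> \<partial>M) \<le> 2 * e k" for k
  proof -
    \<comment> \<open>\<open>N\<close> need not be monotone. Both functions, hence their midpoint,
      lie in the set with the smaller index, where the infimum is still at least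
      \<open>dl - e k\<close>.\<close>
    let ?n = "min (N k) (N (Suc k))"
    have "f k \<in> C ?n" "f (Suc k) \<in> C ?n"
      using f(1)[of k] f(1)[of "Suc k"] dec by (auto simp: decseq_def min_def) (meson nle_le subsetD)+
    then have "mm k \<in> C ?n" unfolding mm_def by (rule mid)
    then have *: "d ?n \<le> \<Phi> (mm k)" by (rule dle)
    have "e (Suc k) \<le> e k" by (simp add: e_def)
    then have "dl - e k \<le> d ?n" using N(2)[of k] N(2)[of "Suc k"] by (auto simp: min_def)
    moreover have "\<Phi> (f k) \<le> dl + e k" "\<Phi> (f (Suc k)) \<le> dl + e k"
      using f(2)[of k] f(2)[of "Suc k"] dl[of "N k"] dl[of "N (Suc k)"] \<open>e (Suc k) \<le> e k\<close> by auto
    moreover have "(\<integral>\<omega>. gap k \<omega> \<partial>M) = \<Phi> (f k) / 2 + \<Phi> (f (Suc k)) / 2 - \<Phi> (mm k)"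
      unfolding gap_def \<Phi>_def using mmi by simp
    ultimately show ?thesis using * by linarith
  qed
  have gap_bound: "(norm (f k \<omega> - f (Suc k) \<omega>))\<^sup>2 \<le> 4 * (hyp (f k \<omega>) * hyp (f (Suc k) \<omega>) *
      (hyp (f k \<omega>) + hyp (f (Suc k) \<omega>))) * gap k \<omega>" for k \<omega>
    unfolding gap_def mm_def by (rule hyp_strict_convexity)
  have gap0: "0 \<le> gap k \<omega>" for k \<omega>
  proof -
    have "0 < 4 * (hyp (f k \<omega>) * hyp (f (Suc k) \<omega>) * (hyp (f k \<omega>) + hyp (f (Suc k) \<omega>)))"
      using hyp_ge_1[of "f k \<omega>"] hyp_ge_1[of "f (Suc k) \<omega>"]
      by (intro mult_pos_pos add_pos_pos) auto
    then show ?thesis using gap_bound[of k \<omega>]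
      by (smt (verit) zero_le_power2 mult_pos_neg)
  qed
  define A where "A k = {\<omega>\<in>space M. (1/2)^k < norm (f (Suc k) \<omega> - f k \<omega>)}" for k
  have [measurable]: "A k \<in> sets M" for k unfolding A_def by measurable
  have PA: "prob (A k) \<le> (2 * (1 + B) + 16) * (1/2)^k" for k
  proof -
    \<comment> \<open>If the step exceeds (1/2)^k, then one of the two functions is large or the
      convexity gap is. All three events have probability of order (1/2)^k: the first two by the L1
      bound, the third by \<open>gapE\<close>. Borel-Cantelli then applies to
      \<open>A\<close>.\<close>
    define R where "R = (2::real)^k"
    have R0: "R > 0" by (simp add: R_def)
    let ?A1 = "{\<omega>\<in>space M. hyp (f k \<omega>) \<ge> R}" and ?A2 = "{\<omega>\<in>space M. hyp (f (Suc k) \<omega>) \<ge> R}"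
      and ?A3 = "{\<omega>\<in>space M. gap k \<omega> \<ge> (1/4)^k / (8 * R^3)}"
    have "A k \<subseteq> ?A1 \<union> ?A2 \<union> ?A3"
    proof
      fix \<omega> assume w: "\<omega> \<in> A k"
      then have w1: "\<omega> \<in> space M" and w2: "(1/2)^k < norm (f k \<omega> - f (Suc k) \<omega>)"
        by (auto simp: A_def norm_minus_commute)
      show "\<omega> \<in> ?A1 \<union> ?A2 \<union> ?A3"
      proof (rule ccontr)
        assume "\<not> ?thesis"
        then have c: "hyp (f k \<omega>) \<le> R" "hyp (f (Suc k) \<omega>) \<le> R" "gap k \<omega> < (1/4)^k / (8 * R^3)"
          using w1 by auto
        have "(1/4::real)^k = ((1/2)^k)\<^sup>2" by (simp add: power2_eq_square flip: power_mult_distrib)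
        also have "\<dots> < (norm (f k \<omega> - f (Suc k) \<omega>))\<^sup>2"
          using w2 by (intro power_strict_mono) auto
        also have "\<dots> \<le> 4 * (hyp (f k \<omega>) * hyp (f (Suc k) \<omega>) *
            (hyp (f k \<omega>) + hyp (f (Suc k) \<omega>))) * gap k \<omega>" by (rule gap_bound)
        also have "\<dots> \<le> 4 * (R * R * (R + R)) * gap k \<omega>"
          using c gap0[of k \<omega>] hyp_ge_1[of "f k \<omega>"] hyp_ge_1[of "f (Suc k) \<omega>"] R0
          by (intro mult_right_mono mult_left_mono mult_mono add_mono) auto
        also have "\<dots> \<le> 4 * (R * R * (R + R)) * ((1/4)^k / (8 * R^3))"
          using c(3) R0 by (intro mult_left_mono) auto
        also have "\<dots> = (1/4)^k" using R0 by (simp add: field_simps power3_eq_cube)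
        finally show False by simp
      qed
    qed
    then have "prob (A k) \<le> prob (?A1 \<union> ?A2 \<union> ?A3)" by (intro finite_measure_mono) auto
    also have "\<dots> \<le> prob (?A1 \<union> ?A2) + prob ?A3" by (intro measure_Un_le) auto
    also have "prob (?A1 \<union> ?A2) \<le> prob ?A1 + prob ?A2" by (intro measure_Un_le) auto
    finally have le: "prob (A k) \<le> prob ?A1 + prob ?A2 + prob ?A3" by simp
    have hh: "prob {\<omega>\<in>space M. hyp (f j \<omega>) \<ge> R} \<le> (1 + B) / R" for j
    proof -
      have "prob {\<omega>\<in>space M. hyp (f j \<omega>) \<ge> R} \<le> \<Phi> (f j) / R" unfolding \<Phi>_def
        using R0 by (intro integral_Markov_inequality_measure[where A="{}"])
          (auto intro!: AE_I2 intro: order_trans[OF _ hyp_ge_1])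
      also have "\<dots> \<le> (1 + B) / R" using \<Phi>B[OF fC] R0 by (intro divide_right_mono) auto
      finally show ?thesis .
    qed
    have "prob ?A3 \<le> (\<integral>\<omega>. gap k \<omega> \<partial>M) / ((1/4)^k / (8 * R^3))"
      using R0 gap0 by (intro integral_Markov_inequality_measure[where A="{}"]) auto
    also have "\<dots> \<le> (2 * e k) / ((1/4)^k / (8 * R^3))"
      using gapE R0 by (intro divide_right_mono) auto
    also have "\<dots> = 16 * (e k * 4^k * (2^k)^3)"
      by (simp add: R_def field_simps power_one_over)
    also have "e k * 4^k * (2^k)^3 = (1/2)^k"
      by (simp add: e_def flip: power_mult power_mult_distrib) (simp add: mult.commute[of k] power_mult flip: power_mult_distrib)
    finally have h3: "prob ?A3 \<le> 16 * (1/2)^k" .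
    have "prob (A k) \<le> (1 + B) / R + (1 + B) / R + 16 * (1/2)^k"
      using le hh[of k] hh[of "Suc k"] h3 by linarith
    also have "\<dots> = (2 * (1 + B) + 16) * (1/2)^k" by (simp add: R_def field_simps power_one_over)
    finally show ?thesis .
  qed
  have "AE \<omega> in M. \<forall>\<^sub>F n in sequentially. \<omega> \<in> space M - A n"
  proof (rule borel_cantelli_AE1)
    show "summable (\<lambda>n. prob (A n))"
      by (rule summable_comparison_test'[where g="\<lambda>k. (2 * (1 + B) + 16) * (1/2)^k"])
        (use PA in \<open>auto intro!: summable_mult summable_geometric\<close>)
  qed (auto simp: emeasure_eq_measure)
  then have conv: "AE \<omega> in M. convergent (\<lambda>n. f n \<omega>)"
  proof (rule AE_mp, intro AE_I2 impI)
    fix \<omega> assume "\<forall>\<^sub>F n in sequentially. \<omega> \<in> space M - A n"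
    then have "\<forall>\<^sub>F n in sequentially. norm (f (Suc n) \<omega> - f n \<omega>) \<le> (1/2) ^ n"
      by eventually_elim (auto simp: A_def not_less)
    then show "convergent (\<lambda>n. f n \<omega>)" by (rule convergent_if_summable_steps)
  qed
  define h where "h \<omega> = lim (\<lambda>n. f n \<omega>)" for \<omega>
  have [measurable]: "h \<in> borel_measurable M" unfolding h_def by measurable
  have lim: "AE \<omega> in M. (\<lambda>n. f n \<omega>) \<longlonglongrightarrow> h \<omega>"
    using conv by eventually_elim (simp add: h_def convergent_LIMSEQ_iff)
  \<comment> \<open>Fatou's lemma carries the bound \<open>B\<close> over to the limit.\<close>
  have "integrable M h"
  proof (rule integrableI_bounded)
    have "(\<integral>\<^sup>+\<omega>. norm (h \<omega>) \<partial>M) = (\<integral>\<^sup>+\<omega>. liminf (\<lambda>n. ennreal (norm (f n \<omega>))) \<partial>M)"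
    proof (rule nn_integral_cong_AE, use lim in eventually_elim)
      case (elim \<omega>)
      then have "(\<lambda>n. ennreal (norm (f n \<omega>))) \<longlonglongrightarrow> ennreal (norm (h \<omega>))"
        by (intro tendsto_ennrealI tendsto_norm)
      then show ?case using lim_imp_Liminf by (metis trivial_limit_sequentially)
    qed
    also have "\<dots> \<le> liminf (\<lambda>n. \<integral>\<^sup>+\<omega>. ennreal (norm (f n \<omega>)) \<partial>M)"
      by (rule nn_integral_liminf) auto
    also have "\<dots> \<le> ennreal B"
    proof (rule Liminf_le, simp)
      show "\<forall>\<^sub>F n in sequentially. (\<integral>\<^sup>+\<omega>. ennreal (norm (f n \<omega>)) \<partial>M) \<le> ennreal B"
        using bnd[OF fC] by (intro always_eventually allI) (subst nn_integral_eq_integral; auto intro!: ennreal_leI)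
    qed
    also have "\<dots> < \<infinity>" by simp
    finally show "(\<integral>\<^sup>+\<omega>. ennreal (norm (h \<omega>)) \<partial>M) < \<infinity>" .
  qed simp
  then show ?thesis using fC lim by blast
qed

text \<open>\<open>N\<close> is so large that violating \<open>Q x \<le> \<delta>\<close> costs more
  than \<open>J\<close> can gain, and \<open>z\<close> nearly maximises \<open>J - N * Q\<close>.
  Comparing \<open>z\<close> with a short move towards \<open>x\<close> and dividing by its length
  \<open>u\<close> leaves the linear term of the penalty, which acts as the multiplier.
  \<open>Qmix\<close> is modelled on a quadratic form \<open>Q\<close> with polar form
  \<open>D\<close>: the weights 1 - 2u and 2u are (1 - u)^2 and 2u(1 - u) up to terms of order u^2,
  which go into \<open>c\<close>.\<close>

lemma approximate_penalty_multiplier: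
  fixes K :: "'x set" and mix :: "real \<Rightarrow> 'x \<Rightarrow> 'x \<Rightarrow> 'x" and J Q :: "'x \<Rightarrow> real"
  assumes ne: "K \<noteq> {}"
    and mixK: "\<And>x y u. x \<in> K \<Longrightarrow> y \<in> K \<Longrightarrow> 0 \<le> u \<Longrightarrow> u \<le> 1 \<Longrightarrow> mix u x y \<in> K"
    and conc: "\<And>x y u. x \<in> K \<Longrightarrow> y \<in> K \<Longrightarrow> 0 \<le> u \<Longrightarrow> u \<le> 1 \<Longrightarrow> (1 - u) * J x + u * J y \<le> J (mix u x y)"
    and Q0: "\<And>x. x \<in> K \<Longrightarrow> 0 \<le> Q x"
    and Qmix: "\<And>x z u. x \<in> K \<Longrightarrow> z \<in> K \<Longrightarrow> 0 \<le> u \<Longrightarrow> u \<le> 1 \<Longrightarrow>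
        Q (mix u z x) \<le> (1 - 2 * u) * Q z + 2 * u * D z x + u\<^sup>2 * c"
    and bdd: "\<And>x. x \<in> K \<Longrightarrow> J x \<le> B"
    and \<delta>: "\<delta> > 0"
    and near: "\<And>x. x \<in> K \<Longrightarrow> Q x \<le> \<delta> \<Longrightarrow> J x \<le> V + \<epsilon>"
    and \<epsilon>: "\<epsilon> > 0"
  shows "\<exists>z\<in>K. \<exists>N\<ge>0. \<forall>x\<in>K. J x - N * D z x \<le> V + 3 * \<epsilon>"
proof -
  define N where "N = max 0 ((B - V) / \<delta>)"
  have N0: "N \<ge> 0" and N1: "B - V \<le> N * \<delta>"
    using \<delta> by (auto simp: N_def max_def field_simps)
  define \<Phi> where "\<Phi> x = J x - N * Q x" for x
  have \<Phi>V: "\<Phi> x \<le> V + \<epsilon>" if "x \<in> K" for x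
  proof (cases "Q x \<le> \<delta>")
    case True
    then show ?thesis using near[OF that] Q0[OF that] N0 by (simp add: \<Phi>_def) (smt (verit) mult_nonneg_nonneg)
  next
    case False
    then have "N * \<delta> \<le> N * Q x" using N0 by (intro mult_left_mono) auto
    then show ?thesis using bdd[OF that] N1 \<epsilon> by (simp add: \<Phi>_def)
  qed
  define c' where "c' = max c 0"
  \<comment> \<open>The remainder \<open>u * (N * c')\<close> left after division by
    \<open>u\<close> is then at most \<open>\<epsilon>\<close>. The slack
    \<open>\<epsilon> * u\<close> in the choice of \<open>z\<close> yields a second
    \<open>\<epsilon>\<close>, and the bound \<open>\<Phi>V\<close> the third.\<close>
  define u where "u = min 1 (\<epsilon> / (N * c' + 1))"
  have c'0: "c' \<ge> 0" by (simp add: c'_def)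
  have Nc: "N * c' + 1 > 0" using N0 c'0 by (smt (verit) mult_nonneg_nonneg)
  have u: "0 < u" "u \<le> 1" using \<epsilon> Nc by (auto simp: u_def)
  have uN: "u * (N * c') \<le> \<epsilon>"
  proof -
    have "u * (N * c') \<le> \<epsilon> / (N * c' + 1) * (N * c')"
      using N0 c'0 by (intro mult_right_mono) (auto simp: u_def)
    also have "\<dots> \<le> \<epsilon>" using \<epsilon> Nc by (simp add: field_simps)
    finally show ?thesis .
  qed
  have bdda: "bdd_above (\<Phi> ` K)" by (rule bdd_aboveI[of _ "V + \<epsilon>"]) (use \<Phi>V in auto)
  obtain z where z: "z \<in> K" and zs: "Sup (\<Phi> ` K) - \<epsilon> * u < \<Phi> z"
    using less_cSupD[of "\<Phi> ` K" "Sup (\<Phi> ` K) - \<epsilon> * u"] ne \<epsilon> u by auto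
  have "J x - 2 * N * D z x \<le> V + 3 * \<epsilon>" if x: "x \<in> K" for x
  proof -
    have m: "mix u z x \<in> K" using mixK z x u by simp
    have "\<Phi> (mix u z x) \<le> \<Phi> z + \<epsilon> * u"
      using cSup_upper[OF imageI[OF m] bdda] zs by linarith
    moreover have "(1 - u) * J z + u * J x \<le> J (mix u z x)" using conc z x u by simp
    moreover have "N * Q (mix u z x) \<le> N * ((1 - 2 * u) * Q z + 2 * u * D z x + u\<^sup>2 * c)"
      using Qmix[OF x z] u N0 by (intro mult_left_mono) auto
    ultimately have "(1 - u) * J z + u * J x - N * ((1 - 2 * u) * Q z + 2 * u * D z x + u\<^sup>2 * c)
        \<le> J z - N * Q z + \<epsilon> * u"
      unfolding \<Phi>_def by linarith
    then have "u * (J x - 2 * N * D z x) \<le> u * (J z - 2 * (N * Q z) + u * (N * c) + \<epsilon>)"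
      by (simp add: algebra_simps power2_eq_square)
    then have "J x - 2 * N * D z x \<le> J z - 2 * (N * Q z) + u * (N * c) + \<epsilon>"
      using u by simp
    also have "u * (N * c) \<le> u * (N * c')"
      using u N0 by (intro mult_left_mono) (auto simp: c'_def)
    also have "J z - 2 * (N * Q z) \<le> \<Phi> z" using N0 Q0[OF z] by (simp add: \<Phi>_def)
    finally show ?thesis using \<Phi>V[OF z] uN by linarith
  qed
  \<comment> \<open>Differentiating the quadratic penalty doubles the coefficient.\<close>
  then show ?thesis using z N0 by (intro bexI[of _ z] exI[of _ "2 * N"]) auto
qed

section \<open>Programs\<close>

lemma vec_nth_measurable [measurable]:
  "(\<lambda>v :: 'a::euclidean_space ^ 'n::finite. v $ i) \<in> borel_measurable borel"
  by (intro borel_measurable_continuous_onI linear_continuous_on bounded_linear_vec_nth)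

lemma bounded_linear_axis:
  "bounded_linear (axis i :: 'a::euclidean_space \<Rightarrow> 'a ^ 'n::finite)"
  by (rule linear_conv_bounded_linear[THEN iffD1]) (auto intro!: linearI simp: vec_eq_iff axis_def)

lemma axis_measurable [measurable]:
  "(axis i :: 'a::euclidean_space \<Rightarrow> 'a ^ 'n::finite) \<in> borel_measurable borel"
  by (intro borel_measurable_continuous_onI linear_continuous_on bounded_linear_axis)

lemma vec_lambda_eq_sum_axis:
  fixes f :: "'n::finite \<Rightarrow> 'a::euclidean_space"
  shows "(\<chi> i. f i) = (\<Sum>i\<in>UNIV. axis i (f i))"
  by (auto simp: vec_eq_iff axis_def if_distrib[of "\<lambda>x. x $ _"] sum.delta' cong: if_cong)

lemma vec_lambda_measurable:
  fixes f :: "'n::finite \<Rightarrow> 'o \<Rightarrow> 'a::euclidean_space"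
  assumes [measurable]: "\<And>i. f i \<in> borel_measurable M"
  shows "(\<lambda>\<omega>. \<chi> i. f i \<omega>) \<in> borel_measurable M"
  unfolding vec_lambda_eq_sum_axis by measurable

lemma integrable_vec_lambda:
  fixes f :: "'n::finite \<Rightarrow> 'o \<Rightarrow> 'a::euclidean_space"
  assumes "\<And>i. integrable M (f i)"
  shows "integrable M (\<lambda>\<omega>. \<chi> i. f i \<omega>)"
  unfolding vec_lambda_eq_sum_axis
  by (intro Bochner_Integration.integrable_sum integrable_bounded_linear[OF bounded_linear_axis] assms)

lemma norm_vec_le_sum: "norm (v :: 'a::real_normed_vector ^ 'n::finite) \<le> (\<Sum>i\<in>UNIV. norm (v $ i))"
  unfolding norm_vec_def by (rule L2_set_le_sum) simp

lemma integrable_nth: "integrable M f \<Longrightarrow> integrable M (\<lambda>\<omega>. f \<omega> $ t)"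
  for f :: "'o \<Rightarrow> 'b::euclidean_space ^ 'n::finite"
  using integrable_bounded_linear[OF bounded_linear_vec_nth] by blast

text \<open>\<open>G\<close> need not contain the null sets of \<open>M\<close>, so an almost sure
  limit of \<open>G\<close>-measurable functions has to be redefined. The set where the sequence is
  Cauchy is \<open>G\<close>-measurable, and the value 0 off it keeps the function in
  \<open>S\<close> at every point of \<open>\<Omega>\<close>, as programs and multipliers must have
  their values in the right subspace everywhere.\<close>

lemma measurable_limit_in_closed:
  fixes f :: "nat \<Rightarrow> 'a \<Rightarrow> 'b::euclidean_space"
  assumes f [measurable]: "\<And>n. f n \<in> borel_measurable G"
    and lim: "AE \<omega> in M. (\<lambda>n. f n \<omega>) \<longlonglongrightarrow> h \<omega>"
    and S: "closed S" "0 \<in> S" "\<And>n \<omega>. \<omega> \<in> \<Omega> \<Longrightarrow> f n \<omega> \<in> S"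
  shows "\<exists>p. p \<in> borel_measurable G \<and> (\<forall>\<omega>\<in>\<Omega>. p \<omega> \<in> S) \<and> (AE \<omega> in M. p \<omega> = h \<omega>)"
proof (intro exI conjI ballI)
  define p where "p \<omega> = (if Cauchy (\<lambda>n. f n \<omega>) then lim (\<lambda>n. f n \<omega>) else 0)" for \<omega>
  show "p \<in> borel_measurable G" unfolding p_def by measurable
  show "p \<omega> \<in> S" if w: "\<omega> \<in> \<Omega>" for \<omega>
  proof (cases "Cauchy (\<lambda>n. f n \<omega>)")
    case True
    then have "(\<lambda>n. f n \<omega>) \<longlonglongrightarrow> p \<omega>"
      using Cauchy_convergent[OF True] unfolding p_def by (simp add: convergent_LIMSEQ_iff)
    with S(3)[OF w] show ?thesis by (rule closed_sequentially[OF S(1)])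
  next
    case False
    then show ?thesis unfolding p_def using S(2) by simp
  qed
  show "AE \<omega> in M. p \<omega> = h \<omega>" using lim
  proof eventually_elim
    case (elim \<omega>)
    then show ?case unfolding p_def by (auto simp: limI dest: LIMSEQ_imp_Cauchy)
  qed
qed

definition mix :: "real \<Rightarrow> ('t \<Rightarrow> 'o \<Rightarrow> 'b::real_vector) \<Rightarrow> ('t \<Rightarrow> 'o \<Rightarrow> 'b) \<Rightarrow> 't \<Rightarrow> 'o \<Rightarrow> 'b" where
  "mix u x y = (\<lambda>t \<omega>. (1 - u) *\<^sub>R x t \<omega> + u *\<^sub>R y t \<omega>)"

lemma closed_coord_space: "closed (coord_space I)"
proof -
  have "coord_space I = (\<Inter>i\<in>-I. {v. v $ i = 0})" by (auto simp: coord_space_def)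
  then show ?thesis
    by (auto intro!: closed_INT closed_Collect_eq continuous_intros)
qed

lemma subspace_coord_space: "subspace (coord_space I)"
  by (auto simp: subspace_def coord_space_def)

section \<open>Consequences of the model and of conditions (A) and (B)\<close>

locale team_problem =
  fixes D :: "('o, 't::{finite,order}, 'v::finite, 'w::finite) team"
  assumes model: "team_model D"
    and condA: "cond_A D" and condB: "cond_B D" and condC: "cond_C D"
    and condD: "cond_D D" and condE: "cond_E D" and condF: "cond_F D"
begin

abbreviation "M \<equiv> pspace D"

sublocale prob_space M
  using model by (simp add: team_model_def)

lemma subalg: "subalgebra M (info D t)"
  using model by (simp add: team_model_def)

lemma info_mono: "t \<le> s \<Longrightarrow> sets (info D t) \<subseteq> sets (info D s)"
  using model by (cases "t = s") (auto simp: team_model_def)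

lemma space_info [simp]: "space (info D t) = space M"
  using subalg by (auto simp: subalgebra_def)

lemma sets_info: "sets (info D t) \<subseteq> sets M"
  using subalg by (auto simp: subalgebra_def)

lemma info_measurable_mono:
  "t \<le> s \<Longrightarrow> f \<in> measurable (info D t) N \<Longrightarrow> f \<in> measurable (info D s) N"
  using info_mono[of t s] by (auto simp: measurable_def)

lemma info_measurable: "f \<in> measurable (info D t) N \<Longrightarrow> f \<in> measurable M N"
  using measurable_from_subalg[OF subalg] by blast

lemma actions_Vsp: "\<omega> \<in> space M \<Longrightarrow> actions D t \<omega> \<subseteq> Vsp D t"
  using model by (auto simp: team_model_def)

lemma subspace_Vsp: "subspace (Vsp D t)" by (simp add: Vsp_def subspace_coord_space)
lemma closed_Vsp: "closed (Vsp D t)" by (simp add: Vsp_def closed_coord_space)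

lemma convex_actions: "\<omega> \<in> space M \<Longrightarrow> convex (actions D t \<omega>)"
  and closed_actions: "\<omega> \<in> space M \<Longrightarrow> closed (actions D t \<omega>)"
  using condA by (auto simp: cond_A_def)

lemma actions_bounded: "\<exists>K\<ge>0. \<forall>t. \<forall>\<omega>\<in>space M. \<forall>a\<in>actions D t \<omega>. norm a \<le> K"
proof -
  obtain K where K: "\<And>t \<omega> a. \<omega> \<in> space M \<Longrightarrow> a \<in> actions D t \<omega> \<Longrightarrow> norm a \<le> K t"
    using condA unfolding cond_A_def by metis
  have "K t \<le> (\<Sum>t\<in>UNIV. \<bar>K t\<bar>)" for t
    using member_le_sum[of t UNIV "\<lambda>t. \<bar>K t\<bar>"] by (smt (verit) UNIV_I abs_ge_zero finite)
  then show ?thesis using K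
    by (intro exI[of _ "\<Sum>t\<in>UNIV. \<bar>K t\<bar>"] conjI allI ballI sum_nonneg) (auto, meson order_trans)
qed

definition action_bound where "action_bound = (SOME K. K \<ge> 0 \<and> (\<forall>t. \<forall>\<omega>\<in>space M. \<forall>a\<in>actions D t \<omega>. norm a \<le> K))"

lemma action_bound: "action_bound \<ge> 0" "\<omega> \<in> space M \<Longrightarrow> a \<in> actions D t \<omega> \<Longrightarrow> norm a \<le> action_bound"
proof -
  have "action_bound \<ge> 0 \<and> (\<forall>t. \<forall>\<omega>\<in>space M. \<forall>a\<in>actions D t \<omega>. norm a \<le> action_bound)"
    unfolding action_bound_def by (rule someI_ex[OF actions_bounded])
  then show "action_bound \<ge> 0" "\<omega> \<in> space M \<Longrightarrow> a \<in> actions D t \<omega> \<Longrightarrow> norm a \<le> action_bound" by blast+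
qed

lemma constr_bounded: "\<exists>c\<ge>0. \<forall>t. \<forall>\<omega>\<in>space M. \<forall>a\<in>Vupto D t. norm (constr D t \<omega> a) \<le> c"
proof -
  obtain c where "\<forall>t. \<forall>\<omega>\<in>space M. \<forall>a\<in>Vupto D t. norm (constr D t \<omega> a) \<le> c"
    using condB unfolding cond_B_def by blast
  then show ?thesis by (intro exI[of _ "max c 0"]) (auto simp: le_max_iff_disj)
qed

definition constr_bound where "constr_bound = (SOME c. c \<ge> 0 \<and> (\<forall>t. \<forall>\<omega>\<in>space M. \<forall>a\<in>Vupto D t. norm (constr D t \<omega> a) \<le> c))"

lemma constr_bound: "constr_bound \<ge> 0" "\<omega> \<in> space M \<Longrightarrow> a \<in> Vupto D t \<Longrightarrow> norm (constr D t \<omega> a) \<le> constr_bound"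
proof -
  have "constr_bound \<ge> 0 \<and> (\<forall>t. \<forall>\<omega>\<in>space M. \<forall>a\<in>Vupto D t. norm (constr D t \<omega> a) \<le> constr_bound)"
    unfolding constr_bound_def by (rule someI_ex[OF constr_bounded])
  then show "constr_bound \<ge> 0" "\<omega> \<in> space M \<Longrightarrow> a \<in> Vupto D t \<Longrightarrow> norm (constr D t \<omega> a) \<le> constr_bound" by blast+
qed

lemma programD:
  assumes "x \<in> programs D"
  shows "x t \<in> borel_measurable M" "\<omega> \<in> space M \<Longrightarrow> x t \<omega> \<in> Vsp D t"
    "AE \<omega> in M. x t \<omega> \<in> actions D t \<omega>"
proof -
  show "x t \<in> borel_measurable M" "AE \<omega> in M. x t \<omega> \<in> actions D t \<omega>"
    using assms unfolding programs_def by blast+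
  show "x t \<omega> \<in> Vsp D t" if "\<omega> \<in> space M"
    using assms that unfolding programs_def by blast
qed

lemma program_bounded:
  assumes "x \<in> programs D"
  shows "AE \<omega> in M. norm (x t \<omega>) \<le> action_bound"
  using programD(3)[OF assms, of t] AE_space by eventually_elim (rule action_bound(2))

lemma program_integrable: "x \<in> programs D \<Longrightarrow> integrable M (x t)"
  using program_bounded programD(1) by (intro integrable_const_bound) auto

lemma program_upto: "x \<in> programs D \<Longrightarrow> \<omega> \<in> space M \<Longrightarrow> upto_vec t x \<omega> \<in> Vupto D t"
  by (auto simp: upto_vec_def Vupto_def prod_upto_def programD)

lemma program_upto_actions: "x \<in> programs D \<Longrightarrow> AE \<omega> in M. upto_vec t x \<omega> \<in> Aupto D t \<omega>"
proof -
  assume "x \<in> programs D"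
  then have "AE \<omega> in M. \<forall>i\<in>UNIV. x i \<omega> \<in> actions D i \<omega>"
    by (intro AE_finite_allI programD(3)) auto
  then show ?thesis
    by eventually_elim (auto simp: upto_vec_def Aupto_def prod_upto_def)
qed

lemma constr_at_bounded: "x \<in> programs D \<Longrightarrow> \<omega> \<in> space M \<Longrightarrow> norm (constr_at D t x \<omega>) \<le> constr_bound"
  unfolding constr_at_def by (intro constr_bound program_upto)

lemma constr_Wsp: "\<omega> \<in> space M \<Longrightarrow> a \<in> Vupto D t \<Longrightarrow> constr D t \<omega> a \<in> Wsp D t"
  using model by (simp add: team_model_def)

lemma constr_at_Wsp: "x \<in> programs D \<Longrightarrow> \<omega> \<in> space M \<Longrightarrow> constr_at D t x \<omega> \<in> Wsp D t"
  unfolding constr_at_def by (rule constr_Wsp[OF _ program_upto])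

lemma constr_at_cong: "(\<And>i. i \<le> t \<Longrightarrow> x i \<omega> = y i \<omega>) \<Longrightarrow> constr_at D t x \<omega> = constr_at D t y \<omega>"
  unfolding constr_at_def upto_vec_def by (intro arg_cong[where f="constr D t \<omega>"]) (auto simp: vec_eq_iff)

text \<open>With \<open>N\<close> equal to \<open>M\<close> this serves arbitrary programs, with
  \<open>N\<close> the information of \<open>t\<close> it serves adapted ones. The joint
  measurability in (B) refers to the product with \<open>Vupto D t\<close>, so the profile of
  actions must lie there at every point.\<close>

lemma constr_at_measurable_sub:
  assumes x: "x \<in> programs D" and N: "sets (info D t) \<subseteq> sets N" "space N = space M"
    and m: "\<And>i. i \<le> t \<Longrightarrow> x i \<in> borel_measurable N"
  shows "constr_at D t x \<in> borel_measurable N"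
proof -
  have 1: "upto_vec t x \<in> borel_measurable N" unfolding upto_vec_def
  proof (rule vec_lambda_measurable)
    show "(\<lambda>\<omega>. if i \<le> t then x i \<omega> else 0) \<in> borel_measurable N" for i
      using m[of i] by (cases "i \<le> t") auto
  qed
  have sub: "subalgebra N (info D t)" using N by (simp add: subalgebra_def)
  have "(\<lambda>\<omega>. (\<omega>, upto_vec t x \<omega>)) \<in> measurable N (info D t \<Otimes>\<^sub>M restrict_space borel (Vupto D t))"
  proof (rule measurable_Pair)
    show "(\<lambda>\<omega>. \<omega>) \<in> measurable N (info D t)"
      by (rule measurable_from_subalg[OF sub]) simp
    show "upto_vec t x \<in> measurable N (restrict_space borel (Vupto D t))"
      using 1 program_upto[OF x] N by (intro measurable_restrict_space2) auto
  qed
  moreover have "(\<lambda>(\<omega>, a). constr D t \<omega> a)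
        \<in> borel_measurable (info D t \<Otimes>\<^sub>M restrict_space borel (Vupto D t))"
    using condB by (simp add: cond_B_def)
  ultimately show ?thesis
    unfolding constr_at_def by (auto dest: measurable_compose)
qed

lemma constr_at_measurable: "x \<in> programs D \<Longrightarrow> constr_at D t x \<in> borel_measurable M"
  by (rule constr_at_measurable_sub) (use sets_info programD(1) in auto)

lemma adapted_program: "x \<in> adapted D \<Longrightarrow> x \<in> programs D"
  by (simp add: adapted_def)

lemma adaptedD: "x \<in> adapted D \<Longrightarrow> x t \<in> borel_measurable (info D t)"
  by (simp add: adapted_def)

lemma constr_at_measurable_info: "x \<in> adapted D \<Longrightarrow> constr_at D t x \<in> borel_measurable (info D t)"
proof (rule constr_at_measurable_sub)
  show "x i \<in> borel_measurable (info D t)" if "x \<in> adapted D" "i \<le> t" for i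
    using info_measurable_mono[OF that(2) adaptedD[OF that(1)]] .
qed (auto simp: adapted_program)

lemma constr_at_inner_integrable:
  assumes "x \<in> programs D" "integrable M p"
  shows "integrable M (\<lambda>\<omega>. p \<omega> \<bullet> constr_at D t x \<omega>)"
proof (rule Bochner_Integration.integrable_bound[where f="\<lambda>\<omega>. constr_bound * norm (p \<omega>)"])
  show "(\<lambda>\<omega>. p \<omega> \<bullet> constr_at D t x \<omega>) \<in> borel_measurable M"
    using assms constr_at_measurable by (intro borel_measurable_inner) auto
  show "AE \<omega> in M. norm (p \<omega> \<bullet> constr_at D t x \<omega>) \<le> norm (constr_bound * norm (p \<omega>))"
  proof (rule AE_I2)
    fix \<omega> assume "\<omega> \<in> space M"
    then have "\<bar>p \<omega> \<bullet> constr_at D t x \<omega>\<bar> \<le> norm (p \<omega>) * constr_bound"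
      using constr_at_bounded[OF assms(1)]
      by (meson Cauchy_Schwarz_ineq2 mult_left_mono norm_ge_zero order_trans)
    then show "norm (p \<omega> \<bullet> constr_at D t x \<omega>) \<le> norm (constr_bound * norm (p \<omega>))"
      using constr_bound(1) by (simp add: mult.commute)
  qed
qed (use assms in auto)

lemma constr_at_concave:
  assumes x: "x \<in> programs D" and y: "y \<in> programs D" and u: "0 \<le> u" "u \<le> 1"
  shows "AE \<omega> in M. (1 - u) *\<^sub>R constr_at D t x \<omega> + u *\<^sub>R constr_at D t y \<omega> \<le> constr_at D t (mix u x y) \<omega>"
  using program_upto_actions[OF x, of t] program_upto_actions[OF y, of t] AE_space
proof eventually_elim
  case (elim \<omega>)
  have "(1 - u) * constr_at D t x \<omega> $ i + u * constr_at D t y \<omega> $ i \<le> constr_at D t (mix u x y) \<omega> $ i" for i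
  proof -
    have m: "upto_vec t (mix u x y) \<omega> = (1 - u) *\<^sub>R upto_vec t x \<omega> + u *\<^sub>R upto_vec t y \<omega>"
      by (auto simp: upto_vec_def mix_def vec_eq_iff)
    show ?thesis
    proof (cases "i \<in> wcoords D t")
      case True
      then have "concave_on (Aupto D t \<omega>) (\<lambda>a. constr D t \<omega> a $ i)"
        using condB elim(3) by (auto simp: cond_B_def)
      from concave_onD[OF this u elim(1,2)] show ?thesis
        unfolding constr_at_def m .
    next
      \<comment> \<open>(B) gives concavity only for the coordinates of \<open>W_t\<close>. The
        others vanish on both sides, at the mixture too because its profile lies in
        \<open>Vupto D t\<close>.\<close>
      case False
      have "constr_at D t x \<omega> $ i = 0" "constr_at D t y \<omega> $ i = 0"
        using False constr_at_Wsp[OF x elim(3)] constr_at_Wsp[OF y elim(3)]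
        by (auto simp: Wsp_def coord_space_def)
      moreover have "constr_at D t (mix u x y) \<omega> \<in> Wsp D t"
      proof -
        have "upto_vec t (mix u x y) \<omega> \<in> Vupto D t"
          using elim(3) x y subspace_Vsp[unfolded subspace_def]
          by (auto simp: upto_vec_def mix_def Vupto_def prod_upto_def programD)
        then show ?thesis unfolding constr_at_def by (rule constr_Wsp[OF elim(3)])
      qed
      ultimately show ?thesis using False by (auto simp: Wsp_def coord_space_def)
    qed
  qed
  then show ?case by (simp add: less_eq_vec_def)
qed

lemma programs_mix:
  assumes x: "x \<in> programs D" and y: "y \<in> programs D" and u: "0 \<le> u" "u \<le> 1"
  shows "mix u x y \<in> programs D"
  unfolding programs_def
proof (intro CollectI allI conjI ballI)
  fix t
  show "mix u x y t \<in> borel_measurable M"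
    using programD(1)[OF x, of t] programD(1)[OF y, of t] unfolding mix_def by measurable
  show "mix u x y t \<omega> \<in> Vsp D t" if "\<omega> \<in> space M" for \<omega>
    using programD(2)[OF x that] programD(2)[OF y that] subspace_Vsp
    unfolding mix_def by (simp add: subspace_add subspace_scale)
  show "AE \<omega> in M. mix u x y t \<omega> \<in> actions D t \<omega>"
    using programD(3)[OF x, of t] programD(3)[OF y, of t] AE_space
  proof eventually_elim
    case (elim \<omega>)
    then show ?case using convex_actions[OF elim(3)] u unfolding mix_def
      by (intro convexD) auto
  qed
qed

text \<open>Continuity of \<open>g_t\<close> is available only on the product of the action sets.
  Hence one null set is discarded outside which all profiles of the sequence, and that of the limit,
  lie in \<open>Aupto D t \<omega>\<close>.\<close>

lemma constr_at_tendsto: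
  assumes x: "x \<in> programs D" and X: "\<And>k::nat. X k \<in> programs D"
    and lim: "\<And>t. AE \<omega> in M. (\<lambda>k. X k t \<omega>) \<longlonglongrightarrow> x t \<omega>"
  shows "AE \<omega> in M. (\<lambda>k. constr_at D t (X k) \<omega>) \<longlonglongrightarrow> constr_at D t x \<omega>"
proof -
  have "AE \<omega> in M. \<forall>k. upto_vec t (X k) \<omega> \<in> Aupto D t \<omega>"
    using program_upto_actions[OF X] by (simp add: AE_all_countable)
  moreover have "AE \<omega> in M. \<forall>t\<in>UNIV. (\<lambda>k. X k t \<omega>) \<longlonglongrightarrow> x t \<omega>"
    using lim by (intro AE_finite_allI) auto
  ultimately show ?thesis using program_upto_actions[OF x, of t] AE_space
  proof eventually_elim
    case (elim \<omega>)
    have "continuous_on (Aupto D t \<omega>) (constr D t \<omega>)" using condB elim(4) by (auto simp: cond_B_def)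
    moreover have "(\<lambda>k. upto_vec t (X k) \<omega>) \<longlonglongrightarrow> upto_vec t x \<omega>"
      unfolding upto_vec_def using elim(2) by - (rule vec_tendstoI, auto)
    ultimately show ?case unfolding constr_at_def
      using elim(1,3) by (intro continuous_on_tendsto_compose[where f="constr D t \<omega>"]) auto
  qed
qed

section \<open>Sequential compactness of convex sets of programs\<close>

definition progs :: "('t \<Rightarrow> 'o measure) \<Rightarrow> ('t \<Rightarrow> 'o \<Rightarrow> real^'v) set" where
  "progs G = {x \<in> programs D. \<forall>t. x t \<in> borel_measurable (G t)}"

lemma adapted_eq_progs: "adapted D = progs (info D)"
  by (simp add: adapted_def progs_def)

lemma programs_eq_progs: "programs D = progs (\<lambda>_. M)"
  by (auto simp: programs_def progs_def)

lemma progs_mix: "x \<in> progs G \<Longrightarrow> y \<in> progs G \<Longrightarrow> 0 \<le> u \<Longrightarrow> u \<le> 1 \<Longrightarrow> mix u x y \<in> progs G"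
  unfolding progs_def mix_def using programs_mix[of x y u, unfolded mix_def]
  by (auto intro!: borel_measurable_add borel_measurable_scaleR borel_measurable_const)

lemma adapted_mix: "x \<in> adapted D \<Longrightarrow> y \<in> adapted D \<Longrightarrow> 0 \<le> u \<Longrightarrow> u \<le> 1 \<Longrightarrow> mix u x y \<in> adapted D"
  by (simp add: adapted_eq_progs progs_mix)

text \<open>The family \<open>G\<close> makes one statement cover both adapted programs and
  arbitrary ones. All components are packed into a single vector, so one selection converges in
  every component at once. Boundedness of the action sets supplies the L1 bound, and their
  closedness keeps the limit inside them.\<close>

lemma progs_selection:
  assumes G: "\<And>t. subalgebra M (G t)"
    and dec: "decseq K" and ne: "\<And>n. K n \<noteq> {}" and sub: "\<And>n. K n \<subseteq> progs G"
    and mid: "\<And>n x y. x \<in> K n \<Longrightarrow> y \<in> K n \<Longrightarrow> mix (1/2) x y \<in> K n"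
  shows "\<exists>X x. (\<forall>n. X n \<in> K n) \<and> x \<in> progs G \<and> (\<forall>t. AE \<omega> in M. (\<lambda>n. X n t \<omega>) \<longlonglongrightarrow> x t \<omega>)"
proof -
  define emb where "emb x = (\<lambda>\<omega>. \<chi> t. x t \<omega>)" for x :: "'t \<Rightarrow> 'o \<Rightarrow> real^'v"
  have KP: "x \<in> programs D" if "x \<in> K n" for x n using that sub by (auto simp: progs_def)
  have nb: "AE \<omega> in M. norm (emb x \<omega>) \<le> real CARD('t) * action_bound" if x: "x \<in> programs D" for x
  proof -
    have "AE \<omega> in M. \<forall>t\<in>UNIV. norm (x t \<omega>) \<le> action_bound"
      using program_bounded[OF x] by (intro AE_finite_allI) auto
    then show ?thesis
    proof eventually_elim
      case (elim \<omega>)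
      have "norm (emb x \<omega>) \<le> (\<Sum>t\<in>UNIV. norm (x t \<omega>))"
        using norm_vec_le_sum[of "emb x \<omega>"] by (simp add: emb_def)
      also have "\<dots> \<le> (\<Sum>t\<in>(UNIV::'t set). action_bound)" using elim by (intro sum_mono) auto
      finally show ?case by simp
    qed
  qed
  have ie: "integrable M (emb x)" if "x \<in> programs D" for x
    unfolding emb_def using program_integrable[OF that] by (rule integrable_vec_lambda)
  have "\<exists>f h. (\<forall>n. f n \<in> emb ` K n) \<and> integrable M h \<and> (AE \<omega> in M. (\<lambda>n. f n \<omega>) \<longlonglongrightarrow> h \<omega>)"
  proof (rule AE_convergent_selection)
    show "decseq (\<lambda>n. emb ` K n)" using dec unfolding decseq_def by blast
    show "emb ` K n \<noteq> {}" for n using ne by auto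
    show "integrable M f" if "f \<in> emb ` K n" for n f using that KP ie by auto
    show "(\<integral>\<omega>. norm (f \<omega>) \<partial>M) \<le> real CARD('t) * action_bound" if f: "f \<in> emb ` K n" for n f
    proof -
      from f obtain x where x: "x \<in> programs D" "f = emb x" using KP by auto
      have "(\<integral>\<omega>. norm (f \<omega>) \<partial>M) \<le> (\<integral>\<omega>. real CARD('t) * action_bound \<partial>M)"
        using x nb[OF x(1)] ie[OF x(1)] by (intro integral_mono_AE) auto
      then show ?thesis by (simp add: prob_space)
    qed
    show "(\<lambda>\<omega>. (1/2) *\<^sub>R (f \<omega> + g \<omega>)) \<in> emb ` K n" if f: "f \<in> emb ` K n" "g \<in> emb ` K n" for n f g
    proof -
      from f obtain x y where xy: "x \<in> K n" "y \<in> K n" "f = emb x" "g = emb y" by auto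
      then have "(\<lambda>\<omega>. (1/2) *\<^sub>R (f \<omega> + g \<omega>)) = emb (mix (1/2) x y)"
        by (auto simp: emb_def mix_def vec_eq_iff scaleR_add_right)
      then show ?thesis using mid xy by auto
    qed
  qed
  then obtain f h where f: "\<And>n. f n \<in> emb ` K n" and h: "AE \<omega> in M. (\<lambda>n. f n \<omega>) \<longlonglongrightarrow> h \<omega>" by blast
  have "\<forall>n. \<exists>y. y \<in> K n \<and> f n = emb y" using f by blast
  from choice[OF this] obtain X where X: "\<And>n. X n \<in> K n" "\<And>n. f n = emb (X n)" by blast
  have XG: "X n t \<in> borel_measurable (G t)" for n t using X(1)[of n] sub[of n] by (auto simp: progs_def)
  have "AE \<omega> in M. (\<lambda>n. X n t \<omega>) \<longlonglongrightarrow> h \<omega> $ t" for t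
    using h
  proof eventually_elim
    case (elim \<omega>)
    then have "(\<lambda>n. f n \<omega> $ t) \<longlonglongrightarrow> h \<omega> $ t" by (rule tendsto_vec_nth)
    then show ?case by (simp add: X emb_def)
  qed
  \<comment> \<open>The limit is corrected component by component because \<open>G t\<close> varies
    with \<open>t\<close>.\<close>
  then have "\<exists>p. p \<in> borel_measurable (G t) \<and> (\<forall>\<omega>\<in>space M. p \<omega> \<in> Vsp D t) \<and> (AE \<omega> in M. p \<omega> = h \<omega> $ t)" for t
    by (rule measurable_limit_in_closed[OF XG _ closed_Vsp subspace_0[OF subspace_Vsp]])
      (rule programD(2)[OF KP[OF X(1)]])
  then have "\<forall>t. \<exists>p. p \<in> borel_measurable (G t) \<and> (\<forall>\<omega>\<in>space M. p \<omega> \<in> Vsp D t) \<and> (AE \<omega> in M. p \<omega> = h \<omega> $ t)"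
    by blast
  from choice[OF this] obtain x where xm: "\<And>t. x t \<in> borel_measurable (G t)"
    and xV: "\<And>t. \<forall>\<omega>\<in>space M. x t \<omega> \<in> Vsp D t" and xh: "\<And>t. AE \<omega> in M. x t \<omega> = h \<omega> $ t"
    by blast
  have lim: "AE \<omega> in M. (\<lambda>n. X n t \<omega>) \<longlonglongrightarrow> x t \<omega>" for t
    using h xh[of t]
  proof eventually_elim
    case (elim \<omega>)
    from elim(1) have "(\<lambda>n. f n \<omega> $ t) \<longlonglongrightarrow> h \<omega> $ t" by (rule tendsto_vec_nth)
    then show ?case using elim(2) by (simp add: X emb_def)
  qed
  have "x \<in> programs D" unfolding programs_def
  proof (intro CollectI allI conjI ballI)
    fix t
    show "x t \<in> borel_measurable M" using measurable_from_subalg[OF G xm] .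
    show "x t \<omega> \<in> Vsp D t" if w: "\<omega> \<in> space M" for \<omega>
      using xV w by blast
    have "AE \<omega> in M. \<forall>n. X n t \<omega> \<in> actions D t \<omega>"
      using programD(3)[OF KP[OF X(1)]] by (simp add: AE_all_countable)
    then show "AE \<omega> in M. x t \<omega> \<in> actions D t \<omega>" using lim[of t] AE_space
    proof eventually_elim
      case (elim \<omega>)
      then have "\<And>n. X n t \<omega> \<in> actions D t \<omega>" by blast
      then show ?case using elim(2) by (rule closed_sequentially[OF closed_actions[OF elim(3)]])
    qed
  qed
  then have "x \<in> progs G" using xm by (simp add: progs_def)
  then show ?thesis using X(1) lim by blast
qed

section \<open>Concave functionals continuous for almost sure convergence\<close>

definition AE_tendsto :: "(nat \<Rightarrow> 't \<Rightarrow> 'o \<Rightarrow> real^'v) \<Rightarrow> ('t \<Rightarrow> 'o \<Rightarrow> real^'v) \<Rightarrow> bool" where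
  "AE_tendsto X x \<longleftrightarrow> (\<forall>t. AE \<omega> in M. (\<lambda>k. X k t \<omega>) \<longlonglongrightarrow> x t \<omega>)"

text \<open>(C) detached from the payoff. The property survives the addition of multiplier terms, so
  a payoff with some constraints already relaxed can take the place of the original one.\<close>

definition concave_continuous :: "(('t \<Rightarrow> 'o \<Rightarrow> real^'v) \<Rightarrow> real) \<Rightarrow> bool" where
  "concave_continuous J \<longleftrightarrow>
     (\<forall>x\<in>programs D. \<forall>y\<in>programs D. \<forall>u\<in>{0..1}. (1 - u) * J x + u * J y \<le> J (mix u x y)) \<and>
     (\<forall>x\<in>programs D. \<forall>X. (\<forall>k. X k \<in> programs D) \<longrightarrow> AE_tendsto X x \<longrightarrow> (\<lambda>k. J (X k)) \<longlonglongrightarrow> J x)"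

lemma concave_continuous_payoff: "concave_continuous (payoff D)"
  using condC by (simp add: cond_C_def concave_continuous_def mix_def AE_tendsto_def)

lemma concave_continuousD:
  assumes "concave_continuous J"
  shows "x \<in> programs D \<Longrightarrow> y \<in> programs D \<Longrightarrow> 0 \<le> u \<Longrightarrow> u \<le> 1 \<Longrightarrow> (1 - u) * J x + u * J y \<le> J (mix u x y)"
    "x \<in> programs D \<Longrightarrow> (\<And>k. X k \<in> programs D) \<Longrightarrow> AE_tendsto X x \<Longrightarrow> (\<lambda>k. J (X k)) \<longlonglongrightarrow> J x"
proof -
  show "(1 - u) * J x + u * J y \<le> J (mix u x y)"
    if "x \<in> programs D" "y \<in> programs D" "0 \<le> u" "u \<le> 1"
    using assms that unfolding concave_continuous_def by simp
  show "(\<lambda>k. J (X k)) \<longlonglongrightarrow> J x"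
    if "x \<in> programs D" "\<And>k. X k \<in> programs D" "AE_tendsto X x"
    using assms that unfolding concave_continuous_def by blast
qed

lemma concave_continuous_cong_AE:
  assumes J: "concave_continuous J" and xy: "x \<in> programs D" "y \<in> programs D"
    and eq: "\<And>t. AE \<omega> in M. x t \<omega> = y t \<omega>"
  shows "J x = J y"
proof -
  have "AE_tendsto (\<lambda>_. y) x" unfolding AE_tendsto_def
  proof
    fix t show "AE \<omega> in M. (\<lambda>k. y t \<omega>) \<longlonglongrightarrow> x t \<omega>" using eq[of t] by eventually_elim simp
  qed
  then have "(\<lambda>k::nat. J y) \<longlonglongrightarrow> J x"
    using concave_continuousD(2)[OF J xy(1), of "\<lambda>_. y"] xy by auto
  then show ?thesis by (simp add: LIMSEQ_const_iff)
qed

text \<open>Non-negativity of \<open>p\<close> turns coordinate-wise concavity of \<open>g_t\<close>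
  into concavity of the added term. As \<open>g_t\<close> is bounded, |p| times
  \<open>constr_bound\<close> dominates the integrands, so integrability of \<open>p\<close> gives
  continuity.\<close>

lemma concave_continuous_add_constr:
  assumes J: "concave_continuous J" and p: "integrable M p" "\<And>\<omega>. \<omega> \<in> space M \<Longrightarrow> 0 \<le> p \<omega>"
  shows "concave_continuous (\<lambda>x. J x + (\<integral>\<omega>. p \<omega> \<bullet> constr_at D t x \<omega> \<partial>M))"
  unfolding concave_continuous_def
proof (intro conjI ballI allI impI)
  fix x y u assume x: "x \<in> programs D" and y: "y \<in> programs D" and u: "u \<in> {0..1::real}"
  then have u': "0 \<le> u" "u \<le> 1" by auto
  note i = constr_at_inner_integrable[OF x p(1), of t] constr_at_inner_integrable[OF y p(1), of t]
    constr_at_inner_integrable[OF programs_mix[OF x y u'] p(1), of t]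
  have "(1 - u) * (\<integral>\<omega>. p \<omega> \<bullet> constr_at D t x \<omega> \<partial>M) + u * (\<integral>\<omega>. p \<omega> \<bullet> constr_at D t y \<omega> \<partial>M)
     = (\<integral>\<omega>. (1 - u) * (p \<omega> \<bullet> constr_at D t x \<omega>) + u * (p \<omega> \<bullet> constr_at D t y \<omega>) \<partial>M)"
    using i by simp
  also have "\<dots> \<le> (\<integral>\<omega>. p \<omega> \<bullet> constr_at D t (mix u x y) \<omega> \<partial>M)"
  proof (rule integral_mono_AE)
    show "AE \<omega> in M. (1 - u) * (p \<omega> \<bullet> constr_at D t x \<omega>) + u * (p \<omega> \<bullet> constr_at D t y \<omega>)
        \<le> p \<omega> \<bullet> constr_at D t (mix u x y) \<omega>"
      using constr_at_concave[OF x y u', of t] AE_space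
    proof eventually_elim
      case (elim \<omega>)
      have "p \<omega> \<bullet> ((1 - u) *\<^sub>R constr_at D t x \<omega> + u *\<^sub>R constr_at D t y \<omega>) \<le> p \<omega> \<bullet> constr_at D t (mix u x y) \<omega>"
        using elim p(2)[OF elim(2)] unfolding inner_vec_def less_eq_vec_def
        by (intro sum_mono) (auto intro!: mult_left_mono)
      then show ?case by (simp add: inner_add_right)
    qed
  qed (use i in auto)
  finally show "(1 - u) * (J x + (\<integral>\<omega>. p \<omega> \<bullet> constr_at D t x \<omega> \<partial>M)) + u * (J y + (\<integral>\<omega>. p \<omega> \<bullet> constr_at D t y \<omega> \<partial>M))
      \<le> J (mix u x y) + (\<integral>\<omega>. p \<omega> \<bullet> constr_at D t (mix u x y) \<omega> \<partial>M)"
    using concave_continuousD(1)[OF J x y u'] by (simp add: distrib_left)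
next
  fix x X assume x: "x \<in> programs D" and X: "\<forall>k. X k \<in> programs D" and lim: "AE_tendsto X x"
  have "(\<lambda>k. \<integral>\<omega>. p \<omega> \<bullet> constr_at D t (X k) \<omega> \<partial>M) \<longlonglongrightarrow> (\<integral>\<omega>. p \<omega> \<bullet> constr_at D t x \<omega> \<partial>M)"
  proof (rule integral_dominated_convergence[where w="\<lambda>\<omega>. norm (p \<omega>) * constr_bound"])
    show "AE \<omega> in M. (\<lambda>k. p \<omega> \<bullet> constr_at D t (X k) \<omega>) \<longlonglongrightarrow> p \<omega> \<bullet> constr_at D t x \<omega>"
    proof -
      have "AE \<omega> in M. (\<lambda>k. constr_at D t (X k) \<omega>) \<longlonglongrightarrow> constr_at D t x \<omega>"
        using constr_at_tendsto[OF x, of X t] X lim unfolding AE_tendsto_def by blast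
      then show ?thesis by eventually_elim (intro tendsto_inner tendsto_const)
    qed
    show "AE \<omega> in M. norm (p \<omega> \<bullet> constr_at D t (X k) \<omega>) \<le> norm (p \<omega>) * constr_bound" for k
    proof (rule AE_I2)
      fix \<omega> assume "\<omega> \<in> space M"
      then have "norm (constr_at D t (X k) \<omega>) \<le> constr_bound" using constr_at_bounded[of "X k"] X by simp
      then show "norm (p \<omega> \<bullet> constr_at D t (X k) \<omega>) \<le> norm (p \<omega>) * constr_bound"
        unfolding real_norm_def by (intro order_trans[OF Cauchy_Schwarz_ineq2] mult_left_mono) auto
    qed
  qed (use X x p constr_at_inner_integrable in auto)
  then show "(\<lambda>k. J (X k) + (\<integral>\<omega>. p \<omega> \<bullet> constr_at D t (X k) \<omega> \<partial>M)) \<longlonglongrightarrow> J x + (\<integral>\<omega>. p \<omega> \<bullet> constr_at D t x \<omega> \<partial>M)"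
    using concave_continuousD(2)[OF J x _ lim] X by (intro tendsto_add) auto
qed

end

section \<open>Approximate multipliers for a single constraint\<close>

definition neg_part :: "real^'n::finite \<Rightarrow> real^'n" where
  "neg_part v = (\<chi> i. max 0 (- v $ i))"

lemma neg_part_nonneg: "0 \<le> neg_part v"
  by (simp add: neg_part_def less_eq_vec_def)

lemma neg_part_eq_0_iff: "neg_part v = 0 \<longleftrightarrow> 0 \<le> v"
proof -
  have "max 0 (- r) = 0 \<longleftrightarrow> 0 \<le> r" for r :: real by auto
  then show ?thesis by (simp add: neg_part_def less_eq_vec_def vec_eq_iff)
qed

lemma neg_part_coord_space: "v \<in> coord_space I \<Longrightarrow> neg_part v \<in> coord_space I"
  by (simp add: neg_part_def coord_space_def)

lemma norm_vec_power2: "(norm (v :: real^'n::finite))\<^sup>2 = (\<Sum>i\<in>UNIV. (v $ i)\<^sup>2)"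
  unfolding power2_norm_eq_inner inner_vec_def by (simp add: power2_eq_square)

lemma norm_neg_part_le: "norm (neg_part v) \<le> norm v"
proof -
  have "(norm (neg_part v))\<^sup>2 \<le> (norm v)\<^sup>2"
    unfolding norm_vec_power2 neg_part_def by (intro sum_mono) (auto simp: max_def)
  then show ?thesis by simp
qed

lemma neg_part_measurable [measurable]: "neg_part \<in> borel_measurable (borel :: (real^'n::finite) measure)"
  unfolding neg_part_def by (rule vec_lambda_measurable) measurable

lemma continuous_on_neg_part: "continuous_on S (neg_part :: real^'n::finite \<Rightarrow> _)"
  unfolding neg_part_def by (intro continuous_intros)

lemma tendsto_neg_part: "(f \<longlongrightarrow> l) F \<Longrightarrow> ((\<lambda>x. neg_part (f x)) \<longlongrightarrow> neg_part l) F"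
  using continuous_on_neg_part[of UNIV] by (metis continuous_on_def tendsto_compose UNIV_I at_within_open open_UNIV)

text \<open>Write \<alpha> for a coordinate of the negative part of \<open>a\<close>. As
  \<open>m\<close> dominates the mixture and -a is at most \<alpha>, the negative part of
  \<open>m\<close> is at most max 0 ((1 - u)\<alpha> - u b). Squaring removes the max, and the
  square of \<alpha> - u(\<alpha> + b) has the linear term -2u\<alpha>(\<alpha> + b). So the
  negative part of \<open>a\<close> emerges as the multiplier that is applied to \<open>b\<close>,
  in the form \<open>Qmix\<close> of the penalty estimate.\<close>

lemma neg_part_mix:
  fixes a b m :: "real^'n::finite"
  assumes m: "(1 - u) *\<^sub>R a + u *\<^sub>R b \<le> m" and u: "0 \<le> u" "u \<le> 1" and c: "norm a \<le> c" "norm b \<le> c"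
  shows "(norm (neg_part m))\<^sup>2
    \<le> (1 - 2 * u) * (norm (neg_part a))\<^sup>2 + 2 * u * (- (neg_part a \<bullet> b)) + u\<^sup>2 * (4 * c\<^sup>2)"
proof -
  have *: "(neg_part m $ i)\<^sup>2 \<le> (1 - 2 * u) * (neg_part a $ i)\<^sup>2 + 2 * u * (- (neg_part a $ i * b $ i))
      + u\<^sup>2 * (2 * (neg_part a $ i)\<^sup>2 + 2 * (b $ i)\<^sup>2)" for i
  proof -
    let ?\<alpha> = "neg_part a $ i"
    have "(1 - u) * a $ i + u * b $ i \<le> m $ i" using m by (simp add: less_eq_vec_def)
    moreover have "(1 - u) * (- a $ i) \<le> (1 - u) * ?\<alpha>"
      using u by (intro mult_left_mono) (auto simp: neg_part_def)
    ultimately have "neg_part m $ i \<le> max 0 ((1 - u) * ?\<alpha> - u * b $ i)"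
      by (auto simp: neg_part_def)
    moreover have "0 \<le> neg_part m $ i" by (simp add: neg_part_def)
    ultimately have "(neg_part m $ i)\<^sup>2 \<le> (max 0 ((1 - u) * ?\<alpha> - u * b $ i))\<^sup>2"
      by (intro power_mono)
    also have "\<dots> \<le> ((1 - u) * ?\<alpha> - u * b $ i)\<^sup>2" by (simp add: max_def)
    also have "\<dots> = (1 - 2 * u) * ?\<alpha>\<^sup>2 + 2 * u * (- (?\<alpha> * b $ i)) + u\<^sup>2 * (?\<alpha> + b $ i)\<^sup>2"
      by (simp add: power2_eq_square algebra_simps)
    also have "(?\<alpha> + b $ i)\<^sup>2 \<le> 2 * ?\<alpha>\<^sup>2 + 2 * (b $ i)\<^sup>2"
      using zero_le_power2[of "?\<alpha> - b $ i"] by (simp add: power2_eq_square algebra_simps)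
    finally show ?thesis by (simp add: mult_left_mono)
  qed
  have "(norm (neg_part m))\<^sup>2 \<le> (\<Sum>i\<in>UNIV. (1 - 2 * u) * (neg_part a $ i)\<^sup>2
      + 2 * u * (- (neg_part a $ i * b $ i)) + u\<^sup>2 * (2 * (neg_part a $ i)\<^sup>2 + 2 * (b $ i)\<^sup>2))"
    unfolding norm_vec_power2[of "neg_part m"] by (intro sum_mono *)
  also have "\<dots> = (1 - 2 * u) * (norm (neg_part a))\<^sup>2 + 2 * u * (- (neg_part a \<bullet> b))
      + u\<^sup>2 * (2 * (norm (neg_part a))\<^sup>2 + 2 * (norm b)\<^sup>2)"
    by (simp add: norm_vec_power2 inner_vec_def sum.distrib sum_distrib_left sum_subtractf distrib_left)
  also have "2 * (norm (neg_part a))\<^sup>2 + 2 * (norm b)\<^sup>2 \<le> 4 * c\<^sup>2"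
  proof -
    have "norm (neg_part a) \<le> c" using norm_neg_part_le c(1) by (rule order_trans)
    then have "(norm (neg_part a))\<^sup>2 \<le> c\<^sup>2" by (intro power_mono) auto
    moreover have "(norm b)\<^sup>2 \<le> c\<^sup>2" using c(2) by (intro power_mono) auto
    ultimately show ?thesis by simp
  qed
  finally show ?thesis by (simp add: mult_left_mono)
qed

text \<open>Keeps the sets of nearly feasible programs closed under midpoints.\<close>

lemma neg_part_midpoint:
  fixes a b m :: "real^'n::finite"
  assumes m: "(1 - 1/2) *\<^sub>R a + (1/2) *\<^sub>R b \<le> m"
  shows "(norm (neg_part m))\<^sup>2 \<le> ((norm (neg_part a))\<^sup>2 + (norm (neg_part b))\<^sup>2) / 2"
proof -
  have *: "(neg_part m $ i)\<^sup>2 \<le> ((neg_part a $ i)\<^sup>2 + (neg_part b $ i)\<^sup>2) / 2" for i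
  proof -
    have "a $ i / 2 + b $ i / 2 \<le> m $ i" using m by (simp add: less_eq_vec_def)
    then have "neg_part m $ i \<le> (neg_part a $ i + neg_part b $ i) / 2"
      by (auto simp: neg_part_def max_def)
    moreover have "0 \<le> neg_part m $ i" by (simp add: neg_part_def)
    ultimately have "(neg_part m $ i)\<^sup>2 \<le> ((neg_part a $ i + neg_part b $ i) / 2)\<^sup>2"
      by (intro power_mono)
    also have "\<dots> \<le> ((neg_part a $ i)\<^sup>2 + (neg_part b $ i)\<^sup>2) / 2"
      using zero_le_power2[of "neg_part a $ i - neg_part b $ i"]
      by (simp add: power2_eq_square algebra_simps)
    finally show ?thesis .
  qed
  have "(norm (neg_part m))\<^sup>2 \<le> (\<Sum>i\<in>UNIV. ((neg_part a $ i)\<^sup>2 + (neg_part b $ i)\<^sup>2) / 2)"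
    unfolding norm_vec_power2 by (intro sum_mono *)
  then show ?thesis unfolding norm_vec_power2 by (simp add: sum.distrib flip: sum_divide_distrib)
qed

lemma inner_nonneg_vec: "0 \<le> a \<Longrightarrow> 0 \<le> b \<Longrightarrow> 0 \<le> a \<bullet> (b :: real^'n::finite)"
  unfolding inner_vec_def less_eq_vec_def by (intro sum_nonneg) simp

lemma closed_nonneg_vec: "closed {v :: real^'n::finite. 0 \<le> v}"
proof -
  have "{v :: real^'n. 0 \<le> v} = (\<Inter>i. {v. 0 \<le> v $ i})" by (auto simp: less_eq_vec_def)
  then show ?thesis by (auto intro!: closed_INT closed_Collect_le continuous_intros)
qed

lemma LIMSEQ_inverse_Suc: "(\<lambda>n. 1 / real (Suc n)) \<longlonglongrightarrow> 0"
  by (rule LIMSEQ_Suc[OF lim_inverse_n'])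

section \<open>Maxima and near-feasibility over closed convex sets of programs\<close>

context team_problem
begin

text \<open>Non-empty convex sets of programs that are closed under almost sure limits within the
  \<open>G\<close>-measurable programs. The instances are the adapted programs subject to some of
  the constraints, and the set of all programs.\<close>

definition admissible :: "('t \<Rightarrow> 'o measure) \<Rightarrow> ('t \<Rightarrow> 'o \<Rightarrow> real^'v) set \<Rightarrow> bool" where
  "admissible G K \<longleftrightarrow> (\<forall>t. subalgebra M (G t)) \<and> K \<subseteq> progs G \<and> K \<noteq> {} \<and>
     (\<forall>x\<in>K. \<forall>y\<in>K. \<forall>u\<in>{0..1}. mix u x y \<in> K) \<and>
     (\<forall>X x. (\<forall>n. X n \<in> K) \<longrightarrow> x \<in> progs G \<longrightarrow> AE_tendsto X x \<longrightarrow> x \<in> K)"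

lemma admissibleD:
  assumes "admissible G K"
  shows "subalgebra M (G t)" "K \<subseteq> progs G" "K \<noteq> {}"
    and admissible_mix: "\<And>x y u. x \<in> K \<Longrightarrow> y \<in> K \<Longrightarrow> 0 \<le> u \<Longrightarrow> u \<le> 1 \<Longrightarrow> mix u x y \<in> K"
    and admissible_closed: "\<And>X x. (\<And>n. X n \<in> K) \<Longrightarrow> x \<in> progs G \<Longrightarrow> AE_tendsto X x \<Longrightarrow> x \<in> K"
proof -
  note a = assms[unfolded admissible_def]
  show "subalgebra M (G t)" "K \<subseteq> progs G" "K \<noteq> {}" using a by blast+
  show "mix u x y \<in> K" if "x \<in> K" "y \<in> K" "0 \<le> u" "u \<le> 1" for x y u
    using a that by simp
  show "x \<in> K" if "\<And>n. X n \<in> K" "x \<in> progs G" "AE_tendsto X x" for X x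
    using a that by blast
qed

lemma progs_subset: "progs G \<subseteq> programs D"
  by (auto simp: progs_def)

lemma admissible_programs: "admissible G K \<Longrightarrow> x \<in> K \<Longrightarrow> x \<in> programs D"
  using admissibleD(2) progs_subset by blast

text \<open>Compactness in the form in which it is used: the decreasing sets \<open>L n\<close> are
  only asked to be non-empty and stable under midpoints, and closedness of \<open>K\<close> places
  the limit in \<open>K\<close>.\<close>

lemma admissible_limit:
  assumes K: "admissible G K"
    and "decseq L" "\<And>n. L n \<noteq> {}" and LK: "\<And>n. L n \<subseteq> K"
    and mid: "\<And>n x y. x \<in> L n \<Longrightarrow> y \<in> L n \<Longrightarrow> mix (1/2) x y \<in> L n"
  shows "\<exists>X x. (\<forall>n. X n \<in> L n) \<and> x \<in> K \<and> AE_tendsto X x"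
proof -
  have "\<exists>X x. (\<forall>n. X n \<in> L n) \<and> x \<in> progs G \<and> (\<forall>t. AE \<omega> in M. (\<lambda>n. X n t \<omega>) \<longlonglongrightarrow> x t \<omega>)"
    by (rule progs_selection) (use admissibleD(1)[OF K] order_trans[OF LK admissibleD(2)[OF K]] assms in auto)
  then obtain X x where X: "\<And>n. X n \<in> L n" "x \<in> progs G" "AE_tendsto X x"
    unfolding AE_tendsto_def by blast
  moreover have "x \<in> K" using admissible_closed[OF K, of X x] X LK by blast
  ultimately show ?thesis by blast
qed

lemma J_midpoint:
  assumes "concave_continuous J" "x \<in> programs D" "y \<in> programs D" "b \<le> J x" "b \<le> J y"
  shows "b \<le> J (mix (1/2) x y)"
  using concave_continuousD(1)[OF assms(1-3), of "1/2"] assms(4,5) by simp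

text \<open>If \<open>J\<close> were unbounded above, the sets where \<open>J\<close> is at least
  \<open>n\<close> would be non-empty and decreasing, and stable under midpoints by concavity. A
  convergent selection from them would have \<open>J (X n)\<close> both at least \<open>n\<close>
  and convergent to the real number \<open>J x\<close>.\<close>

lemma payoff_bounded:
  assumes K: "admissible G K" and J: "concave_continuous J"
  shows "\<exists>B. \<forall>x\<in>K. J x \<le> B"
proof (rule ccontr)
  assume "\<not> ?thesis"
  then have ne: "\<exists>x\<in>K. real n \<le> J x" for n by (meson less_imp_le not_le)
  define L where "L n = {x\<in>K. real n \<le> J x}" for n
  have "\<exists>X x. (\<forall>n. X n \<in> L n) \<and> x \<in> K \<and> AE_tendsto X x"
  proof (rule admissible_limit[OF K])
    show "decseq L" by (auto simp: L_def decseq_def)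
    show "L n \<noteq> {}" for n using ne by (auto simp: L_def)
    show "mix (1/2) x y \<in> L n" if "x \<in> L n" "y \<in> L n" for n x y
      using that admissible_mix[OF K] J_midpoint[OF J] admissible_programs[OF K] by (auto simp: L_def)
  qed (auto simp: L_def)
  then obtain X x where X: "\<And>n. X n \<in> K" "\<And>n. real n \<le> J (X n)" "x \<in> K" "AE_tendsto X x"
    by (auto simp: L_def)
  then have "(\<lambda>n. J (X n)) \<longlonglongrightarrow> J x"
    using admissible_programs[OF K] by (intro concave_continuousD(2)[OF J]) auto
  then obtain b where "\<And>n. \<bar>J (X n)\<bar> \<le> b"
    using convergent_imp_Bseq[of "\<lambda>n. J (X n)"] by (auto simp: convergent_def Bseq_def)
  then have "real n \<le> b" for n using X(2)[of n] by (smt (verit))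
  then show False by (meson reals_Archimedean2 not_le)
qed

text \<open>A selection from the superlevel sets just below the supremum converges to a
  maximiser.\<close>

lemma payoff_attained:
  assumes K: "admissible G K" and J: "concave_continuous J"
  shows "\<exists>x\<in>K. \<forall>y\<in>K. J y \<le> J x"
proof -
  define s where "s = Sup (J ` K)"
  have bdd: "bdd_above (J ` K)" using payoff_bounded[OF assms] by (auto simp: bdd_above_def)
  define L where "L n = {x\<in>K. s - 1 / real (Suc n) \<le> J x}" for n
  have "\<exists>X x. (\<forall>n. X n \<in> L n) \<and> x \<in> K \<and> AE_tendsto X x"
  proof (rule admissible_limit[OF K])
    show "decseq L" unfolding L_def decseq_def
      by (auto intro: order_trans[rotated] diff_left_mono divide_left_mono)
        (smt (verit) frac_le of_nat_mono of_nat_0_le_iff)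
    show "L n \<noteq> {}" for n
    proof -
      have "\<exists>y\<in>J ` K. s - 1 / real (Suc n) < y"
        unfolding s_def using admissibleD(3)[OF K] by (intro less_cSupD) auto
      then show ?thesis by (force simp: L_def)
    qed
    show "mix (1/2) x y \<in> L n" if "x \<in> L n" "y \<in> L n" for n x y
      using that admissible_mix[OF K] J_midpoint[OF J] admissible_programs[OF K] by (auto simp: L_def)
  qed (auto simp: L_def)
  then obtain X x where X: "\<And>n. X n \<in> K" "\<And>n. s - 1 / real (Suc n) \<le> J (X n)" "x \<in> K" "AE_tendsto X x"
    by (auto simp: L_def)
  then have lim: "(\<lambda>n. J (X n)) \<longlonglongrightarrow> J x"
    using admissible_programs[OF K] by (intro concave_continuousD(2)[OF J]) auto
  have "(\<lambda>n. s - 1 / real (Suc n)) \<longlonglongrightarrow> s - 0"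
    by (intro tendsto_diff tendsto_const LIMSEQ_inverse_Suc)
  then have "s \<le> J x" using LIMSEQ_le[OF _ lim] X(2) by auto
  moreover have "J y \<le> s" if "y \<in> K" for y unfolding s_def using bdd that by (intro cSup_upper) auto
  ultimately show ?thesis using X(3) by (meson order_trans)
qed

text \<open>Supplies the hypothesis \<open>near\<close> of the penalty estimate. If arbitrarily
  small values of \<open>Q\<close> were compatible with \<open>J\<close> at least
  \<open>V + e / 3\<close>, the sets cut out by both inequalities would be non-empty and stable
  under midpoints, and a selected limit would have \<open>Q x = 0\<close> but \<open>J x\<close>
  above \<open>V\<close>. The third of \<open>e\<close> compensates the factor 3 of that
  estimate.\<close>

lemma approximate_multiplier:
  assumes K: "admissible G K" and J: "concave_continuous J"
    and Q0: "\<And>x. x \<in> K \<Longrightarrow> 0 \<le> Q x"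
    and Qmid: "\<And>x y. x \<in> K \<Longrightarrow> y \<in> K \<Longrightarrow> Q (mix (1/2) x y) \<le> (Q x + Q y) / 2"
    and Qcont: "\<And>X x. (\<And>n. X n \<in> K) \<Longrightarrow> x \<in> K \<Longrightarrow> AE_tendsto X x \<Longrightarrow> (\<lambda>n. Q (X n)) \<longlonglongrightarrow> Q x"
    and Qmix: "\<And>x z u. x \<in> K \<Longrightarrow> z \<in> K \<Longrightarrow> 0 \<le> u \<Longrightarrow> u \<le> 1 \<Longrightarrow>
        Q (mix u z x) \<le> (1 - 2 * u) * Q z + 2 * u * d z x + u\<^sup>2 * c"
    and V: "\<And>x. x \<in> K \<Longrightarrow> Q x = 0 \<Longrightarrow> J x \<le> V"
    and e: "e > 0"
  shows "\<exists>z\<in>K. \<exists>N\<ge>0. \<forall>x\<in>K. J x - N * d z x \<le> V + e"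
proof -
  obtain B where B: "\<And>x. x \<in> K \<Longrightarrow> J x \<le> B" using payoff_bounded[OF K J] by blast
  have "\<exists>\<delta>>0. \<forall>x\<in>K. Q x \<le> \<delta> \<longrightarrow> J x \<le> V + e / 3"
  proof (rule ccontr)
    assume "\<not> ?thesis"
    then have ne: "\<exists>x\<in>K. Q x \<le> \<delta> \<and> V + e / 3 \<le> J x" if "\<delta> > 0" for \<delta>
      using that by (meson less_imp_le not_le)
    define L where "L n = {x\<in>K. Q x \<le> 1 / real (Suc n) \<and> V + e / 3 \<le> J x}" for n
    have "\<exists>X x. (\<forall>n. X n \<in> L n) \<and> x \<in> K \<and> AE_tendsto X x"
    proof (rule admissible_limit[OF K])
      show "decseq L" unfolding L_def decseq_def
        by (auto intro: order_trans divide_left_mono) (smt (verit) frac_le of_nat_mono of_nat_0_le_iff)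
      show "L n \<noteq> {}" for n using ne[of "1 / real (Suc n)"] by (auto simp: L_def)
      show "mix (1/2) x y \<in> L n" if xy: "x \<in> L n" "y \<in> L n" for n x y
      proof -
        have "Q (mix (1/2) x y) \<le> 1 / real (Suc n)"
          using Qmid[of x y] xy by (auto simp: L_def)
        then show ?thesis
          using xy admissible_mix[OF K] J_midpoint[OF J] admissible_programs[OF K] by (auto simp: L_def)
      qed
    qed (auto simp: L_def)
    then obtain X x where X: "\<And>n. X n \<in> K" "\<And>n. Q (X n) \<le> 1 / real (Suc n)" "\<And>n. V + e / 3 \<le> J (X n)"
        "x \<in> K" "AE_tendsto X x"
      by (auto simp: L_def)
    have "(\<lambda>n. J (X n)) \<longlonglongrightarrow> J x"
      using X admissible_programs[OF K] by (intro concave_continuousD(2)[OF J]) auto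
    then have "V + e / 3 \<le> J x" using X(3) by (intro LIMSEQ_le_const) auto
    moreover have "Q x \<le> 0"
      using LIMSEQ_le[OF Qcont[OF X(1,4,5)] LIMSEQ_inverse_Suc] X(2) by auto
    ultimately show False using V[OF X(4)] Q0[OF X(4)] e by force
  qed
  then obtain \<delta> where \<delta>: "\<delta> > 0" "\<And>x. x \<in> K \<Longrightarrow> Q x \<le> \<delta> \<Longrightarrow> J x \<le> V + e / 3" by blast
  have "\<exists>z\<in>K. \<exists>N\<ge>0. \<forall>x\<in>K. J x - N * d z x \<le> V + 3 * (e / 3)"
  proof (rule approximate_penalty_multiplier[where mix=mix and \<delta>=\<delta> and B=B and Q=Q and c=c])
    show "(1 - u) * J x + u * J y \<le> J (mix u x y)" if "x \<in> K" "y \<in> K" "0 \<le> u" "u \<le> 1" for x y u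
      using that admissible_programs[OF K] by (intro concave_continuousD(1)[OF J]) auto
  qed (use K B \<delta> e Q0 Qmix admissible_mix admissibleD(3) in auto)
  then show ?thesis by simp
qed

section \<open>Problems in which only part of the constraints is enforced\<close>

definition feasible_on :: "'t set \<Rightarrow> ('t \<Rightarrow> 'o \<Rightarrow> real^'v) set" where
  "feasible_on R = {x \<in> adapted D. \<forall>t\<in>R. AE \<omega> in M. 0 \<le> constr_at D t x \<omega>}"

lemma feasible_on_program: "x \<in> feasible_on R \<Longrightarrow> x \<in> programs D"
  by (simp add: feasible_on_def adapted_program)

text \<open>The strictly feasible program of (E), fixed once. It belongs to every
  \<open>feasible_on R\<close>, so it can be tested against the multiplier at each stage of the
  relaxation.\<close>

definition slater :: "'t \<Rightarrow> 'o \<Rightarrow> real^'v" where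
  "slater = (SOME x. x \<in> adapted D \<and> (\<exists>\<kappa>. \<forall>t.
     \<kappa> t \<in> Wsp D t \<and> (\<forall>i\<in>wcoords D t. 0 < \<kappa> t $ i) \<and> (AE \<omega> in M. \<kappa> t \<le> constr_at D t x \<omega>)))"

lemma slater: "slater \<in> adapted D" "\<exists>\<kappa>. \<forall>t.
     \<kappa> t \<in> Wsp D t \<and> (\<forall>i\<in>wcoords D t. 0 < \<kappa> t $ i) \<and> (AE \<omega> in M. \<kappa> t \<le> constr_at D t slater \<omega>)"
proof -
  have ex: "\<exists>x. x \<in> adapted D \<and> (\<exists>\<kappa>. \<forall>t.
     \<kappa> t \<in> Wsp D t \<and> (\<forall>i\<in>wcoords D t. 0 < \<kappa> t $ i) \<and> (AE \<omega> in M. \<kappa> t \<le> constr_at D t x \<omega>))"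
    using condE unfolding cond_E_def by blast
  have "slater \<in> adapted D \<and> (\<exists>\<kappa>. \<forall>t.
     \<kappa> t \<in> Wsp D t \<and> (\<forall>i\<in>wcoords D t. 0 < \<kappa> t $ i) \<and> (AE \<omega> in M. \<kappa> t \<le> constr_at D t slater \<omega>))"
    unfolding slater_def by (rule someI_ex[OF ex])
  then show "slater \<in> adapted D" "\<exists>\<kappa>. \<forall>t.
     \<kappa> t \<in> Wsp D t \<and> (\<forall>i\<in>wcoords D t. 0 < \<kappa> t $ i) \<and> (AE \<omega> in M. \<kappa> t \<le> constr_at D t slater \<omega>)"
    by blast+
qed

lemma slater_feasible_on: "slater \<in> feasible_on R"
proof -
  obtain \<kappa> where \<kappa>: "\<And>t. \<kappa> t \<in> Wsp D t" "\<And>t i. i \<in> wcoords D t \<Longrightarrow> 0 < \<kappa> t $ i"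
    "\<And>t. AE \<omega> in M. \<kappa> t \<le> constr_at D t slater \<omega>" using slater(2) by blast
  have "0 \<le> \<kappa> t" for t
    unfolding less_eq_vec_def
  proof
    fix i show "0 $ i \<le> \<kappa> t $ i"
      using \<kappa>(1)[of t] \<kappa>(2)[of i t] by (cases "i \<in> wcoords D t") (auto simp: Wsp_def coord_space_def less_imp_le)
  qed
  then have "AE \<omega> in M. 0 \<le> constr_at D t slater \<omega>" for t
    by (intro eventually_mono[OF \<kappa>(3)[of t]]) (rule order_trans)
  then show ?thesis using slater(1) by (simp add: feasible_on_def)
qed

text \<open>Concavity of \<open>g_t\<close> preserves the enforced inequalities under mixtures,
  continuity preserves them under limits.\<close>

lemma admissible_feasible_on: "admissible (info D) (feasible_on R)"
  unfolding admissible_def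
proof (intro conjI allI ballI impI)
  show "feasible_on R \<subseteq> progs (info D)" by (auto simp: feasible_on_def adapted_eq_progs)
  show "feasible_on R \<noteq> {}" using slater_feasible_on by blast
  fix x y u assume x: "x \<in> feasible_on R" and y: "y \<in> feasible_on R" and u: "u \<in> {0..1::real}"
  then have "mix u x y \<in> adapted D" by (auto simp: feasible_on_def adapted_mix)
  moreover have "AE \<omega> in M. 0 \<le> constr_at D t (mix u x y) \<omega>" if t: "t \<in> R" for t
  proof -
    have xt: "AE \<omega> in M. 0 \<le> constr_at D t x \<omega>" and yt: "AE \<omega> in M. 0 \<le> constr_at D t y \<omega>"
      using x y t by (auto simp: feasible_on_def)
    have u': "0 \<le> u" "u \<le> 1" using u by auto
    show ?thesis using xt yt constr_at_concave[OF feasible_on_program[OF x] feasible_on_program[OF y] u', of t]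
    proof eventually_elim
      case (elim \<omega>)
      have "0 \<le> (1 - u) *\<^sub>R constr_at D t x \<omega> + u *\<^sub>R constr_at D t y \<omega>"
        using elim(1,2) u' by (auto simp: less_eq_vec_def)
      then show ?case using elim(3) by (rule order_trans)
    qed
  qed
  ultimately show "mix u x y \<in> feasible_on R" by (simp add: feasible_on_def)
next
  fix X x assume X: "\<forall>n. X n \<in> feasible_on R" and x: "x \<in> progs (info D)" and lim: "AE_tendsto X x"
  have xa: "x \<in> adapted D" using x by (simp add: adapted_eq_progs)
  have "AE \<omega> in M. 0 \<le> constr_at D t x \<omega>" if t: "t \<in> R" for t
  proof -
    have "AE \<omega> in M. \<forall>n. 0 \<le> constr_at D t (X n) \<omega>"
      using X t by (auto simp: AE_all_countable feasible_on_def)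
    moreover have "AE \<omega> in M. (\<lambda>n. constr_at D t (X n) \<omega>) \<longlonglongrightarrow> constr_at D t x \<omega>"
      using lim X feasible_on_program adapted_program[OF xa] unfolding AE_tendsto_def
      by (intro constr_at_tendsto) blast+
    ultimately show ?thesis
    proof eventually_elim
      case (elim \<omega>)
      then have "\<And>n. constr_at D t (X n) \<omega> \<in> {v. 0 \<le> v}" by blast
      from closed_sequentially[OF closed_nonneg_vec this elim(2)] show ?case by simp
    qed
  qed
  then show "x \<in> feasible_on R" using xa by (simp add: feasible_on_def)
qed (rule subalg)

text \<open>The penalty is the expected squared negative part of \<open>g_s\<close>; its linear term
  at the near-maximiser \<open>z\<close> is the pairing with \<open>N\<close> times the negative
  part of \<open>g_s\<close> at \<open>z\<close>. This is non-negative by construction, and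
  measurable for the information of \<open>s\<close> because \<open>z\<close> is adapted and
  \<open>g_s\<close> involves only the actions of decision makers up to \<open>s\<close>.\<close>

lemma approximate_constraint_multiplier:
  assumes J: "concave_continuous J"
    and V: "\<And>x. x \<in> feasible_on (insert s R) \<Longrightarrow> J x \<le> V" and e: "e > 0"
  shows "\<exists>p. p \<in> borel_measurable (info D s) \<and> integrable M p \<and>
     (\<forall>\<omega>\<in>space M. p \<omega> \<in> Wsp D s \<and> 0 \<le> p \<omega>) \<and>
     (\<forall>x\<in>feasible_on R. J x + (\<integral>\<omega>. p \<omega> \<bullet> constr_at D s x \<omega> \<partial>M) \<le> V + e)"
proof -
  define g where "g x = constr_at D s x" for x
  define Q where "Q x = (\<integral>\<omega>. (norm (neg_part (g x \<omega>)))\<^sup>2 \<partial>M)" for x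
  define d where "d z x = - (\<integral>\<omega>. neg_part (g z \<omega>) \<bullet> g x \<omega> \<partial>M)" for z x
  have gm [measurable]: "g x \<in> borel_measurable M" if "x \<in> programs D" for x
    unfolding g_def by (rule constr_at_measurable[OF that])
  have gle: "norm (g x \<omega>) \<le> constr_bound" if "x \<in> programs D" "\<omega> \<in> space M" for x \<omega>
    unfolding g_def by (rule constr_at_bounded[OF that])
  have nle: "norm (neg_part (g x \<omega>)) \<le> constr_bound" if "x \<in> programs D" "\<omega> \<in> space M" for x \<omega>
    using norm_neg_part_le gle[OF that] by (rule order_trans)
  have n2le: "(norm (neg_part (g x \<omega>)))\<^sup>2 \<le> constr_bound\<^sup>2" if "x \<in> programs D" "\<omega> \<in> space M" for x \<omega>
    using nle[OF that] by (intro power_mono) auto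
  have Qi: "integrable M (\<lambda>\<omega>. (norm (neg_part (g x \<omega>)))\<^sup>2)" if x: "x \<in> programs D" for x
    using n2le[OF x] gm[OF x] by (intro integrable_const_bound[of _ "constr_bound\<^sup>2"]) auto
  have ni: "integrable M (\<lambda>\<omega>. neg_part (g x \<omega>))" if x: "x \<in> programs D" for x
    using nle[OF x] gm[OF x] by (intro integrable_const_bound[of _ constr_bound]) auto
  have di: "integrable M (\<lambda>\<omega>. neg_part (g z \<omega>) \<bullet> g x \<omega>)" if "x \<in> programs D" "z \<in> programs D" for x z
    unfolding g_def by (intro constr_at_inner_integrable that ni[unfolded g_def])
  have "\<exists>z\<in>feasible_on R. \<exists>N\<ge>0. \<forall>x\<in>feasible_on R. J x - N * d z x \<le> V + e"
  proof (rule approximate_multiplier[OF admissible_feasible_on J, where Q=Q and c="4 * constr_bound\<^sup>2"])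
    fix x assume x: "x \<in> feasible_on R"
    note xp = feasible_on_program[OF x]
    show "0 \<le> Q x" unfolding Q_def by simp
    show "J x \<le> V" if "Q x = 0"
    proof -
      have "AE \<omega> in M. (norm (neg_part (g x \<omega>)))\<^sup>2 = 0"
        using that integral_nonneg_eq_0_iff_AE[OF Qi[OF xp]] by (auto simp: Q_def)
      then have "AE \<omega> in M. 0 \<le> constr_at D s x \<omega>"
        by eventually_elim (simp add: g_def neg_part_eq_0_iff)
      then show ?thesis using x by (intro V) (auto simp: feasible_on_def)
    qed
    fix z assume z: "z \<in> feasible_on R"
    note zp = feasible_on_program[OF z]
    have half: "0 \<le> (1/2 :: real)" "(1/2 :: real) \<le> 1" by auto
    have mp: "mix (1/2) x z \<in> programs D" by (intro programs_mix xp zp half)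
    have "Q (mix (1/2) x z) \<le> (\<integral>\<omega>. ((norm (neg_part (g x \<omega>)))\<^sup>2 + (norm (neg_part (g z \<omega>)))\<^sup>2) / 2 \<partial>M)"
      unfolding Q_def
    proof (rule integral_mono_AE)
      show "AE \<omega> in M. (norm (neg_part (g (mix (1/2) x z) \<omega>)))\<^sup>2
          \<le> ((norm (neg_part (g x \<omega>)))\<^sup>2 + (norm (neg_part (g z \<omega>)))\<^sup>2) / 2"
        unfolding g_def
        by (rule eventually_mono[OF constr_at_concave[OF xp zp half]]) (rule neg_part_midpoint)
    qed (use Qi xp zp mp in auto)
    then show "Q (mix (1/2) x z) \<le> (Q x + Q z) / 2" unfolding Q_def using Qi xp zp by simp
    fix u :: real assume u: "0 \<le> u" "u \<le> 1"
    have mp: "mix u z x \<in> programs D" by (intro programs_mix xp zp u)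
    have "Q (mix u z x) \<le> (\<integral>\<omega>. (1 - 2 * u) * (norm (neg_part (g z \<omega>)))\<^sup>2
        + 2 * u * (- (neg_part (g z \<omega>) \<bullet> g x \<omega>)) + u\<^sup>2 * (4 * constr_bound\<^sup>2) \<partial>M)"
      unfolding Q_def
    proof (rule integral_mono_AE)
      show "AE \<omega> in M. (norm (neg_part (g (mix u z x) \<omega>)))\<^sup>2 \<le> (1 - 2 * u) * (norm (neg_part (g z \<omega>)))\<^sup>2
        + 2 * u * (- (neg_part (g z \<omega>) \<bullet> g x \<omega>)) + u\<^sup>2 * (4 * constr_bound\<^sup>2)"
        using constr_at_concave[OF zp xp u, of s] AE_space
      proof eventually_elim
        case (elim \<omega>)
        show ?case using elim(1) u gle[OF zp elim(2)] gle[OF xp elim(2)] unfolding g_def by (rule neg_part_mix)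
      qed
    qed (use Qi di xp zp mp in auto)
    also have "\<dots> = (1 - 2 * u) * Q z + 2 * u * d z x + u\<^sup>2 * (4 * constr_bound\<^sup>2)"
      unfolding Q_def d_def using Qi di xp zp by (simp add: prob_space)
    finally show "Q (mix u z x) \<le> (1 - 2 * u) * Q z + 2 * u * d z x + u\<^sup>2 * (4 * constr_bound\<^sup>2)" .
  next
    fix X x assume X: "\<And>n. X n \<in> feasible_on R" and x: "x \<in> feasible_on R" and lim: "AE_tendsto X x"
    note Xp = feasible_on_program[OF X] and xp = feasible_on_program[OF x]
    show "(\<lambda>n. Q (X n)) \<longlonglongrightarrow> Q x" unfolding Q_def
    proof (rule integral_dominated_convergence[where w="\<lambda>_. constr_bound\<^sup>2"])
      have "AE \<omega> in M. (\<lambda>n. constr_at D s (X n) \<omega>) \<longlonglongrightarrow> constr_at D s x \<omega>"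
        using lim Xp xp unfolding AE_tendsto_def by (intro constr_at_tendsto) blast+
      then show "AE \<omega> in M. (\<lambda>n. (norm (neg_part (g (X n) \<omega>)))\<^sup>2) \<longlonglongrightarrow> (norm (neg_part (g x \<omega>)))\<^sup>2"
        by eventually_elim (auto simp: g_def intro!: tendsto_power tendsto_norm tendsto_neg_part)
    qed (use Xp xp Qi n2le in \<open>auto intro!: AE_I2\<close>)
  qed (use e in auto)
  then obtain z N where z: "z \<in> feasible_on R" and N: "N \<ge> 0"
    and le: "\<And>x. x \<in> feasible_on R \<Longrightarrow> J x - N * d z x \<le> V + e" by blast
  note zp = feasible_on_program[OF z]
  define p where "p \<omega> = N *\<^sub>R neg_part (g z \<omega>)" for \<omega>
  have "p \<in> borel_measurable (info D s)"
  proof -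
    have [measurable]: "g z \<in> borel_measurable (info D s)"
      unfolding g_def using z by (intro constr_at_measurable_info) (auto simp: feasible_on_def)
    show ?thesis unfolding p_def by measurable
  qed
  moreover have "integrable M p" unfolding p_def using ni[OF zp] by simp
  moreover have "p \<omega> \<in> Wsp D s \<and> 0 \<le> p \<omega>" if "\<omega> \<in> space M" for \<omega>
    using neg_part_coord_space[OF constr_at_Wsp[OF zp that, of s, unfolded Wsp_def]] N neg_part_nonneg[of "g z \<omega>"]
    unfolding p_def g_def Wsp_def by (auto simp: subspace_scale subspace_coord_space less_eq_vec_def)
  moreover have "J x + (\<integral>\<omega>. p \<omega> \<bullet> constr_at D s x \<omega> \<partial>M) \<le> V + e" if "x \<in> feasible_on R" for x
    using le[OF that] unfolding p_def d_def g_def by simp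
  ultimately show ?thesis by blast
qed

end

section \<open>Multipliers for the constraints\<close>

definition exceed :: "'a measure \<Rightarrow> (nat \<Rightarrow> 'a \<Rightarrow> 'b::real_normed_vector) \<Rightarrow> nat \<Rightarrow> 'a set" where
  "exceed M f k = {\<omega>\<in>space M. \<exists>n. real k < norm (f n \<omega>)}"

lemma exceed_sets:
  fixes f :: "nat \<Rightarrow> 'a \<Rightarrow> 'b::euclidean_space"
  assumes [measurable]: "\<And>n. f n \<in> borel_measurable G" and "space G = space M"
  shows "exceed M f k \<in> sets G"
  unfolding exceed_def assms(2)[symmetric] by measurable

lemma AE_eventually_not_exceed:
  assumes "AE \<omega> in M. (\<lambda>n. f n \<omega>) \<longlonglongrightarrow> h \<omega>"
  shows "AE \<omega> in M. \<forall>\<^sub>F k in sequentially. \<omega> \<notin> exceed M f k"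
  using assms
proof eventually_elim
  case (elim \<omega>)
  then obtain b where b: "\<And>n. norm (f n \<omega>) \<le> b"
    using convergent_imp_Bseq[of "\<lambda>n. f n \<omega>"] by (auto simp: convergent_def Bseq_def)
  have "\<forall>\<^sub>F k in sequentially. b \<le> real k"
    using filterlim_real_sequentially by (auto simp: filterlim_at_top)
  then show ?case
  proof eventually_elim
    case (elim k)
    have "norm (f n \<omega>) \<le> real k" for n using b elim by (rule order_trans)
    then show ?case by (simp add: exceed_def not_less)
  qed
qed

text \<open>\<open>exceed M f k\<close> is one set for all \<open>n\<close>. Outside it the whole
  sequence is bounded by \<open>k\<close>, so dominated convergence lets \<open>n\<close> tend to
  infinity for fixed \<open>k\<close>. Then \<open>k\<close> tends to infinity under the integrable
  majorant given by \<open>h\<close>; almost every point eventually leaves the exceptional sets,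
  since a convergent sequence is bounded.\<close>

lemma (in prob_space) truncated_inner_limits:
  fixes f :: "nat \<Rightarrow> 'a \<Rightarrow> 'b::euclidean_space"
  assumes f [measurable]: "\<And>n. f n \<in> borel_measurable M" and h: "integrable M h"
    and lim: "AE \<omega> in M. (\<lambda>n. f n \<omega>) \<longlonglongrightarrow> h \<omega>"
    and w [measurable]: "w \<in> borel_measurable M" and c: "AE \<omega> in M. norm (w \<omega>) \<le> c"
  shows "(\<lambda>n. \<integral>\<omega>. (if \<omega> \<in> exceed M f k then 0 else f n \<omega> \<bullet> w \<omega>) \<partial>M)
      \<longlonglongrightarrow> (\<integral>\<omega>. (if \<omega> \<in> exceed M f k then 0 else h \<omega> \<bullet> w \<omega>) \<partial>M)" (is ?thesis1)
    and "(\<lambda>k. \<integral>\<omega>. (if \<omega> \<in> exceed M f k then 0 else h \<omega> \<bullet> w \<omega>) \<partial>M) \<longlonglongrightarrow> (\<integral>\<omega>. h \<omega> \<bullet> w \<omega> \<partial>M)" (is ?thesis2)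
proof -
  have [measurable]: "exceed M f k \<in> sets M" for k by (intro exceed_sets) auto
  have [measurable]: "h \<in> borel_measurable M" using h by (rule borel_measurable_integrable)
  show ?thesis1
  proof (rule integral_dominated_convergence[where w="\<lambda>_. real k * c"])
    show "AE \<omega> in M. (\<lambda>n. if \<omega> \<in> exceed M f k then 0 else f n \<omega> \<bullet> w \<omega>)
        \<longlonglongrightarrow> (if \<omega> \<in> exceed M f k then 0 else h \<omega> \<bullet> w \<omega>)"
      using lim by eventually_elim (auto intro!: tendsto_inner)
    show "AE \<omega> in M. norm (if \<omega> \<in> exceed M f k then 0 else f n \<omega> \<bullet> w \<omega>) \<le> real k * c" for n
      using c AE_space
    proof eventually_elim
      case (elim \<omega>)
      have "\<bar>f n \<omega> \<bullet> w \<omega>\<bar> \<le> real k * c" if "\<omega> \<notin> exceed M f k"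
      proof -
        have "norm (f n \<omega>) \<le> real k" using that elim(2) by (auto simp: exceed_def not_less)
        then have "norm (f n \<omega>) * norm (w \<omega>) \<le> real k * c" using elim(1) by (intro mult_mono) auto
        then show ?thesis using Cauchy_Schwarz_ineq2 order_trans by blast
      qed
      moreover have "0 \<le> c" using elim(1) norm_ge_zero order_trans by blast
      ultimately show ?case by simp
    qed
  qed auto
  show ?thesis2
  proof (rule integral_dominated_convergence[where w="\<lambda>\<omega>. norm (h \<omega>) * c"])
    show "AE \<omega> in M. (\<lambda>k. if \<omega> \<in> exceed M f k then 0 else h \<omega> \<bullet> w \<omega>) \<longlonglongrightarrow> h \<omega> \<bullet> w \<omega>"
      using AE_eventually_not_exceed[OF lim]
    proof eventually_elim
      case (elim \<omega>)
      then show ?case by (intro tendsto_eventually) (erule eventually_mono, simp)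
    qed
    show "AE \<omega> in M. norm (if \<omega> \<in> exceed M f k then 0 else h \<omega> \<bullet> w \<omega>) \<le> norm (h \<omega>) * c" for k
      using c
    proof eventually_elim
      case (elim \<omega>)
      have "0 \<le> c" using elim norm_ge_zero order_trans by blast
      moreover have "\<bar>h \<omega> \<bullet> w \<omega>\<bar> \<le> norm (h \<omega>) * c"
        using mult_left_mono[OF elim norm_ge_zero] Cauchy_Schwarz_ineq2 order_trans by blast
      ultimately show ?case by simp
    qed
  qed (use h in auto)
qed

context team_problem
begin

text \<open>At the program of (E) every coordinate of \<open>g_s\<close> in
  \<open>wcoords D s\<close> is at least \<open>k0\<close>, so the pairing with a non-negative
  \<open>p\<close> is at least \<open>k0\<close> times its L1 norm. In the other coordinates
  \<open>p\<close> vanishes.\<close>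

lemma constraint_multiplier_L1_bound:
  assumes p: "p \<in> borel_measurable M" "integrable M p" "\<And>\<omega>. \<omega> \<in> space M \<Longrightarrow> p \<omega> \<in> Wsp D s \<and> 0 \<le> p \<omega>"
    and k0: "k0 > 0" and \<kappa>: "\<And>i. i \<in> wcoords D s \<Longrightarrow> k0 \<le> \<kappa> $ i" "AE \<omega> in M. \<kappa> \<le> constr_at D s slater \<omega>"
    and b: "(\<integral>\<omega>. p \<omega> \<bullet> constr_at D s slater \<omega> \<partial>M) \<le> b"
  shows "(\<integral>\<omega>. norm (p \<omega>) \<partial>M) \<le> b / k0"
proof -
  have "(\<integral>\<omega>. k0 * norm (p \<omega>) \<partial>M) \<le> (\<integral>\<omega>. p \<omega> \<bullet> constr_at D s slater \<omega> \<partial>M)"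
  proof (rule integral_mono_AE)
    show "integrable M (\<lambda>\<omega>. p \<omega> \<bullet> constr_at D s slater \<omega>)"
      using p slater(1) by (intro constr_at_inner_integrable adapted_program)
    show "AE \<omega> in M. k0 * norm (p \<omega>) \<le> p \<omega> \<bullet> constr_at D s slater \<omega>"
      using \<kappa>(2) AE_space
    proof eventually_elim
      case (elim \<omega>)
      note pw = p(3)[OF elim(2)]
      have "k0 * norm (p \<omega>) \<le> k0 * (\<Sum>i\<in>UNIV. \<bar>p \<omega> $ i\<bar>)"
        using k0 by (intro mult_left_mono norm_le_l1_cart) auto
      also have "\<dots> = (\<Sum>i\<in>UNIV. k0 * p \<omega> $ i)"
        using pw by (simp add: sum_distrib_left less_eq_vec_def)
      also have "\<dots> \<le> (\<Sum>i\<in>UNIV. p \<omega> $ i * constr_at D s slater \<omega> $ i)"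
      proof (rule sum_mono)
        fix i
        show "k0 * p \<omega> $ i \<le> p \<omega> $ i * constr_at D s slater \<omega> $ i"
        proof (cases "i \<in> wcoords D s")
          case True
          then have "k0 \<le> constr_at D s slater \<omega> $ i"
            using \<kappa>(1)[OF True] elim(1) unfolding less_eq_vec_def by (meson order_trans)
          then show ?thesis using pw mult_left_mono[of k0 "constr_at D s slater \<omega> $ i" "p \<omega> $ i"]
            by (simp add: less_eq_vec_def mult.commute)
        next
          case False
          then show ?thesis using pw by (simp add: Wsp_def coord_space_def)
        qed
      qed
      finally show ?case by (simp add: inner_vec_def)
    qed
  qed (use p in auto)
  then have "k0 * (\<integral>\<omega>. norm (p \<omega>) \<partial>M) \<le> b" using b by simp
  then show ?thesis using k0 by (simp add: field_simps)
qed

text \<open>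
  The recourse condition (F) is what keeps the multiplier in \<open>L\<^sup>1\<close>: on the small set where the
  approximate multipliers are unbounded, a program is replaced by its feasible modification, where
  the multiplier term is non-negative and may be dropped.
\<close>

lemma constraint_multiplier:
  assumes J: "concave_continuous J"
    and R: "\<And>t. t < s \<Longrightarrow> t \<in> R" "\<And>t. t \<in> R \<Longrightarrow> \<not> s \<le> t"
    and V: "\<And>x. x \<in> feasible_on (insert s R) \<Longrightarrow> J x \<le> V"
  shows "\<exists>p. p \<in> borel_measurable (info D s) \<and> integrable M p \<and>
     (\<forall>\<omega>\<in>space M. p \<omega> \<in> Wsp D s \<and> 0 \<le> p \<omega>) \<and>
     (\<forall>x\<in>feasible_on R. J x + (\<integral>\<omega>. p \<omega> \<bullet> constr_at D s x \<omega> \<partial>M) \<le> V)"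
proof -
  \<comment> \<open>The multipliers that are correct up to 1/(n + 1). These sets decrease, and they
    are stable under midpoints because the pairing is linear in \<open>p\<close>. The error never
    exceeds 1, which makes the L1 bound below independent of \<open>n\<close>.\<close>
  define C where "C n = {p. p \<in> borel_measurable (info D s) \<and> integrable M p \<and>
     (\<forall>\<omega>\<in>space M. p \<omega> \<in> Wsp D s \<and> 0 \<le> p \<omega>) \<and>
     (\<forall>x\<in>feasible_on R. J x + (\<integral>\<omega>. p \<omega> \<bullet> constr_at D s x \<omega> \<partial>M) \<le> V + 1 / real (Suc n))}" for n
  have arith: "m = (a + b) / 2 \<Longrightarrow> j + a \<le> c \<Longrightarrow> j + b \<le> c \<Longrightarrow> j + m \<le> c" for m a b j c :: real
    by auto
  note gi = constr_at_inner_integrable[OF feasible_on_program]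
  obtain \<kappa> where \<kappa>: "\<And>t. \<kappa> t \<in> Wsp D t" "\<And>t i. i \<in> wcoords D t \<Longrightarrow> 0 < \<kappa> t $ i"
    "\<And>t. AE \<omega> in M. \<kappa> t \<le> constr_at D t slater \<omega>" using slater(2) by blast
  \<comment> \<open>The additional element 1 covers the case that \<open>W_s\<close> is the zero
    space.\<close>
  define k0 where "k0 = Min (insert 1 ((\<lambda>i. \<kappa> s $ i) ` wcoords D s))"
  have k0: "k0 > 0" "\<And>i. i \<in> wcoords D s \<Longrightarrow> k0 \<le> \<kappa> s $ i"
    unfolding k0_def using \<kappa>(2) by auto
  have CM: "p \<in> borel_measurable M" if "p \<in> C n" for p n
    using that info_measurable by (auto simp: C_def)
  have "\<exists>f h. (\<forall>n. f n \<in> C n) \<and> integrable M h \<and> (AE \<omega> in M. (\<lambda>n. f n \<omega>) \<longlonglongrightarrow> h \<omega>)"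
  proof (rule AE_convergent_selection)
    show "decseq C" unfolding decseq_def
    proof (intro allI impI subsetI)
      fix m n :: nat and p assume "m \<le> n" and p: "p \<in> C n"
      then have "1 / real (Suc n) \<le> 1 / real (Suc m)" by (intro divide_left_mono) auto
      then show "p \<in> C m" using p unfolding C_def by (auto intro: order_trans)
    qed
    show "C n \<noteq> {}" for n
      using approximate_constraint_multiplier[OF J V, of s R "1 / real (Suc n)"] unfolding C_def by fastforce
    show "integrable M p" if "p \<in> C n" for n p using that by (simp add: C_def)
    show "(\<integral>\<omega>. norm (p \<omega>) \<partial>M) \<le> (V + 1 - J slater) / k0" if p: "p \<in> C n" for n p
    proof (rule constraint_multiplier_L1_bound[OF CM[OF p] _ _ k0 \<kappa>(3)])
      have "J slater + (\<integral>\<omega>. p \<omega> \<bullet> constr_at D s slater \<omega> \<partial>M) \<le> V + 1 / real (Suc n)"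
        using p slater_feasible_on by (auto simp: C_def)
      moreover have "1 / real (Suc n) \<le> 1" by simp
      ultimately show "(\<integral>\<omega>. p \<omega> \<bullet> constr_at D s slater \<omega> \<partial>M) \<le> V + 1 - J slater" by linarith
    qed (use p in \<open>auto simp: C_def\<close>)
    show "(\<lambda>\<omega>. (1/2) *\<^sub>R (f \<omega> + g \<omega>)) \<in> C n" if f: "f \<in> C n" and g: "g \<in> C n" for n f g
      unfolding C_def
    proof (intro CollectI conjI ballI)
      show "(\<lambda>\<omega>. (1/2) *\<^sub>R (f \<omega> + g \<omega>)) \<in> borel_measurable (info D s)"
        using f g by (auto simp: C_def)
      show "integrable M (\<lambda>\<omega>. (1/2) *\<^sub>R (f \<omega> + g \<omega>))"
        using f g by (auto simp: C_def)
      fix x assume x: "x \<in> feasible_on R"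
      have "(\<integral>\<omega>. ((1/2) *\<^sub>R (f \<omega> + g \<omega>)) \<bullet> constr_at D s x \<omega> \<partial>M)
        = ((\<integral>\<omega>. f \<omega> \<bullet> constr_at D s x \<omega> \<partial>M) + (\<integral>\<omega>. g \<omega> \<bullet> constr_at D s x \<omega> \<partial>M)) / 2"
        using f g gi[OF x, of f s] gi[OF x, of g s] by (simp add: C_def inner_add_left)
      moreover have "J x + (\<integral>\<omega>. f \<omega> \<bullet> constr_at D s x \<omega> \<partial>M) \<le> V + 1 / real (Suc n)"
          "J x + (\<integral>\<omega>. g \<omega> \<bullet> constr_at D s x \<omega> \<partial>M) \<le> V + 1 / real (Suc n)"
        using f g x by (auto simp: C_def)
      ultimately show "J x + (\<integral>\<omega>. ((1/2) *\<^sub>R (f \<omega> + g \<omega>)) \<bullet> constr_at D s x \<omega> \<partial>M) \<le> V + 1 / real (Suc n)"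
        by (rule arith)
    next
      fix \<omega> assume w: "\<omega> \<in> space M"
      then have "f \<omega> \<in> Wsp D s" "g \<omega> \<in> Wsp D s" "0 \<le> f \<omega>" "0 \<le> g \<omega>" using f g by (auto simp: C_def)
      then show "(1/2) *\<^sub>R (f \<omega> + g \<omega>) \<in> Wsp D s" "0 \<le> (1/2) *\<^sub>R (f \<omega> + g \<omega>)"
        by (auto simp: Wsp_def coord_space_def less_eq_vec_def)
    qed
  qed
  then obtain f h where f: "\<And>n. f n \<in> C n" and hi: "integrable M h"
    and lim: "AE \<omega> in M. (\<lambda>n. f n \<omega>) \<longlonglongrightarrow> h \<omega>" by blast
  have fm: "f n \<in> borel_measurable (info D s)" and fM: "f n \<in> borel_measurable M"
    and fi: "integrable M (f n)" and fW: "\<omega> \<in> space M \<Longrightarrow> f n \<omega> \<in> Wsp D s \<inter> {v. 0 \<le> v}" for n \<omega>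
    using f[of n] CM[OF f] by (auto simp: C_def)
  have cl: "closed (Wsp D s \<inter> {v. 0 \<le> v})"
    unfolding Wsp_def by (intro closed_Int closed_coord_space closed_nonneg_vec)
  have "0 \<in> Wsp D s \<inter> {v. 0 \<le> v}" by (simp add: Wsp_def coord_space_def)
  from measurable_limit_in_closed[OF fm lim cl this fW]
  obtain p where p: "p \<in> borel_measurable (info D s)" "\<And>\<omega>. \<omega> \<in> space M \<Longrightarrow> p \<omega> \<in> Wsp D s \<inter> {v. 0 \<le> v}"
    and ph: "AE \<omega> in M. p \<omega> = h \<omega>" by blast
  have pM: "p \<in> borel_measurable M" using p(1) by (rule info_measurable)
  have pi: "integrable M p"
    by (rule integrable_cong_AE_imp[OF hi pM]) (rule eventually_mono[OF ph], simp)
  have "J x + (\<integral>\<omega>. p \<omega> \<bullet> constr_at D s x \<omega> \<partial>M) \<le> V" if x: "x \<in> feasible_on R" for x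
  proof -
    define g where "g = constr_at D s x"
    note xp = feasible_on_program[OF x]
    have gm: "g \<in> borel_measurable M" unfolding g_def using xp by (rule constr_at_measurable)
    have gle: "AE \<omega> in M. norm (g \<omega>) \<le> constr_bound" unfolding g_def using constr_at_bounded[OF xp] by (intro AE_I2)
    define T where "T k = exceed M f k" for k
    have Tm: "T k \<in> sets (info D s)" for k unfolding T_def by (intro exceed_sets fm) simp
    have Ts: "T k \<inter> space M = T k" for k by (auto simp: T_def exceed_def)
    \<comment> \<open>All strict predecessors of \<open>s\<close> belong to \<open>R\<close>, so
      their constraints are still enforced and (F) applies to \<open>x\<close>.\<close>
    have "x \<in> feasible_before D s"
      using x R(1) by (auto simp: feasible_on_def feasible_before_def)
    then obtain y where y: "y \<in> adapted D" "\<And>t \<omega>. t \<noteq> s \<Longrightarrow> \<omega> \<in> space M \<Longrightarrow> x t \<omega> = y t \<omega>"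
      "AE \<omega> in M. 0 \<le> constr_at D s y \<omega>"
      using condF unfolding cond_F_def by blast
    note yp = adapted_program[OF y(1)]
    \<comment> \<open>(F) changes \<open>x\<close> only at \<open>s\<close>, so \<open>z k\<close>
      differs from \<open>x\<close> only there. As \<open>T k\<close> is an event of
      \<open>info D s\<close>, the pasted program remains adapted.\<close>
    define z where "z k = (\<lambda>t \<omega>. if \<omega> \<in> T k then y t \<omega> else x t \<omega>)" for k
    have xa: "x \<in> adapted D" using x by (simp add: feasible_on_def)
    have zt: "z k t \<omega> = x t \<omega>" if "t \<noteq> s" "\<omega> \<in> space M" for k t \<omega>
      using y(2)[OF that] by (simp add: z_def)
    have zm: "z k t \<in> borel_measurable (info D t)" for k t
    proof (cases "t = s")
      case True
      have "z k s \<in> borel_measurable (info D s)" unfolding z_def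
        using Tm adaptedD[OF y(1)] adaptedD[OF xa] by (intro measurable_If_set) (auto simp: Ts)
      then show ?thesis using True by simp
    next
      case False
      have "z k t \<in> borel_measurable (info D t) \<longleftrightarrow> x t \<in> borel_measurable (info D t)"
        by (rule measurable_cong) (use zt False in auto)
      then show ?thesis using adaptedD[OF xa] by simp
    qed
    have zp: "z k \<in> programs D" for k
      unfolding programs_def
    proof (intro CollectI allI conjI ballI)
      fix t
      show "z k t \<in> borel_measurable M" using zm by (rule info_measurable)
      show "z k t \<omega> \<in> Vsp D t" if "\<omega> \<in> space M" for \<omega>
        using that programD(2)[OF yp] programD(2)[OF xp] by (simp add: z_def)
      show "AE \<omega> in M. z k t \<omega> \<in> actions D t \<omega>"
        using programD(3)[OF yp, of t] programD(3)[OF xp, of t]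
        by eventually_elim (simp add: z_def)
    qed
    have za: "z k \<in> adapted D" for k using zp zm by (simp add: adapted_def)
    \<comment> \<open>No member of \<open>R\<close> lies above \<open>s\<close>, so the constraints
      in \<open>R\<close> do not involve the action of \<open>s\<close> and are unaffected by the
      pasting.\<close>
    have "AE \<omega> in M. 0 \<le> constr_at D t (z k) \<omega>" if t: "t \<in> R" for t k
    proof -
      have "AE \<omega> in M. 0 \<le> constr_at D t x \<omega>" using x t by (simp add: feasible_on_def)
      then show ?thesis using AE_space
      proof eventually_elim
        case (elim \<omega>)
        have "constr_at D t (z k) \<omega> = constr_at D t x \<omega>"
          using R(2)[OF t] elim(2) by (intro constr_at_cong zt) auto
        then show ?case using elim(1) by simp
      qed
    qed
    then have zR: "z k \<in> feasible_on R" for k using za by (simp add: feasible_on_def)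
    have le: "J (z k) + (\<integral>\<omega>. (if \<omega> \<in> T k then 0 else f n \<omega> \<bullet> g \<omega>) \<partial>M) \<le> V + 1 / real (Suc n)" for k n
    proof -
      have i1: "integrable M (\<lambda>\<omega>. f n \<omega> \<bullet> g \<omega>)" unfolding g_def using xp fi by (rule constr_at_inner_integrable)
      have i2: "integrable M (\<lambda>\<omega>. if \<omega> \<in> T k then 0 else f n \<omega> \<bullet> g \<omega>)"
      proof (rule Bochner_Integration.integrable_bound[OF i1])
        show "(\<lambda>\<omega>. if \<omega> \<in> T k then 0 else f n \<omega> \<bullet> g \<omega>) \<in> borel_measurable M"
          using Tm[of k] sets_info[of s] fM gm by (intro measurable_If_set borel_measurable_inner) (auto simp: Ts)
      qed auto
      have "(\<integral>\<omega>. (if \<omega> \<in> T k then 0 else f n \<omega> \<bullet> g \<omega>) \<partial>M) \<le> (\<integral>\<omega>. f n \<omega> \<bullet> constr_at D s (z k) \<omega> \<partial>M)"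
      proof (rule integral_mono_AE[OF i2 constr_at_inner_integrable[OF zp fi]])
        show "AE \<omega> in M. (if \<omega> \<in> T k then 0 else f n \<omega> \<bullet> g \<omega>) \<le> f n \<omega> \<bullet> constr_at D s (z k) \<omega>"
          using y(3) AE_space
        proof eventually_elim
          case (elim \<omega>)
          show ?case
          proof (cases "\<omega> \<in> T k")
            case True
            then have "constr_at D s (z k) \<omega> = constr_at D s y \<omega>"
              by (intro constr_at_cong) (simp add: z_def)
            then show ?thesis using True elim(1) fW[OF elim(2), of n] by (simp add: inner_nonneg_vec)
          next
            case False
            then have "constr_at D s (z k) \<omega> = g \<omega>"
              unfolding g_def by (intro constr_at_cong) (simp add: z_def)
            then show ?thesis using False by simp
          qed
        qed
      qed
      moreover have "J (z k) + (\<integral>\<omega>. f n \<omega> \<bullet> constr_at D s (z k) \<omega> \<partial>M) \<le> V + 1 / real (Suc n)"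
        using f[of n] zR by (simp add: C_def)
      ultimately show ?thesis by linarith
    qed
    note tl = truncated_inner_limits[OF fM hi lim gm gle, folded T_def]
    have le2: "J (z k) + (\<integral>\<omega>. (if \<omega> \<in> T k then 0 else h \<omega> \<bullet> g \<omega>) \<partial>M) \<le> V" for k
    proof -
      have "(\<lambda>n. V + 1 / real (Suc n)) \<longlonglongrightarrow> V + 0"
        by (intro tendsto_add tendsto_const LIMSEQ_inverse_Suc)
      then show ?thesis
        using LIMSEQ_le[OF tendsto_add[OF tendsto_const tl(1)[of k]]] le[of k] by fastforce
    qed
    have "AE_tendsto z x" unfolding AE_tendsto_def
    proof
      fix t show "AE \<omega> in M. (\<lambda>k. z k t \<omega>) \<longlonglongrightarrow> x t \<omega>"
        using AE_eventually_not_exceed[OF lim, folded T_def]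
      proof eventually_elim
        case (elim \<omega>)
        then show ?case by (intro tendsto_eventually) (erule eventually_mono, simp add: z_def)
      qed
    qed
    then have "(\<lambda>k. J (z k)) \<longlonglongrightarrow> J x" using concave_continuousD(2)[OF J xp zp] by simp
    from LIMSEQ_le_const2[OF tendsto_add[OF this tl(2)]] le2
    have "J x + (\<integral>\<omega>. h \<omega> \<bullet> g \<omega> \<partial>M) \<le> V" by blast
    moreover have "(\<integral>\<omega>. h \<omega> \<bullet> g \<omega> \<partial>M) = (\<integral>\<omega>. p \<omega> \<bullet> g \<omega> \<partial>M)"
    proof (rule integral_cong_AE)
      show "AE \<omega> in M. h \<omega> \<bullet> g \<omega> = p \<omega> \<bullet> g \<omega>" using ph by eventually_elim simp
    qed (use hi pM gm in auto)
    ultimately show ?thesis by (simp add: g_def)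
  qed
  then show ?thesis using p pi by blast
qed

lemma concave_continuous_add_constrs:
  assumes "concave_continuous J" and "\<And>t. t \<in> S \<Longrightarrow> integrable M (p t)"
    and "\<And>t \<omega>. t \<in> S \<Longrightarrow> \<omega> \<in> space M \<Longrightarrow> 0 \<le> p t \<omega>"
  shows "concave_continuous (\<lambda>x. J x + (\<Sum>t\<in>S. \<integral>\<omega>. p t \<omega> \<bullet> constr_at D t x \<omega> \<partial>M))"
  using finite[of S] assms(2,3)
proof (induction S rule: finite_induct)
  case empty
  then show ?case using assms(1) by simp
next
  case (insert s S)
  then have "concave_continuous (\<lambda>x. J x + (\<Sum>t\<in>S. \<integral>\<omega>. p t \<omega> \<bullet> constr_at D t x \<omega> \<partial>M))" by simp
  from concave_continuous_add_constr[OF this, of "p s" s] insert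
  show ?case by (simp add: add.commute add.left_commute)
qed

text \<open>Induction on the number of relaxed constraints, whose index set \<open>S\<close> is kept
  closed upwards. The next \<open>s\<close> is maximal among the rest: everything below
  \<open>s\<close> is still enforced, so (F) can be used, and no other enforced constraint lies
  above \<open>s\<close>. The recourse may violate relaxed constraints above \<open>s\<close>, but
  these enter only through \<open>L S p\<close>, whose continuity absorbs the change.\<close>

lemma constraint_multipliers:
  assumes V: "\<And>x. x \<in> feasible D \<Longrightarrow> payoff D x \<le> V"
  shows "\<exists>p. (\<forall>t. p t \<in> borel_measurable (info D t) \<and> integrable M (p t) \<and>
        (\<forall>\<omega>\<in>space M. p t \<omega> \<in> Wsp D t \<and> 0 \<le> p t \<omega>)) \<and>
     (\<forall>x\<in>adapted D. payoff D x + (\<Sum>t\<in>UNIV. \<integral>\<omega>. p t \<omega> \<bullet> constr_at D t x \<omega> \<partial>M) \<le> V)"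
proof -
  define ok where "ok t p \<longleftrightarrow> p \<in> borel_measurable (info D t) \<and> integrable M p \<and>
        (\<forall>\<omega>\<in>space M. p \<omega> \<in> Wsp D t \<and> 0 \<le> p \<omega>)" for t p
  define L where "L S p x = payoff D x + (\<Sum>t\<in>S. \<integral>\<omega>. p t \<omega> \<bullet> constr_at D t x \<omega> \<partial>M)" for S p x
  have "n \<le> CARD('t) \<Longrightarrow> \<exists>S p. card S = n \<and> (\<forall>t\<in>S. \<forall>s\<ge>t. s \<in> S) \<and> (\<forall>t\<in>S. ok t (p t)) \<and>
      (\<forall>x\<in>feasible_on (- S). L S p x \<le> V)" for n
  proof (induction n)
    case 0
    have "feasible_on UNIV = feasible D" by (auto simp: feasible_on_def feasible_def)
    then show ?case using V by (intro exI[of _ "{}"]) (auto simp: L_def)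
  next
    case (Suc n)
    then obtain S p where S: "card S = n" "\<And>t s. t \<in> S \<Longrightarrow> t \<le> s \<Longrightarrow> s \<in> S" "\<And>t. t \<in> S \<Longrightarrow> ok t (p t)"
      "\<And>x. x \<in> feasible_on (- S) \<Longrightarrow> L S p x \<le> V" by (metis Suc_leD)
    have "S \<noteq> UNIV" using S(1) Suc.prems by auto
    then have "- S \<noteq> {}" by auto
    then obtain s where s: "s \<notin> S" "\<And>t. t \<notin> S \<Longrightarrow> s \<le> t \<Longrightarrow> s = t"
      using finite_has_maximal[of "- S"] by auto
    have ins: "insert s (- S - {s}) = - S" using s by auto
    have "concave_continuous (L S p)"
      unfolding L_def using S(3) by (intro concave_continuous_add_constrs concave_continuous_payoff) (auto simp: ok_def)
    moreover have "t \<in> - S - {s}" if "t < s" for t using s(1) S(2)[of t s] that by (auto dest: less_imp_le)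
    moreover have "\<not> s \<le> t" if "t \<in> - S - {s}" for t using s(2)[of t] that by auto
    moreover have "L S p x \<le> V" if "x \<in> feasible_on (insert s (- S - {s}))" for x using S(4) that unfolding ins .
    ultimately have "\<exists>r. r \<in> borel_measurable (info D s) \<and> integrable M r \<and>
      (\<forall>\<omega>\<in>space M. r \<omega> \<in> Wsp D s \<and> 0 \<le> r \<omega>) \<and>
      (\<forall>x\<in>feasible_on (- S - {s}). L S p x + (\<integral>\<omega>. r \<omega> \<bullet> constr_at D s x \<omega> \<partial>M) \<le> V)"
      by (rule constraint_multiplier)
    then obtain r where r: "ok s r" "\<And>x. x \<in> feasible_on (- S - {s}) \<Longrightarrow> L S p x + (\<integral>\<omega>. r \<omega> \<bullet> constr_at D s x \<omega> \<partial>M) \<le> V"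
      unfolding ok_def by blast
    have "L (insert s S) (p(s := r)) x \<le> V" if "x \<in> feasible_on (- insert s S)" for x
    proof -
      have "(\<Sum>t\<in>S. \<integral>\<omega>. (p(s := r)) t \<omega> \<bullet> constr_at D t x \<omega> \<partial>M) = (\<Sum>t\<in>S. \<integral>\<omega>. p t \<omega> \<bullet> constr_at D t x \<omega> \<partial>M)"
        using s(1) by (intro sum.cong) auto
      moreover have "- insert s S = - S - {s}" by auto
      ultimately show ?thesis using r(2) that s(1) by (simp add: L_def add.commute add.left_commute)
    qed
    moreover have "\<forall>t\<in>insert s S. \<forall>u\<ge>t. u \<in> insert s S" using s(2) S(2) by (metis insert_iff)
    moreover have "\<forall>t\<in>insert s S. ok t ((p(s := r)) t)" using r(1) S(3) by auto
    moreover have "card (insert s S) = Suc n" using S(1) s(1) by simp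
    ultimately show ?case by blast
  qed
  from this[OF order_refl] obtain S p where S: "card S = CARD('t) \<and> (\<forall>t\<in>S. \<forall>s\<ge>t. s \<in> S) \<and>
      (\<forall>t\<in>S. ok t (p t)) \<and> (\<forall>x\<in>feasible_on (- S). L S p x \<le> V)"
    by (elim exE)
  have "S = UNIV" using S by (intro card_subset_eq) auto
  then show ?thesis using S by (intro exI[of _ p]) (auto simp: ok_def L_def feasible_on_def)
qed

end

section \<open>Conditional expectations of programs\<close>

text \<open>
  Going far out along the outward normal at the nearest point of \<open>S\<close> makes the gap between
  the two squared distances exceed any bound.
\<close>

lemma mem_if_infdist_le:
  fixes S :: "'a::euclidean_space set"
  assumes S: "convex S" "closed S" "S \<noteq> {}" and L: "subspace L" "S \<subseteq> L" "y \<in> L"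
    and le: "\<And>b. b \<in> L \<Longrightarrow> (infdist b S)\<^sup>2 \<le> (norm (b - y))\<^sup>2 + K"
  shows "y \<in> S"
proof (rule ccontr)
  assume "y \<notin> S"
  define a where "a = closest_point S y"
  define w where "w = y - a"
  have aS: "a \<in> S" unfolding a_def using S by (intro closest_point_in_set)
  then have w0: "w \<noteq> 0" using \<open>y \<notin> S\<close> by (auto simp: w_def)
  then have nw: "norm w > 0" by simp
  \<comment> \<open>Then \<open>b\<close> has distance at least s|w| from \<open>S\<close> and
    distance (s - 1)|w| from \<open>y\<close>. The squares differ by (2s - 1)|w|^2 = 2|K| + |w|^2,
    which exceeds \<open>K\<close>.\<close>
  define s where "s = \<bar>K\<bar> / (norm w)\<^sup>2 + 1"
  have s1: "s \<ge> 1" by (simp add: s_def)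
  define b where "b = a + s *\<^sub>R w"
  have aL: "a \<in> L" using aS L by auto
  have bL: "b \<in> L" unfolding b_def w_def
    using aL L by (intro subspace_add subspace_scale subspace_diff)
  have "s * norm w \<le> infdist b S"
    unfolding infdist_notempty[OF S(3)]
  proof (rule cINF_greatest[OF S(3)])
    fix c assume c: "c \<in> S"
    \<comment> \<open>\<open>S\<close> lies behind the hyperplane through its nearest point
      \<open>a\<close> with normal \<open>w\<close>, hence no point of \<open>S\<close> is closer to
      \<open>b\<close> than \<open>a\<close>.\<close>
    have "w \<bullet> (c - a) \<le> 0" unfolding w_def a_def
      using S c by (intro closest_point_dot)
    then have "0 \<le> s * (- (w \<bullet> (c - a)))" using s1 by (intro mult_nonneg_nonneg) auto
    have "(s * norm w)\<^sup>2 = s\<^sup>2 * (w \<bullet> w)"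
      by (simp add: power_mult_distrib power2_norm_eq_inner)
    also have "\<dots> \<le> s\<^sup>2 * (w \<bullet> w) + 2 * (s * (- (w \<bullet> (c - a)))) + (c - a) \<bullet> (c - a)"
      using \<open>0 \<le> s * (- (w \<bullet> (c - a)))\<close> inner_ge_zero[of "c - a"] by linarith
    also have "\<dots> = (s *\<^sub>R w - (c - a)) \<bullet> (s *\<^sub>R w - (c - a))"
      by (simp add: inner_diff_left inner_diff_right inner_commute power2_eq_square algebra_simps)
    also have "\<dots> = (dist b c)\<^sup>2"
      by (simp add: dist_norm power2_norm_eq_inner b_def algebra_simps)
    finally show "s * norm w \<le> dist b c" by (rule power2_le_imp_le) simp
  qed
  then have "(s * norm w)\<^sup>2 \<le> (infdist b S)\<^sup>2" using s1 by (intro power_mono) auto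
  also have "\<dots> \<le> (norm (b - y))\<^sup>2 + K" by (rule le[OF bL])
  also have "b - y = (s - 1) *\<^sub>R w" by (simp add: b_def w_def algebra_simps)
  finally have "s\<^sup>2 * (norm w)\<^sup>2 \<le> (s - 1)\<^sup>2 * (norm w)\<^sup>2 + K"
    by (simp add: power_mult_distrib)
  then have "(2 * s - 1) * (norm w)\<^sup>2 \<le> K"
    by (simp add: power2_eq_square algebra_simps)
  moreover have "(2 * s - 1) * (norm w)\<^sup>2 = 2 * \<bar>K\<bar> + (norm w)\<^sup>2"
    using nw by (simp add: s_def field_simps)
  moreover have "(norm w)\<^sup>2 > 0" using nw by simp
  ultimately show False by linarith
qed

text \<open>For a squared norm the expansion is an identity with remainder u^2 |a - b|^2, and
  \<open>2 * c\<close> bounds |a - b|. It plays the part for the information penalty that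
  \<open>neg_part_mix\<close> plays for the constraints.\<close>

lemma norm_mix_power2:
  fixes a b :: "'b::real_inner"
  assumes "norm a \<le> c" "norm b \<le> c"
  shows "((1 - u) *\<^sub>R a + u *\<^sub>R b) \<bullet> ((1 - u) *\<^sub>R a + u *\<^sub>R b)
    \<le> (1 - 2 * u) * (a \<bullet> a) + 2 * u * (a \<bullet> b) + u\<^sup>2 * (2 * c)\<^sup>2"
proof -
  have "((1 - u) *\<^sub>R a + u *\<^sub>R b) \<bullet> ((1 - u) *\<^sub>R a + u *\<^sub>R b)
    = (1 - 2 * u) * (a \<bullet> a) + 2 * u * (a \<bullet> b) + u\<^sup>2 * (norm (a - b))\<^sup>2"
    unfolding power2_norm_eq_inner
    by (simp add: inner_add_left inner_add_right inner_diff_left inner_diff_right inner_commute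
        power2_eq_square algebra_simps)
  moreover have "norm (a - b) \<le> 2 * c" using assms norm_triangle_ineq4[of a b] by simp
  then have "(norm (a - b))\<^sup>2 \<le> (2 * c)\<^sup>2" by (intro power_mono) auto
  then have "u\<^sup>2 * (norm (a - b))\<^sup>2 \<le> u\<^sup>2 * (2 * c)\<^sup>2" by (intro mult_left_mono) auto
  ultimately show ?thesis by linarith
qed

section \<open>Conditional expectation as a map from programs to adapted programs\<close>

context team_problem
begin

lemma sigma_finite_info: "sigma_finite_subalgebra M (info D t)"
  using finite_measure_axioms subalg
  by (intro finite_measure_subalgebra_is_sigma_finite)
    (auto simp: finite_measure_subalgebra_def finite_measure_subalgebra_axioms_def)

text \<open>
  Coordinates outside \<open>vcoords D t\<close> are set to 0 because \<open>real_cond_exp\<close> of the zero function is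
  only almost everywhere 0, while programs must have values in \<open>Vsp D t\<close> everywhere.
\<close>

definition cproj :: "('t \<Rightarrow> 'o \<Rightarrow> real^'v) \<Rightarrow> 't \<Rightarrow> 'o \<Rightarrow> real^'v" where
  "cproj x t \<omega> = (\<chi> i. if i \<in> vcoords D t then real_cond_exp M (info D t) (\<lambda>\<omega>. x t \<omega> $ i) \<omega> else 0)"

lemma cproj_measurable: "cproj x t \<in> borel_measurable (info D t)"
  unfolding cproj_def
proof (rule vec_lambda_measurable)
  show "(\<lambda>\<omega>. if i \<in> vcoords D t then real_cond_exp M (info D t) (\<lambda>\<omega>. x t \<omega> $ i) \<omega> else 0)
      \<in> borel_measurable (info D t)" for i
    by (cases "i \<in> vcoords D t") auto
qed

lemma cproj_Vsp: "cproj x t \<omega> \<in> Vsp D t"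
  by (simp add: cproj_def Vsp_def coord_space_def)

lemma program_component_integrable: "x \<in> programs D \<Longrightarrow> integrable M (\<lambda>\<omega>. x t \<omega> $ i)"
  using program_integrable[of x t] integrable_bounded_linear[OF bounded_linear_vec_nth] by blast

lemma cproj_component:
  assumes x: "x \<in> programs D"
  shows "AE \<omega> in M. cproj x t \<omega> $ i = real_cond_exp M (info D t) (\<lambda>\<omega>. x t \<omega> $ i) \<omega>"
proof (cases "i \<in> vcoords D t")
  case False
  interpret sigma_finite_subalgebra M "info D t" by (rule sigma_finite_info)
  have "AE \<omega> in M. real_cond_exp M (info D t) (\<lambda>\<omega>. x t \<omega> $ i) \<omega> = real_cond_exp M (info D t) (\<lambda>\<omega>. 0) \<omega>"
  proof (rule real_cond_exp_cong)
    show "AE \<omega> in M. x t \<omega> $ i = 0"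
      using programD(2)[OF x] False by (intro AE_I2) (auto simp: Vsp_def coord_space_def)
  qed (use program_component_integrable[OF x] in auto)
  moreover have "AE \<omega> in M. real_cond_exp M (info D t) (\<lambda>\<omega>. 0) \<omega> = 0"
    by (rule real_cond_exp_F_meas) auto
  ultimately show ?thesis by eventually_elim (simp add: cproj_def False)
qed (simp add: cproj_def)

lemma cproj_eq_vec_cond_exp:
  assumes x: "x \<in> programs D"
  shows "AE \<omega> in M. cproj x t \<omega> = vec_cond_exp M (info D t) (x t) \<omega>"
proof -
  have "AE \<omega> in M. \<forall>i\<in>UNIV. cproj x t \<omega> $ i = real_cond_exp M (info D t) (\<lambda>\<omega>. x t \<omega> $ i) \<omega>"
    using cproj_component[OF x] by (intro AE_finite_allI) auto
  then show ?thesis by eventually_elim (simp add: vec_cond_exp_def vec_eq_iff)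
qed

lemma cproj_inner_const:
  assumes x: "x \<in> programs D"
  shows "AE \<omega> in M. real_cond_exp M (info D t) (\<lambda>\<omega>. b \<bullet> x t \<omega>) \<omega> = b \<bullet> cproj x t \<omega>"
proof -
  interpret sigma_finite_subalgebra M "info D t" by (rule sigma_finite_info)
  note xi = program_component_integrable[OF x, of t]
  have "AE \<omega> in M. real_cond_exp M (info D t) (\<lambda>\<omega>. \<Sum>i\<in>UNIV. b $ i * x t \<omega> $ i) \<omega>
      = (\<Sum>i\<in>UNIV. real_cond_exp M (info D t) (\<lambda>\<omega>. b $ i * x t \<omega> $ i) \<omega>)"
    by (rule real_cond_exp_sum) (use xi in auto)
  moreover have "AE \<omega> in M. \<forall>i\<in>UNIV. real_cond_exp M (info D t) (\<lambda>\<omega>. b $ i * x t \<omega> $ i) \<omega>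
      = b $ i * real_cond_exp M (info D t) (\<lambda>\<omega>. x t \<omega> $ i) \<omega>"
    using real_cond_exp_cmult[OF xi] by (intro AE_finite_allI) auto
  moreover have "AE \<omega> in M. \<forall>i\<in>UNIV. cproj x t \<omega> $ i = real_cond_exp M (info D t) (\<lambda>\<omega>. x t \<omega> $ i) \<omega>"
    using cproj_component[OF x] by (intro AE_finite_allI) auto
  ultimately show ?thesis by eventually_elim (simp add: inner_vec_def)
qed

text \<open>The characteristic identity of the conditional expectation, coordinate by coordinate.
  The weight \<open>w\<close> may be any integrable function of the information of \<open>t\<close>,
  because programs are bounded. The symmetry and orthogonality relations for residuals rest on
  it.\<close>

lemma cproj_inner:
  assumes x: "x \<in> programs D" and w: "w \<in> borel_measurable (info D t)" "integrable M w"
  shows "integrable M (\<lambda>\<omega>. w \<omega> \<bullet> cproj x t \<omega>)"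
    and "(\<integral>\<omega>. w \<omega> \<bullet> cproj x t \<omega> \<partial>M) = (\<integral>\<omega>. w \<omega> \<bullet> x t \<omega> \<partial>M)"
proof -
  interpret sigma_finite_subalgebra M "info D t" by (rule sigma_finite_info)
  have wi: "integrable M (\<lambda>\<omega>. w \<omega> $ i)" for i
    using w(2) integrable_bounded_linear[OF bounded_linear_vec_nth] by blast
  have wm: "(\<lambda>\<omega>. w \<omega> $ i) \<in> borel_measurable (info D t)" for i using w(1) by measurable
  have xm: "(\<lambda>\<omega>. x t \<omega> $ i) \<in> borel_measurable M" for i
    using program_component_integrable[OF x] by (rule borel_measurable_integrable)
  have wx: "integrable M (\<lambda>\<omega>. w \<omega> $ i * x t \<omega> $ i)" for i
  proof (rule Bochner_Integration.integrable_bound[where f="\<lambda>\<omega>. action_bound * w \<omega> $ i"])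
    show "AE \<omega> in M. norm (w \<omega> $ i * x t \<omega> $ i) \<le> norm (action_bound * w \<omega> $ i)"
      using program_bounded[OF x, of t]
    proof eventually_elim
      case (elim \<omega>)
      then have "\<bar>x t \<omega> $ i\<bar> \<le> action_bound" using component_le_norm_cart order_trans by blast
      then have "\<bar>w \<omega> $ i\<bar> * \<bar>x t \<omega> $ i\<bar> \<le> \<bar>w \<omega> $ i\<bar> * action_bound" by (intro mult_left_mono) auto
      then show ?case using action_bound(1) by (simp add: abs_mult mult.commute)
    qed
    show "(\<lambda>\<omega>. w \<omega> $ i * x t \<omega> $ i) \<in> borel_measurable M"
      using wi xm by (intro borel_measurable_times) auto
  qed (use wi in auto)
  have AEc: "AE \<omega> in M. (\<Sum>i\<in>UNIV. w \<omega> $ i * real_cond_exp M (info D t) (\<lambda>\<omega>. x t \<omega> $ i) \<omega>) = w \<omega> \<bullet> cproj x t \<omega>"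
  proof -
    have "AE \<omega> in M. \<forall>i\<in>UNIV. cproj x t \<omega> $ i = real_cond_exp M (info D t) (\<lambda>\<omega>. x t \<omega> $ i) \<omega>"
      using cproj_component[OF x] by (intro AE_finite_allI) auto
    then show ?thesis by eventually_elim (simp add: inner_vec_def)
  qed
  have wcm: "(\<lambda>\<omega>. w \<omega> \<bullet> cproj x t \<omega>) \<in> borel_measurable M"
    using w(2) info_measurable[OF cproj_measurable] by (intro borel_measurable_inner) auto
  have si: "integrable M (\<lambda>\<omega>. \<Sum>i\<in>UNIV. w \<omega> $ i * real_cond_exp M (info D t) (\<lambda>\<omega>. x t \<omega> $ i) \<omega>)"
    using real_cond_exp_intg(1)[OF wx wm xm] by auto
  show i: "integrable M (\<lambda>\<omega>. w \<omega> \<bullet> cproj x t \<omega>)"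
    by (rule integrable_cong_AE_imp[OF si wcm AEc])
  have "(\<integral>\<omega>. w \<omega> \<bullet> cproj x t \<omega> \<partial>M)
      = (\<integral>\<omega>. (\<Sum>i\<in>UNIV. w \<omega> $ i * real_cond_exp M (info D t) (\<lambda>\<omega>. x t \<omega> $ i) \<omega>) \<partial>M)"
    using si wcm by (intro integral_cong_AE AE_symmetric[OF AEc]) auto
  also have "\<dots> = (\<Sum>i\<in>UNIV. \<integral>\<omega>. w \<omega> $ i * real_cond_exp M (info D t) (\<lambda>\<omega>. x t \<omega> $ i) \<omega> \<partial>M)"
    using real_cond_exp_intg(1)[OF wx wm xm] by simp
  also have "\<dots> = (\<Sum>i\<in>UNIV. \<integral>\<omega>. w \<omega> $ i * x t \<omega> $ i \<partial>M)"
    using real_cond_exp_intg(2)[OF wx wm xm] by simp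
  also have "\<dots> = (\<integral>\<omega>. w \<omega> \<bullet> x t \<omega> \<partial>M)"
    unfolding inner_vec_def using wx by simp
  finally show "(\<integral>\<omega>. w \<omega> \<bullet> cproj x t \<omega> \<partial>M) = (\<integral>\<omega>. w \<omega> \<bullet> x t \<omega> \<partial>M)" .
qed

definition interior_program :: "('t \<Rightarrow> 'o \<Rightarrow> real^'v) \<Rightarrow> real \<Rightarrow> bool" where
  "interior_program x \<theta> \<longleftrightarrow> x \<in> adapted D \<and> \<theta> > 0 \<and>
     (\<forall>t. \<forall>\<omega>\<in>space M. ball (x t \<omega>) \<theta> \<inter> Vsp D t \<subseteq> actions D t \<omega>)"

lemma interior_program_exists: "\<exists>x \<theta>. interior_program x \<theta>"
  using condD by (auto simp: cond_D_def interior_program_def)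

lemma actions_nonempty: "\<omega> \<in> space M \<Longrightarrow> actions D t \<omega> \<noteq> {}"
proof -
  assume w: "\<omega> \<in> space M"
  obtain x \<theta> where x: "interior_program x \<theta>" using interior_program_exists by blast
  then have "x t \<omega> \<in> ball (x t \<omega>) \<theta> \<inter> Vsp D t"
    using programD(2)[OF adapted_program w] by (auto simp: interior_program_def)
  then show ?thesis using x w unfolding interior_program_def by blast
qed

text \<open>
  For \<open>x \<in> A\<close> one has \<open>d(b, A)\<^sup>2 \<le> |b|\<^sup>2 - 2 b x + K\<^sup>2\<close>.  This is affine in \<open>x\<close>, so it passes
  to the conditional expectation, for all \<open>b\<close> in a countable dense set simultaneously.
\<close>

lemma cproj_actions:
  assumes x: "x \<in> programs D"
  shows "AE \<omega> in M. cproj x t \<omega> \<in> actions D t \<omega>"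
proof -
  interpret sigma_finite_subalgebra M "info D t" by (rule sigma_finite_info)
  define d where "d b \<omega> = infdist b (actions D t \<omega>)" for b \<omega>
  have main: "AE \<omega> in M. (d b \<omega>)\<^sup>2 \<le> b \<bullet> b - 2 * (b \<bullet> cproj x t \<omega>) + action_bound\<^sup>2" if b: "b \<in> Vsp D t" for b
  proof -
    have dm: "d b \<in> borel_measurable (info D t)"
      using condA b unfolding cond_A_def d_def by blast
    \<comment> \<open>The distance estimate solved for \<open>b \<bullet> x t \<omega>\<close>. By
      (A) the distance to the action set is measurable for the information of \<open>t\<close>, so
      \<open>\<beta>\<close> is its own conditional expectation.\<close>
    define \<beta> where "\<beta> \<omega> = (b \<bullet> b + action_bound\<^sup>2 - (d b \<omega>)\<^sup>2) / 2" for \<omega>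
    have \<beta>m: "\<beta> \<in> borel_measurable (info D t)" unfolding \<beta>_def using dm by measurable
    have d_le: "(d b \<omega>)\<^sup>2 \<le> (norm b + action_bound)\<^sup>2" if w: "\<omega> \<in> space M" for \<omega>
    proof -
      obtain a where a: "a \<in> actions D t \<omega>" using actions_nonempty[OF w] by blast
      have "d b \<omega> \<le> dist b a" unfolding d_def using a by (rule infdist_le)
      also have "\<dots> \<le> norm b + norm a" by (simp add: dist_norm norm_triangle_ineq4)
      also have "\<dots> \<le> norm b + action_bound" using action_bound(2)[OF w a] by simp
      finally show ?thesis unfolding d_def by (intro power_mono infdist_nonneg)
    qed
    have d2i: "integrable M (\<lambda>\<omega>. (d b \<omega>)\<^sup>2)"
      using d_le info_measurable[OF dm] by (intro integrable_const_bound[of _ "(norm b + action_bound)\<^sup>2"]) auto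
    have \<beta>i: "integrable M \<beta>" unfolding \<beta>_def using d2i by auto
    have "AE \<omega> in M. b \<bullet> x t \<omega> \<le> \<beta> \<omega>"
      using programD(3)[OF x, of t] AE_space
    proof eventually_elim
      case (elim \<omega>)
      have "(d b \<omega>)\<^sup>2 \<le> (dist b (x t \<omega>))\<^sup>2"
        unfolding d_def using infdist_le[OF elim(1)] by (intro power_mono infdist_nonneg)
      also have "\<dots> = b \<bullet> b - 2 * (b \<bullet> x t \<omega>) + (norm (x t \<omega>))\<^sup>2"
        unfolding dist_norm power2_norm_eq_inner
        by (simp add: inner_diff_left inner_diff_right inner_commute)
      also have "(norm (x t \<omega>))\<^sup>2 \<le> action_bound\<^sup>2" using action_bound(2)[OF elim(2,1)] by (intro power_mono) auto
      finally show ?case by (simp add: \<beta>_def)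
    qed
    moreover have "integrable M (\<lambda>\<omega>. b \<bullet> x t \<omega>)" using program_integrable[OF x] by simp
    ultimately have "AE \<omega> in M. real_cond_exp M (info D t) (\<lambda>\<omega>. b \<bullet> x t \<omega>) \<omega> \<le> real_cond_exp M (info D t) \<beta> \<omega>"
      using \<beta>i by (intro real_cond_exp_mono)
    moreover have "AE \<omega> in M. real_cond_exp M (info D t) \<beta> \<omega> = \<beta> \<omega>"
      using \<beta>i \<beta>m by (rule real_cond_exp_F_meas)
    ultimately show ?thesis using cproj_inner_const[OF x, of t b]
    proof eventually_elim
      case (elim \<omega>)
      then have "b \<bullet> cproj x t \<omega> \<le> \<beta> \<omega>" by simp
      then show ?case by (simp add: \<beta>_def)
    qed
  qed
  obtain B where B: "countable B" "B \<subseteq> Vsp D t" "Vsp D t \<subseteq> closure B"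
    using separable[of "Vsp D t"] by metis
  have "AE \<omega> in M. \<forall>b\<in>B. (d b \<omega>)\<^sup>2 \<le> b \<bullet> b - 2 * (b \<bullet> cproj x t \<omega>) + action_bound\<^sup>2"
    using main B by (intro AE_ball_countable') auto
  then show ?thesis using AE_space
  proof eventually_elim
    case (elim \<omega>)
    let ?S = "actions D t \<omega>"
    \<comment> \<open>At a fixed point both sides are continuous in \<open>b\<close>, so the
      estimate extends from the dense set \<open>B\<close> to all of \<open>Vsp D t\<close>.\<close>
    define Z where "Z = {b. (infdist b ?S)\<^sup>2 \<le> b \<bullet> b - 2 * (b \<bullet> cproj x t \<omega>) + action_bound\<^sup>2}"
    have "closed Z" unfolding Z_def
      by (intro closed_Collect_le continuous_intros)
    moreover have "B \<subseteq> Z" using elim(1) by (auto simp: Z_def d_def)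
    ultimately have "closure B \<subseteq> Z" by (rule closure_minimal[rotated])
    then have VZ: "Vsp D t \<subseteq> Z" using B(3) by blast
    show ?case
    proof (rule mem_if_infdist_le[where L="Vsp D t" and K="action_bound\<^sup>2"])
      fix b assume "b \<in> Vsp D t"
      then have "(infdist b ?S)\<^sup>2 \<le> b \<bullet> b - 2 * (b \<bullet> cproj x t \<omega>) + action_bound\<^sup>2" using VZ by (auto simp: Z_def)
      \<comment> \<open>Completing the square adds the non-negative term |E_t x_t|^2 and brings the
        bound into the form of the distance criterion.\<close>
      also have "\<dots> \<le> (norm (b - cproj x t \<omega>))\<^sup>2 + action_bound\<^sup>2"
        unfolding power2_norm_eq_inner by (simp add: inner_diff_left inner_diff_right inner_commute)
      finally show "(infdist b ?S)\<^sup>2 \<le> (norm (b - cproj x t \<omega>))\<^sup>2 + action_bound\<^sup>2" .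
    qed (use convex_actions closed_actions actions_nonempty actions_Vsp subspace_Vsp cproj_Vsp elim(2) in auto)
  qed
qed

lemma cproj_program: "x \<in> programs D \<Longrightarrow> cproj x \<in> programs D"
proof -
  assume x: "x \<in> programs D"
  show ?thesis unfolding programs_def
    using info_measurable[OF cproj_measurable] cproj_Vsp cproj_actions[OF x] by blast
qed

lemma cproj_adapted: "x \<in> programs D \<Longrightarrow> cproj x \<in> adapted D"
  using cproj_program cproj_measurable by (simp add: adapted_def)

lemma cproj_of_adapted:
  assumes x: "x \<in> adapted D"
  shows "AE \<omega> in M. cproj x t \<omega> = x t \<omega>"
proof -
  interpret sigma_finite_subalgebra M "info D t" by (rule sigma_finite_info)
  note xp = adapted_program[OF x]
  have m: "(\<lambda>\<omega>. x t \<omega> $ i) \<in> borel_measurable (info D t)" for i using adaptedD[OF x, of t] by measurable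
  have "AE \<omega> in M. \<forall>i\<in>UNIV. cproj x t \<omega> $ i = real_cond_exp M (info D t) (\<lambda>\<omega>. x t \<omega> $ i) \<omega>"
    using cproj_component[OF xp] by (intro AE_finite_allI) auto
  moreover have "AE \<omega> in M. \<forall>i\<in>UNIV. real_cond_exp M (info D t) (\<lambda>\<omega>. x t \<omega> $ i) \<omega> = x t \<omega> $ i"
    using real_cond_exp_F_meas[OF program_component_integrable[OF xp] m] by (intro AE_finite_allI) auto
  ultimately show ?thesis by eventually_elim (simp add: vec_eq_iff)
qed

lemma cproj_mix:
  assumes x: "x \<in> programs D" and y: "y \<in> programs D"
  shows "AE \<omega> in M. cproj (mix u x y) t \<omega> = (1 - u) *\<^sub>R cproj x t \<omega> + u *\<^sub>R cproj y t \<omega>"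
proof -
  interpret sigma_finite_subalgebra M "info D t" by (rule sigma_finite_info)
  have "AE \<omega> in M. \<forall>i\<in>UNIV. real_cond_exp M (info D t) (\<lambda>\<omega>. mix u x y t \<omega> $ i) \<omega>
      = (1 - u) * real_cond_exp M (info D t) (\<lambda>\<omega>. x t \<omega> $ i) \<omega> + u * real_cond_exp M (info D t) (\<lambda>\<omega>. y t \<omega> $ i) \<omega>"
  proof (intro AE_finite_allI)
    fix i
    note xi = program_component_integrable[OF x, of t i] and yi = program_component_integrable[OF y, of t i]
    have "AE \<omega> in M. real_cond_exp M (info D t) (\<lambda>\<omega>. (1 - u) * x t \<omega> $ i + u * y t \<omega> $ i) \<omega>
      = real_cond_exp M (info D t) (\<lambda>\<omega>. (1 - u) * x t \<omega> $ i) \<omega> + real_cond_exp M (info D t) (\<lambda>\<omega>. u * y t \<omega> $ i) \<omega>"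
      by (rule real_cond_exp_add) (use xi yi in auto)
    then show "AE \<omega> in M. real_cond_exp M (info D t) (\<lambda>\<omega>. mix u x y t \<omega> $ i) \<omega>
      = (1 - u) * real_cond_exp M (info D t) (\<lambda>\<omega>. x t \<omega> $ i) \<omega> + u * real_cond_exp M (info D t) (\<lambda>\<omega>. y t \<omega> $ i) \<omega>"
      using real_cond_exp_cmult[OF xi, of "1 - u"] real_cond_exp_cmult[OF yi, of u]
      by eventually_elim (simp add: mix_def)
  qed auto
  then show ?thesis by eventually_elim (simp add: cproj_def vec_eq_iff)
qed

section \<open>The residual x_t - E_t x_t and its quadratic form\<close>

definition residual :: "('t \<Rightarrow> 'o \<Rightarrow> real^'v) \<Rightarrow> 't \<Rightarrow> 'o \<Rightarrow> real^'v" where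
  "residual x t \<omega> = x t \<omega> - cproj x t \<omega>"

lemma residual_measurable: "x \<in> programs D \<Longrightarrow> residual x t \<in> borel_measurable M"
  unfolding residual_def using programD(1)[of x t] info_measurable[OF cproj_measurable] by (intro borel_measurable_diff)

lemma residual_bounded: "x \<in> programs D \<Longrightarrow> AE \<omega> in M. norm (residual x t \<omega>) \<le> 2 * action_bound"
proof -
  assume x: "x \<in> programs D"
  show ?thesis using program_bounded[OF x, of t] program_bounded[OF cproj_program[OF x], of t]
  proof eventually_elim
    case (elim \<omega>)
    then show ?case using norm_triangle_ineq4[of "x t \<omega>" "cproj x t \<omega>"] by (simp add: residual_def)
  qed
qed

lemma residual_integrable: "x \<in> programs D \<Longrightarrow> integrable M (residual x t)"
  using residual_bounded residual_measurable by (intro integrable_const_bound)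

lemma integrable_inner_bounded:
  fixes f g :: "'o \<Rightarrow> real^'v"
  assumes f: "integrable M f" and g: "g \<in> borel_measurable M" "AE \<omega> in M. norm (g \<omega>) \<le> c"
  shows "integrable M (\<lambda>\<omega>. f \<omega> \<bullet> g \<omega>)"
proof (rule Bochner_Integration.integrable_bound[where f="\<lambda>\<omega>. c * norm (f \<omega>)"])
  show "AE \<omega> in M. norm (f \<omega> \<bullet> g \<omega>) \<le> norm (c * norm (f \<omega>))" using g(2)
  proof eventually_elim
    case (elim \<omega>)
    have "0 \<le> c" using elim norm_ge_zero order_trans by blast
    have "\<bar>f \<omega> \<bullet> g \<omega>\<bar> \<le> norm (f \<omega>) * norm (g \<omega>)" by (rule Cauchy_Schwarz_ineq2)
    also have "\<dots> \<le> norm (f \<omega>) * c" using elim by (intro mult_left_mono) auto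
    finally show ?case using \<open>0 \<le> c\<close> by (simp add: mult.commute)
  qed
  show "(\<lambda>\<omega>. f \<omega> \<bullet> g \<omega>) \<in> borel_measurable M" using f g by (intro borel_measurable_inner) auto
qed (use f in auto)

lemma program_inner_integrable: "integrable M f \<Longrightarrow> x \<in> programs D \<Longrightarrow> integrable M (\<lambda>\<omega>. f \<omega> \<bullet> x t \<omega>)"
  using program_bounded programD(1) by (intro integrable_inner_bounded)

lemma residual_inner_integrable: "integrable M f \<Longrightarrow> x \<in> programs D \<Longrightarrow> integrable M (\<lambda>\<omega>. f \<omega> \<bullet> residual x t \<omega>)"
  using residual_bounded residual_measurable by (intro integrable_inner_bounded)

lemma residual_orthogonal:
  assumes x: "x \<in> programs D" and y: "y \<in> programs D"
  shows "(\<integral>\<omega>. residual x t \<omega> \<bullet> cproj y t \<omega> \<partial>M) = 0"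
proof -
  note cy = program_integrable[OF cproj_program[OF y], of t]
  have "(\<integral>\<omega>. residual x t \<omega> \<bullet> cproj y t \<omega> \<partial>M) = (\<integral>\<omega>. cproj y t \<omega> \<bullet> x t \<omega> - cproj y t \<omega> \<bullet> cproj x t \<omega> \<partial>M)"
    unfolding residual_def inner_diff_left by (simp add: inner_commute)
  also have "\<dots> = 0"
    using cproj_inner[OF x cproj_measurable cy] program_inner_integrable[OF cy x] by simp
  finally show ?thesis .
qed

text \<open>A residual is orthogonal to every E_t y_t, hence pairs equally with \<open>y\<close> and
  with the residual of \<open>y\<close>. The multiplier term can therefore be written as a linear
  functional of the program itself.\<close>

lemma residual_inner_program:
  assumes x: "x \<in> programs D" and y: "y \<in> programs D"
  shows "(\<integral>\<omega>. residual x t \<omega> \<bullet> residual y t \<omega> \<partial>M) = (\<integral>\<omega>. residual x t \<omega> \<bullet> y t \<omega> \<partial>M)"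
proof -
  note rx = residual_integrable[OF x, of t]
  have "(\<integral>\<omega>. residual x t \<omega> \<bullet> residual y t \<omega> \<partial>M) = (\<integral>\<omega>. residual x t \<omega> \<bullet> y t \<omega> - residual x t \<omega> \<bullet> cproj y t \<omega> \<partial>M)"
    unfolding residual_def[of y] by (simp add: inner_diff_right)
  then show ?thesis
    using residual_orthogonal[OF x y, of t] program_inner_integrable[OF rx y] program_inner_integrable[OF rx cproj_program[OF y]]
    by simp
qed

definition residual_form :: "('t \<Rightarrow> 'o \<Rightarrow> real^'v) \<Rightarrow> ('t \<Rightarrow> 'o \<Rightarrow> real^'v) \<Rightarrow> real" where
  "residual_form z x = (\<Sum>t\<in>UNIV. \<integral>\<omega>. residual z t \<omega> \<bullet> residual x t \<omega> \<partial>M)"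

text \<open>The expected squared residual is E|x|^2 minus the expectation of E_t x . x. The first
  term converges by dominated convergence. For the second, the symmetry \<open>sym\<close> turns the
  difference into the expectation of (E_t X + E_t x) . (X - x), which is at most 2 *
  \<open>action_bound\<close> times the L1 distance of the programs, and that distance tends to
  0.\<close>

lemma residual_form_continuous:
  assumes X: "\<And>n. X n \<in> programs D" and x: "x \<in> programs D" and lim: "AE_tendsto X x"
  shows "(\<lambda>n. residual_form (X n) (X n)) \<longlonglongrightarrow> residual_form x x"
  unfolding residual_form_def
proof (rule tendsto_sum)
  fix t
  have L: "AE \<omega> in M. (\<lambda>n. X n t \<omega>) \<longlonglongrightarrow> x t \<omega>" using lim by (simp add: AE_tendsto_def)
  have pi: "integrable M (y t)" if "y \<in> programs D" for y using that by (rule program_integrable)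
  have ci: "integrable M (cproj y t)" if "y \<in> programs D" for y using that by (intro program_integrable cproj_program)
  have Q: "(\<integral>\<omega>. residual y t \<omega> \<bullet> residual y t \<omega> \<partial>M) = (\<integral>\<omega>. y t \<omega> \<bullet> y t \<omega> \<partial>M) - (\<integral>\<omega>. cproj y t \<omega> \<bullet> y t \<omega> \<partial>M)"
    if y: "y \<in> programs D" for y
    unfolding residual_inner_program[OF y y] unfolding residual_def
    using program_inner_integrable[OF pi[OF y] y] program_inner_integrable[OF ci[OF y] y]
    by (simp add: inner_diff_left)
  have sym: "(\<integral>\<omega>. cproj y t \<omega> \<bullet> w t \<omega> \<partial>M) = (\<integral>\<omega>. cproj w t \<omega> \<bullet> y t \<omega> \<partial>M)"
    if y: "y \<in> programs D" and w: "w \<in> programs D" for y w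
    using cproj_inner(2)[OF y cproj_measurable ci[OF w]] cproj_inner(2)[OF w cproj_measurable ci[OF y]]
    by (simp add: inner_commute)
  have 1: "(\<lambda>n. \<integral>\<omega>. X n t \<omega> \<bullet> X n t \<omega> \<partial>M) \<longlonglongrightarrow> (\<integral>\<omega>. x t \<omega> \<bullet> x t \<omega> \<partial>M)"
  proof (rule integral_dominated_convergence[where w="\<lambda>_. action_bound\<^sup>2"])
    show "AE \<omega> in M. (\<lambda>n. X n t \<omega> \<bullet> X n t \<omega>) \<longlonglongrightarrow> x t \<omega> \<bullet> x t \<omega>"
      using L by eventually_elim (intro tendsto_inner)
    show "AE \<omega> in M. norm (X n t \<omega> \<bullet> X n t \<omega>) \<le> action_bound\<^sup>2" for n
      using program_bounded[OF X[of n], of t]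
    proof eventually_elim
      case (elim \<omega>)
      then have "(norm (X n t \<omega>))\<^sup>2 \<le> action_bound\<^sup>2" by (intro power_mono) auto
      then show ?case by (simp add: power2_norm_eq_inner)
    qed
    show "(\<lambda>\<omega>. x t \<omega> \<bullet> x t \<omega>) \<in> borel_measurable M" "(\<lambda>\<omega>. X n t \<omega> \<bullet> X n t \<omega>) \<in> borel_measurable M" for n
      using programD(1)[OF x] programD(1)[OF X] by (auto intro!: borel_measurable_inner)
  qed auto
  have e0: "(\<lambda>n. \<integral>\<omega>. norm (X n t \<omega> - x t \<omega>) \<partial>M) \<longlonglongrightarrow> (\<integral>\<omega>. 0 \<partial>M)"
  proof (rule integral_dominated_convergence[where w="\<lambda>_. 2 * action_bound"])
    show "AE \<omega> in M. (\<lambda>n. norm (X n t \<omega> - x t \<omega>)) \<longlonglongrightarrow> 0"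
      using L by eventually_elim (intro tendsto_norm_zero LIM_zero)
    show "AE \<omega> in M. norm (norm (X n t \<omega> - x t \<omega>)) \<le> 2 * action_bound" for n
      using program_bounded[OF X[of n], of t] program_bounded[OF x, of t]
    proof eventually_elim
      case (elim \<omega>)
      then show ?case using norm_triangle_ineq4[of "X n t \<omega>" "x t \<omega>"] by simp
    qed
    show "(\<lambda>\<omega>. norm (X n t \<omega> - x t \<omega>)) \<in> borel_measurable M" for n
      using programD(1)[OF x, of t] programD(1)[OF X, of n t] by measurable
  qed auto
  have 2: "(\<lambda>n. \<integral>\<omega>. cproj (X n) t \<omega> \<bullet> X n t \<omega> \<partial>M) \<longlonglongrightarrow> (\<integral>\<omega>. cproj x t \<omega> \<bullet> x t \<omega> \<partial>M)"
  proof (rule LIM_zero_cancel)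
    have b: "norm ((\<integral>\<omega>. cproj (X n) t \<omega> \<bullet> X n t \<omega> \<partial>M) - (\<integral>\<omega>. cproj x t \<omega> \<bullet> x t \<omega> \<partial>M))
        \<le> 2 * action_bound * (\<integral>\<omega>. norm (X n t \<omega> - x t \<omega>) \<partial>M)" for n
    proof -
      note i = program_inner_integrable[OF ci[OF X[of n]] X[of n], of t] program_inner_integrable[OF ci[OF X[of n]] x, of t]
        program_inner_integrable[OF ci[OF x] X[of n], of t] program_inner_integrable[OF ci[OF x] x, of t]
      have "(\<integral>\<omega>. cproj (X n) t \<omega> \<bullet> X n t \<omega> \<partial>M) - (\<integral>\<omega>. cproj x t \<omega> \<bullet> x t \<omega> \<partial>M)
        = (\<integral>\<omega>. cproj (X n) t \<omega> \<bullet> X n t \<omega> \<partial>M) - (\<integral>\<omega>. cproj (X n) t \<omega> \<bullet> x t \<omega> \<partial>M)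
          + ((\<integral>\<omega>. cproj x t \<omega> \<bullet> X n t \<omega> \<partial>M) - (\<integral>\<omega>. cproj x t \<omega> \<bullet> x t \<omega> \<partial>M))"
        using sym[OF X[of n] x] by simp
      also have "\<dots> = (\<integral>\<omega>. (cproj (X n) t \<omega> + cproj x t \<omega>) \<bullet> (X n t \<omega> - x t \<omega>) \<partial>M)"
        using i by (simp add: inner_add_left inner_diff_right)
      finally have "norm ((\<integral>\<omega>. cproj (X n) t \<omega> \<bullet> X n t \<omega> \<partial>M) - (\<integral>\<omega>. cproj x t \<omega> \<bullet> x t \<omega> \<partial>M))
        \<le> (\<integral>\<omega>. norm ((cproj (X n) t \<omega> + cproj x t \<omega>) \<bullet> (X n t \<omega> - x t \<omega>)) \<partial>M)"
        by (simp only: integral_norm_bound)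
      also have "\<dots> \<le> (\<integral>\<omega>. 2 * action_bound * norm (X n t \<omega> - x t \<omega>) \<partial>M)"
      proof (rule integral_mono_AE)
        show "integrable M (\<lambda>\<omega>. norm ((cproj (X n) t \<omega> + cproj x t \<omega>) \<bullet> (X n t \<omega> - x t \<omega>)))"
          using i by (simp add: inner_add_left inner_diff_right)
        show "AE \<omega> in M. norm ((cproj (X n) t \<omega> + cproj x t \<omega>) \<bullet> (X n t \<omega> - x t \<omega>)) \<le> 2 * action_bound * norm (X n t \<omega> - x t \<omega>)"
          using program_bounded[OF cproj_program[OF X[of n]], of t] program_bounded[OF cproj_program[OF x], of t]
        proof eventually_elim
          case (elim \<omega>)
          have "norm (cproj (X n) t \<omega> + cproj x t \<omega>) \<le> 2 * action_bound"
            using elim norm_triangle_ineq[of "cproj (X n) t \<omega>" "cproj x t \<omega>"] by simp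
          then have "norm (cproj (X n) t \<omega> + cproj x t \<omega>) * norm (X n t \<omega> - x t \<omega>) \<le> 2 * action_bound * norm (X n t \<omega> - x t \<omega>)"
            by (intro mult_right_mono) auto
          then show ?case unfolding real_norm_def using Cauchy_Schwarz_ineq2 order_trans by blast
        qed
      qed (use pi X x in auto)
      finally show ?thesis by simp
    qed
    have "(\<lambda>n. 2 * action_bound * (\<integral>\<omega>. norm (X n t \<omega> - x t \<omega>) \<partial>M)) \<longlonglongrightarrow> 0"
      using tendsto_mult_left[OF e0, of "2 * action_bound"] by simp
    then show "(\<lambda>n. (\<integral>\<omega>. cproj (X n) t \<omega> \<bullet> X n t \<omega> \<partial>M) - (\<integral>\<omega>. cproj x t \<omega> \<bullet> x t \<omega> \<partial>M)) \<longlonglongrightarrow> 0"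
      by (rule Lim_null_comparison[OF always_eventually[OF allI[OF b]]])
  qed
  show "(\<lambda>n. \<integral>\<omega>. residual (X n) t \<omega> \<bullet> residual (X n) t \<omega> \<partial>M) \<longlonglongrightarrow> (\<integral>\<omega>. residual x t \<omega> \<bullet> residual x t \<omega> \<partial>M)"
    unfolding Q[OF x] Q[OF X] using 1 2 by (rule tendsto_diff)
qed

lemma admissible_all_programs: "admissible (\<lambda>_. M) (programs D)"
  unfolding admissible_def programs_eq_progs[symmetric]
  using slater(1) adapted_program programs_mix by (auto simp: subalgebra_def)

lemma residual_mix:
  assumes x: "x \<in> programs D" and y: "y \<in> programs D"
  shows "AE \<omega> in M. residual (mix u x y) t \<omega> = (1 - u) *\<^sub>R residual x t \<omega> + u *\<^sub>R residual y t \<omega>"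
  using cproj_mix[OF x y, of u t]
  by eventually_elim (simp add: residual_def mix_def scaleR_diff_right)

text \<open>The penalty is the sum of the E|x_t - E_t x_t|^2. If it vanishes, \<open>x\<close>
  agrees almost surely with the adapted program \<open>cproj x\<close>, and \<open>J\<close> takes
  the same value at both. The minus sign of the penalty term is absorbed into
  \<open>N\<close>.\<close>

lemma approximate_information_multiplier:
  assumes J: "concave_continuous J"
    and V: "\<And>x. x \<in> adapted D \<Longrightarrow> J x \<le> V" and e: "e > 0"
  shows "\<exists>z\<in>programs D. \<exists>N. \<forall>x\<in>programs D. J x + (\<Sum>t\<in>UNIV. \<integral>\<omega>. (N *\<^sub>R residual z t \<omega>) \<bullet> x t \<omega> \<partial>M) \<le> V + e"
proof -
  have rri: "integrable M (\<lambda>\<omega>. residual y t \<omega> \<bullet> residual w t \<omega>)" if "y \<in> programs D" "w \<in> programs D" for y w t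
    using that by (intro residual_inner_integrable residual_integrable)
  have "\<exists>z\<in>programs D. \<exists>N\<ge>0. \<forall>x\<in>programs D. J x - N * residual_form z x \<le> V + e"
  proof (rule approximate_multiplier[OF admissible_all_programs J,
        where Q="\<lambda>x. residual_form x x" and c="real CARD('t) * (2 * (2 * action_bound))\<^sup>2"])
    fix x assume x: "x \<in> programs D"
    show "0 \<le> residual_form x x" unfolding residual_form_def by (intro sum_nonneg integral_nonneg_AE) auto
    show "J x \<le> V" if "residual_form x x = 0"
    proof -
      have "(\<integral>\<omega>. residual x t \<omega> \<bullet> residual x t \<omega> \<partial>M) = 0" for t
        using that unfolding residual_form_def
        by (subst (asm) sum_nonneg_eq_0_iff) (auto intro!: integral_nonneg_AE)
      then have "AE \<omega> in M. residual x t \<omega> \<bullet> residual x t \<omega> = 0" for t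
        using integral_nonneg_eq_0_iff_AE[OF rri[OF x x]] by auto
      then have "AE \<omega> in M. x t \<omega> = cproj x t \<omega>" for t
        by (rule eventually_mono) (simp add: residual_def)
      then have "J x = J (cproj x)"
        using J x cproj_program[OF x] by (intro concave_continuous_cong_AE)
      then show ?thesis using V[OF cproj_adapted[OF x]] by simp
    qed
    fix z assume z: "z \<in> programs D"
    have half: "0 \<le> (1/2 :: real)" "(1/2 :: real) \<le> 1" by auto
    have mp: "mix (1/2) x z \<in> programs D" by (intro programs_mix x z half)
    have "residual_form (mix (1/2) x z) (mix (1/2) x z)
        \<le> (\<Sum>t\<in>UNIV. \<integral>\<omega>. (residual x t \<omega> \<bullet> residual x t \<omega> + residual z t \<omega> \<bullet> residual z t \<omega>) / 2 \<partial>M)"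
      unfolding residual_form_def
    proof (intro sum_mono integral_mono_AE)
      fix t
      show "AE \<omega> in M. residual (mix (1/2) x z) t \<omega> \<bullet> residual (mix (1/2) x z) t \<omega>
          \<le> (residual x t \<omega> \<bullet> residual x t \<omega> + residual z t \<omega> \<bullet> residual z t \<omega>) / 2"
        using residual_mix[OF x z, of "1/2" t]
      proof eventually_elim
        case (elim \<omega>)
        show ?case unfolding elim using inner_ge_zero[of "residual x t \<omega> - residual z t \<omega>"]
          by (simp add: inner_add_left inner_add_right inner_diff_left inner_diff_right inner_commute field_simps)
      qed
    qed (use rri x z mp in auto)
    also have "\<dots> = (residual_form x x + residual_form z z) / 2"
      unfolding residual_form_def using rri x z by (simp add: sum.distrib flip: sum_divide_distrib)
    finally show "residual_form (mix (1/2) x z) (mix (1/2) x z) \<le> (residual_form x x + residual_form z z) / 2" .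
    fix u :: real assume u: "0 \<le> u" "u \<le> 1"
    have mp: "mix u z x \<in> programs D" by (intro programs_mix x z u)
    have "residual_form (mix u z x) (mix u z x) \<le> (\<Sum>t\<in>UNIV. \<integral>\<omega>. (1 - 2 * u) * (residual z t \<omega> \<bullet> residual z t \<omega>)
        + 2 * u * (residual z t \<omega> \<bullet> residual x t \<omega>) + u\<^sup>2 * (2 * (2 * action_bound))\<^sup>2 \<partial>M)"
      unfolding residual_form_def
    proof (intro sum_mono integral_mono_AE)
      fix t
      show "AE \<omega> in M. residual (mix u z x) t \<omega> \<bullet> residual (mix u z x) t \<omega> \<le> (1 - 2 * u) * (residual z t \<omega> \<bullet> residual z t \<omega>)
        + 2 * u * (residual z t \<omega> \<bullet> residual x t \<omega>) + u\<^sup>2 * (2 * (2 * action_bound))\<^sup>2"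
        using residual_mix[OF z x, of u t] residual_bounded[OF x, of t] residual_bounded[OF z, of t]
      proof eventually_elim
        case (elim \<omega>)
        show ?case unfolding elim(1) using elim(3,2) by (rule norm_mix_power2)
      qed
    qed (use rri x z mp in auto)
    also have "\<dots> = (1 - 2 * u) * residual_form z z + 2 * u * residual_form z x + u\<^sup>2 * (real CARD('t) * (2 * (2 * action_bound))\<^sup>2)"
      unfolding residual_form_def using rri x z
      by (simp add: sum.distrib sum_distrib_left prob_space)
    finally show "residual_form (mix u z x) (mix u z x)
      \<le> (1 - 2 * u) * residual_form z z + 2 * u * residual_form z x + u\<^sup>2 * (real CARD('t) * (2 * (2 * action_bound))\<^sup>2)" .
  qed (use residual_form_continuous e in auto)
  then obtain z N where z: "z \<in> programs D" and le: "\<And>x. x \<in> programs D \<Longrightarrow> J x - N * residual_form z x \<le> V + e" by blast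
  have "J x + (\<Sum>t\<in>UNIV. \<integral>\<omega>. ((- N) *\<^sub>R residual z t \<omega>) \<bullet> x t \<omega> \<partial>M) \<le> V + e" if x: "x \<in> programs D" for x
    using le[OF x] unfolding residual_form_def by (simp add: residual_inner_program[OF z x] sum_negf sum_distrib_left)
  then show ?thesis using z by blast
qed

end

section \<open>Multipliers for the information constraint\<close>

context team_problem
begin

text \<open>Otherwise programs within 1/(n + 1) of \<open>x\<close> would converge to
  \<open>x\<close> while their payoff stays at most \<open>J x - 1\<close>. The bound has to be
  uniform over all close programs, since it is later applied to a perturbation whose direction
  depends on the multiplier.\<close>

lemma payoff_lower_bound_near:
  assumes J: "concave_continuous J" and x: "x \<in> programs D"
  shows "\<exists>\<delta>>0. \<forall>y\<in>programs D. (\<forall>t. \<forall>\<omega>\<in>space M. norm (y t \<omega> - x t \<omega>) \<le> \<delta>) \<longrightarrow> J x - 1 \<le> J y"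
proof (rule ccontr)
  assume "\<not> ?thesis"
  then have "\<exists>y. y \<in> programs D \<and> (\<forall>t. \<forall>\<omega>\<in>space M. norm (y t \<omega> - x t \<omega>) \<le> \<delta>) \<and> J y \<le> J x - 1" if "\<delta> > 0" for \<delta>
    using that by (meson less_imp_le not_le)
  then have "\<forall>n. \<exists>y. y \<in> programs D \<and> (\<forall>t. \<forall>\<omega>\<in>space M. norm (y t \<omega> - x t \<omega>) \<le> 1 / real (Suc n)) \<and> J y \<le> J x - 1"
    by simp
  from choice[OF this] obtain Y where Y: "\<And>n. Y n \<in> programs D"
    "\<And>n t \<omega>. \<omega> \<in> space M \<Longrightarrow> norm (Y n t \<omega> - x t \<omega>) \<le> 1 / real (Suc n)" "\<And>n. J (Y n) \<le> J x - 1"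
    by blast
  have "AE_tendsto Y x" unfolding AE_tendsto_def
  proof (intro allI AE_I2)
    fix t \<omega> assume w: "\<omega> \<in> space M"
    have "(\<lambda>n. Y n t \<omega> - x t \<omega>) \<longlonglongrightarrow> 0"
      by (rule Lim_null_comparison[OF _ LIMSEQ_inverse_Suc]) (use Y(2)[OF w] in auto)
    then show "(\<lambda>n. Y n t \<omega>) \<longlonglongrightarrow> x t \<omega>" by (rule LIM_zero_cancel)
  qed
  then have "(\<lambda>n. J (Y n)) \<longlonglongrightarrow> J x" using concave_continuousD(2)[OF J x Y(1)] by simp
  then have "J x \<le> J x - 1" using Y(3) by (intro LIMSEQ_le_const2) auto
  then show False by simp
qed

text \<open>\<open>f\<close> carries the candidates for all \<open>q_t\<close> as one vector, so
  that a single selection makes them converge together.\<close>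

definition pairing :: "('o \<Rightarrow> ('t, 'v) profile) \<Rightarrow> ('t \<Rightarrow> 'o \<Rightarrow> real^'v) \<Rightarrow> real" where
  "pairing f x = (\<Sum>t\<in>UNIV. \<integral>\<omega>. f \<omega> $ t \<bullet> x t \<omega> \<partial>M)"

text \<open>From the interior program \<open>x\<close> of (D) one moves by \<open>\<delta>\<close>
  in the direction sgn f_t. As \<open>f\<close> annihilates conditional expectations and
  \<open>x\<close> is adapted, the pairing becomes \<open>\<delta>\<close> times the sum of the L1
  norms of the f_t, while \<open>J\<close> drops by at most 1. Hence (V + 2 - J x) / \<delta> is a
  bound that is common to all such \<open>f\<close>.\<close>

lemma information_multiplier_L1_bound:
  assumes J: "concave_continuous J"
  shows "\<exists>B. \<forall>f. integrable M f \<longrightarrow> (\<forall>\<omega>\<in>space M. \<forall>t. f \<omega> $ t \<in> Vsp D t) \<longrightarrow>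
    (\<forall>t. \<forall>x\<in>programs D. (\<integral>\<omega>. f \<omega> $ t \<bullet> cproj x t \<omega> \<partial>M) = 0) \<longrightarrow>
    (\<forall>x\<in>programs D. J x + pairing f x \<le> V + 1) \<longrightarrow> (\<integral>\<omega>. norm (f \<omega>) \<partial>M) \<le> B"
proof -
  obtain x \<theta> where x: "interior_program x \<theta>" using interior_program_exists by blast
  then have xa: "x \<in> adapted D" and \<theta>: "\<theta> > 0"
    and ball: "\<And>t \<omega>. \<omega> \<in> space M \<Longrightarrow> ball (x t \<omega>) \<theta> \<inter> Vsp D t \<subseteq> actions D t \<omega>"
    by (auto simp: interior_program_def)
  note xp = adapted_program[OF xa]
  obtain \<delta>0 where \<delta>0: "\<delta>0 > 0"
    "\<And>y. y \<in> programs D \<Longrightarrow> (\<And>t \<omega>. \<omega> \<in> space M \<Longrightarrow> norm (y t \<omega> - x t \<omega>) \<le> \<delta>0) \<Longrightarrow> J x - 1 \<le> J y"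
    using payoff_lower_bound_near[OF J xp] by blast
  \<comment> \<open>Half of \<open>\<theta>\<close> keeps the perturbed action strictly inside the
    open ball of (D).\<close>
  define \<delta> where "\<delta> = min \<delta>0 (\<theta> / 2)"
  have \<delta>: "\<delta> > 0" "\<delta> \<le> \<delta>0" "\<delta> < \<theta>" using \<delta>0(1) \<theta> by (auto simp: \<delta>_def)
  have "(\<integral>\<omega>. norm (f \<omega>) \<partial>M) \<le> (V + 2 - J x) / \<delta>"
    if fi: "integrable M f" and fV: "\<And>\<omega> t. \<omega> \<in> space M \<Longrightarrow> f \<omega> $ t \<in> Vsp D t"
      and orth: "\<And>t x. x \<in> programs D \<Longrightarrow> (\<integral>\<omega>. f \<omega> $ t \<bullet> cproj x t \<omega> \<partial>M) = 0"
      and le: "\<And>x. x \<in> programs D \<Longrightarrow> J x + pairing f x \<le> V + 1" for f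
  proof -
    define y where "y t \<omega> = x t \<omega> + \<delta> *\<^sub>R sgn (f \<omega> $ t)" for t \<omega>
    note fti = integrable_nth[OF fi]
    have ns: "norm (\<delta> *\<^sub>R sgn (v :: real^'v)) \<le> \<delta>" for v using \<delta>(1) by (simp add: norm_sgn)
    have yp: "y \<in> programs D" unfolding programs_def
    proof (intro CollectI allI conjI ballI AE_I2)
      fix t
      have "(\<lambda>\<omega>. f \<omega> $ t) \<in> borel_measurable M" using fti by (rule borel_measurable_integrable)
      then have "(\<lambda>\<omega>. sgn (f \<omega> $ t)) \<in> borel_measurable M" unfolding sgn_div_norm by measurable
      then show "y t \<in> borel_measurable M" unfolding y_def
        using programD(1)[OF xp, of t] by (intro borel_measurable_add borel_measurable_scaleR) auto
      fix \<omega> assume w: "\<omega> \<in> space M"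
      show V: "y t \<omega> \<in> Vsp D t" unfolding y_def sgn_div_norm
        by (intro subspace_add subspace_scale subspace_Vsp programD(2)[OF xp w] fV[OF w])
      have "y t \<omega> \<in> ball (x t \<omega>) \<theta>" using ns[of "f \<omega> $ t"] \<delta>(3) by (simp add: y_def dist_norm)
      then show "y t \<omega> \<in> actions D t \<omega>" using V ball[OF w] by blast
    qed
    have "J x - 1 \<le> J y"
      by (rule \<delta>0(2)[OF yp]) (use ns \<delta>(2) in \<open>auto simp: y_def intro: order_trans\<close>)
    have sg: "v \<bullet> sgn v = norm v" for v :: "real^'v"
      by (cases "v = 0") (auto simp: sgn_div_norm dot_square_norm power2_eq_square)
    have "(\<integral>\<omega>. f \<omega> $ t \<bullet> y t \<omega> \<partial>M) = \<delta> * (\<integral>\<omega>. norm (f \<omega> $ t) \<partial>M)" for t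
    proof -
      have "(\<integral>\<omega>. f \<omega> $ t \<bullet> y t \<omega> \<partial>M) = (\<integral>\<omega>. f \<omega> $ t \<bullet> x t \<omega> + \<delta> * norm (f \<omega> $ t) \<partial>M)"
        by (simp add: y_def inner_add_right sg)
      also have "\<dots> = (\<integral>\<omega>. f \<omega> $ t \<bullet> x t \<omega> \<partial>M) + \<delta> * (\<integral>\<omega>. norm (f \<omega> $ t) \<partial>M)"
        using program_inner_integrable[OF fti xp] fti by simp
      also have "(\<integral>\<omega>. f \<omega> $ t \<bullet> x t \<omega> \<partial>M) = (\<integral>\<omega>. f \<omega> $ t \<bullet> cproj x t \<omega> \<partial>M)"
      proof (rule integral_cong_AE)
        show "AE \<omega> in M. f \<omega> $ t \<bullet> x t \<omega> = f \<omega> $ t \<bullet> cproj x t \<omega>"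
          using cproj_of_adapted[OF xa, of t] by eventually_elim simp
      qed (use program_inner_integrable[OF fti xp] program_inner_integrable[OF fti cproj_program[OF xp]] in auto)
      finally show ?thesis using orth[OF xp] by simp
    qed
    then have "pairing f y = \<delta> * (\<Sum>t\<in>UNIV. \<integral>\<omega>. norm (f \<omega> $ t) \<partial>M)"
      by (simp add: pairing_def sum_distrib_left)
    then have le_S: "\<delta> * (\<Sum>t\<in>UNIV. \<integral>\<omega>. norm (f \<omega> $ t) \<partial>M) \<le> V + 2 - J x"
      using le[OF yp] \<open>J x - 1 \<le> J y\<close> by linarith
    have "(\<integral>\<omega>. norm (f \<omega>) \<partial>M) \<le> (\<integral>\<omega>. (\<Sum>t\<in>UNIV. norm (f \<omega> $ t)) \<partial>M)"
      using fi fti norm_vec_le_sum by (intro integral_mono Bochner_Integration.integrable_sum integrable_norm)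
    also have "\<dots> = (\<Sum>t\<in>UNIV. \<integral>\<omega>. norm (f \<omega> $ t) \<partial>M)" using fti by simp
    finally have "\<delta> * (\<integral>\<omega>. norm (f \<omega>) \<partial>M) \<le> \<delta> * (\<Sum>t\<in>UNIV. \<integral>\<omega>. norm (f \<omega> $ t) \<partial>M)"
      using \<delta>(1) by (intro mult_left_mono) auto
    then have "\<delta> * (\<integral>\<omega>. norm (f \<omega>) \<partial>M) \<le> V + 2 - J x" using le_S by (rule order_trans)
    then show ?thesis using \<delta>(1) by (simp add: pos_le_divide_eq mult.commute)
  qed
  then show ?thesis by (intro exI[of _ "(V + 2 - J x) / \<delta>"] allI impI) simp
qed

text \<open>
  The integrable limit of the approximate multipliers need not annihilate adapted programs: mass
  may escape to small sets.  Replacing a program there by its conditional expectation removes this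
  mass, because \<open>x\<^sub>t - E\<^sub>t x\<^sub>t\<close> is then cut off on these sets.
\<close>

lemma information_multiplier:
  assumes J: "concave_continuous J" and V: "\<And>x. x \<in> adapted D \<Longrightarrow> J x \<le> V"
  shows "\<exists>q. (\<forall>t. integrable M (q t) \<and> (\<forall>\<omega>\<in>space M. q t \<omega> \<in> Vsp D t)) \<and>
    (\<forall>x\<in>programs D. J x + (\<Sum>t\<in>UNIV. \<integral>\<omega>. q t \<omega> \<bullet> residual x t \<omega> \<partial>M) \<le> V)"
proof -
  \<comment> \<open>Orthogonality to all conditional expectations is recorded here because the
    approximate multipliers, being multiples of residuals, have it. Both the L1 bound and the
    formula \<open>pz\<close> depend on it.\<close>
  define C where "C n = {f. integrable M f \<and> (\<forall>\<omega>\<in>space M. \<forall>t. f \<omega> $ t \<in> Vsp D t) \<and>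
    (\<forall>t. \<forall>x\<in>programs D. (\<integral>\<omega>. f \<omega> $ t \<bullet> cproj x t \<omega> \<partial>M) = 0) \<and>
    (\<forall>x\<in>programs D. J x + pairing f x \<le> V + 1 / real (Suc n))}" for n
  from information_multiplier_L1_bound[OF J, of V]
  obtain B where B0: "\<forall>f. integrable M f \<longrightarrow> (\<forall>\<omega>\<in>space M. \<forall>t. f \<omega> $ t \<in> Vsp D t) \<longrightarrow>
    (\<forall>t. \<forall>x\<in>programs D. (\<integral>\<omega>. f \<omega> $ t \<bullet> cproj x t \<omega> \<partial>M) = 0) \<longrightarrow>
    (\<forall>x\<in>programs D. J x + pairing f x \<le> V + 1) \<longrightarrow> (\<integral>\<omega>. norm (f \<omega>) \<partial>M) \<le> B"
    by (elim exE)
  have arith: "m = (a + b) / 2 \<Longrightarrow> j + a \<le> c \<Longrightarrow> j + b \<le> c \<Longrightarrow> j + m \<le> c" for m a b j c :: real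
    by auto
  have "\<exists>f h. (\<forall>n. f n \<in> C n) \<and> integrable M h \<and> (AE \<omega> in M. (\<lambda>n. f n \<omega>) \<longlonglongrightarrow> h \<omega>)"
  proof (rule AE_convergent_selection)
    show "decseq C" unfolding decseq_def
    proof (intro allI impI subsetI)
      fix m n :: nat and f assume "m \<le> n" and f: "f \<in> C n"
      then have "1 / real (Suc n) \<le> 1 / real (Suc m)" by (intro divide_left_mono) auto
      then show "f \<in> C m" using f unfolding C_def by (auto intro: order_trans)
    qed
    show "C n \<noteq> {}" for n
    proof -
      obtain z N where z: "z \<in> programs D"
        and le: "\<And>x. x \<in> programs D \<Longrightarrow> J x + (\<Sum>t\<in>UNIV. \<integral>\<omega>. (N *\<^sub>R residual z t \<omega>) \<bullet> x t \<omega> \<partial>M) \<le> V + 1 / real (Suc n)"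
        using approximate_information_multiplier[OF J V, of "1 / real (Suc n)"] by auto
      define f where "f \<omega> = (\<chi> t. N *\<^sub>R residual z t \<omega>)" for \<omega>
      have "f \<in> C n" unfolding C_def
      proof (intro CollectI conjI allI ballI)
        show "integrable M f" unfolding f_def
          using residual_integrable[OF z] by (intro integrable_vec_lambda) auto
        show "f \<omega> $ t \<in> Vsp D t" if "\<omega> \<in> space M" for \<omega> t
          unfolding f_def residual_def using programD(2)[OF z that] cproj_Vsp
          by (auto intro!: subspace_scale subspace_diff subspace_Vsp)
        show "(\<integral>\<omega>. f \<omega> $ t \<bullet> cproj x t \<omega> \<partial>M) = 0" if "x \<in> programs D" for x t
          using residual_orthogonal[OF z that] by (simp add: f_def)
        show "J x + pairing f x \<le> V + 1 / real (Suc n)" if "x \<in> programs D" for x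
          using le[OF that] by (simp add: pairing_def f_def)
      qed
      then show ?thesis by blast
    qed
    show "integrable M f" if "f \<in> C n" for n f using that by (simp add: C_def)
    show "(\<integral>\<omega>. norm (f \<omega>) \<partial>M) \<le> B" if f: "f \<in> C n" for n f
    proof (rule B0[rule_format])
      fix x assume "x \<in> programs D"
      then have "J x + pairing f x \<le> V + 1 / real (Suc n)" using f by (auto simp: C_def)
      moreover have "1 / real (Suc n) \<le> 1" by simp
      ultimately show "J x + pairing f x \<le> V + 1" by linarith
    qed (use f in \<open>auto simp: C_def\<close>)
    show "(\<lambda>\<omega>. (1/2) *\<^sub>R (f \<omega> + g \<omega>)) \<in> C n" if f: "f \<in> C n" and g: "g \<in> C n" for n f g
    proof -
      have fg: "integrable M f" "integrable M g" using f g by (auto simp: C_def)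
      have avg: "(\<integral>\<omega>. ((1/2) *\<^sub>R (f \<omega> + g \<omega>)) $ t \<bullet> x t \<omega> \<partial>M)
          = ((\<integral>\<omega>. f \<omega> $ t \<bullet> x t \<omega> \<partial>M) + (\<integral>\<omega>. g \<omega> $ t \<bullet> x t \<omega> \<partial>M)) / 2"
        if "x \<in> programs D" for x t
        using program_inner_integrable[OF integrable_nth[OF fg(1)] that]
          program_inner_integrable[OF integrable_nth[OF fg(2)] that]
        by (simp add: inner_add_left)
      show ?thesis unfolding C_def
      proof (intro CollectI conjI allI ballI)
        show "integrable M (\<lambda>\<omega>. (1/2) *\<^sub>R (f \<omega> + g \<omega>))" using fg by auto
        show "((1/2) *\<^sub>R (f \<omega> + g \<omega>)) $ t \<in> Vsp D t" if "\<omega> \<in> space M" for \<omega> t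
          using f g that by (auto simp: C_def intro!: subspace_scale subspace_add subspace_Vsp)
        show "(\<integral>\<omega>. ((1/2) *\<^sub>R (f \<omega> + g \<omega>)) $ t \<bullet> cproj x t \<omega> \<partial>M) = 0" if "x \<in> programs D" for x t
          unfolding avg[OF cproj_program[OF that]] using f g that by (simp add: C_def)
        fix x assume x: "x \<in> programs D"
        have "pairing (\<lambda>\<omega>. (1/2) *\<^sub>R (f \<omega> + g \<omega>)) x = (pairing f x + pairing g x) / 2"
          unfolding pairing_def avg[OF x] by (simp add: sum.distrib flip: sum_divide_distrib)
        moreover have "J x + pairing f x \<le> V + 1 / real (Suc n)" "J x + pairing g x \<le> V + 1 / real (Suc n)"
          using f g x by (auto simp: C_def)
        ultimately show "J x + pairing (\<lambda>\<omega>. (1/2) *\<^sub>R (f \<omega> + g \<omega>)) x \<le> V + 1 / real (Suc n)"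
          by (rule arith)
      qed
    qed
  qed
  then obtain f h where f: "\<And>n. f n \<in> C n" and hi: "integrable M h"
    and lim: "AE \<omega> in M. (\<lambda>n. f n \<omega>) \<longlonglongrightarrow> h \<omega>" by blast
  have fi: "integrable M (f n)" and fV: "\<omega> \<in> space M \<Longrightarrow> f n \<omega> \<in> {v. \<forall>t. v $ t \<in> Vsp D t}"
    and orth: "x \<in> programs D \<Longrightarrow> (\<integral>\<omega>. f n \<omega> $ t \<bullet> cproj x t \<omega> \<partial>M) = 0"
    and fle: "x \<in> programs D \<Longrightarrow> J x + pairing (f n) x \<le> V + 1 / real (Suc n)" for n \<omega> t x
    using f[of n] by (auto simp: C_def)
  have fM: "f n \<in> borel_measurable M" for n using fi by (rule borel_measurable_integrable)
  have cl: "closed {v :: ('t, 'v) profile. \<forall>t. v $ t \<in> Vsp D t}"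
  proof -
    have "closed ((\<lambda>v :: ('t, 'v) profile. v $ t) -` Vsp D t)" for t
      by (intro closed_vimage closed_Vsp continuous_intros)
    moreover have "{v :: ('t, 'v) profile. \<forall>t. v $ t \<in> Vsp D t} = (\<Inter>t. (\<lambda>v. v $ t) -` Vsp D t)" by auto
    ultimately show ?thesis by auto
  qed
  have zero: "0 \<in> {v :: ('t, 'v) profile. \<forall>t. v $ t \<in> Vsp D t}" by (simp add: subspace_0 subspace_Vsp)
  have "\<exists>q. q \<in> borel_measurable M \<and> (\<forall>\<omega>\<in>space M. q \<omega> \<in> {v. \<forall>t. v $ t \<in> Vsp D t}) \<and> (AE \<omega> in M. q \<omega> = h \<omega>)"
    by (rule measurable_limit_in_closed[OF fM lim cl zero]) (rule fV)
  then
  obtain q where q1: "q \<in> borel_measurable M"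
    and qS: "\<forall>\<omega>\<in>space M. q \<omega> \<in> {v. \<forall>t. v $ t \<in> Vsp D t}"
    and qh: "AE \<omega> in M. q \<omega> = h \<omega>" by (elim exE conjE)
  have q: "q \<in> borel_measurable M" "\<omega> \<in> space M \<Longrightarrow> q \<omega> $ t \<in> Vsp D t" for \<omega> t
    using q1 qS by auto
  have qi: "integrable M q"
    by (rule integrable_cong_AE_imp[OF hi q(1)]) (rule eventually_mono[OF qh], simp)
  have "J x + (\<Sum>t\<in>UNIV. \<integral>\<omega>. q \<omega> $ t \<bullet> residual x t \<omega> \<partial>M) \<le> V" if x: "x \<in> programs D" for x
  proof -
    define w where "w \<omega> = (\<chi> t. residual x t \<omega>)" for \<omega>
    have wm: "w \<in> borel_measurable M" unfolding w_def using residual_measurable[OF x] by (rule vec_lambda_measurable)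
    have wle: "AE \<omega> in M. norm (w \<omega>) \<le> real CARD('t) * (2 * action_bound)"
    proof -
      have "AE \<omega> in M. \<forall>t\<in>UNIV. norm (residual x t \<omega>) \<le> 2 * action_bound"
        using residual_bounded[OF x] by (intro AE_finite_allI) auto
      then show ?thesis
      proof eventually_elim
        case (elim \<omega>)
        have "norm (w \<omega>) \<le> (\<Sum>t\<in>UNIV. norm (residual x t \<omega>))"
          using norm_vec_le_sum[of "w \<omega>"] by (simp add: w_def)
        also have "\<dots> \<le> (\<Sum>t\<in>(UNIV::'t set). 2 * action_bound)" using elim by (intro sum_mono) auto
        finally show ?case by simp
      qed
    qed
    define T where "T k = exceed M f k" for k
    have Tm: "T k \<in> sets M" for k unfolding T_def by (intro exceed_sets fM) simp
    have Ts: "T k \<inter> space M = T k" for k by (auto simp: T_def exceed_def)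
    \<comment> \<open>\<open>z k\<close> competes among all programs, so \<open>T k\<close> has to
      be an event of \<open>M\<close> only, and one set can serve all \<open>t\<close>
      simultaneously.\<close>
    define z where "z k t \<omega> = (if \<omega> \<in> T k then cproj x t \<omega> else x t \<omega>)" for k t \<omega>
    note cx = cproj_program[OF x]
    have zp: "z k \<in> programs D" for k unfolding programs_def
    proof (intro CollectI allI conjI ballI)
      fix t
      show "z k t \<in> borel_measurable M" unfolding z_def
        using Tm programD(1)[OF x] programD(1)[OF cx] by (intro measurable_If_set) (auto simp: Ts)
      show "z k t \<omega> \<in> Vsp D t" if "\<omega> \<in> space M" for \<omega>
        using programD(2)[OF x that] cproj_Vsp by (simp add: z_def)
      show "AE \<omega> in M. z k t \<omega> \<in> actions D t \<omega>"
        using programD(3)[OF x, of t] programD(3)[OF cx, of t] by eventually_elim (simp add: z_def)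
    qed
    \<comment> \<open>Subtracting E_t x_t does not change the pairing, since \<open>f n\<close> is
      orthogonal to it. The difference of \<open>z k\<close> and E_t x_t is 0 on \<open>T k\<close>
      and the residual of \<open>x\<close> elsewhere.\<close>
    have pz: "pairing (f n) (z k) = (\<integral>\<omega>. (if \<omega> \<in> T k then 0 else f n \<omega> \<bullet> w \<omega>) \<partial>M)" for n k
    proof -
      have i: "integrable M (\<lambda>\<omega>. f n \<omega> $ t \<bullet> (z k t \<omega> - cproj x t \<omega>))" for t
        unfolding inner_diff_right
        by (intro Bochner_Integration.integrable_diff program_inner_integrable integrable_nth fi zp cx)
      have "(\<integral>\<omega>. f n \<omega> $ t \<bullet> z k t \<omega> \<partial>M) = (\<integral>\<omega>. f n \<omega> $ t \<bullet> (z k t \<omega> - cproj x t \<omega>) \<partial>M)" for t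
        using orth[OF x, of n t] program_inner_integrable[OF integrable_nth[OF fi] zp, of n t k t]
          program_inner_integrable[OF integrable_nth[OF fi] cx, of n t t]
        by (simp add: inner_diff_right)
      then have "pairing (f n) (z k) = (\<integral>\<omega>. (\<Sum>t\<in>UNIV. f n \<omega> $ t \<bullet> (z k t \<omega> - cproj x t \<omega>)) \<partial>M)"
        unfolding pairing_def using i by simp
      also have "\<dots> = (\<integral>\<omega>. (if \<omega> \<in> T k then 0 else f n \<omega> \<bullet> w \<omega>) \<partial>M)"
        by (intro Bochner_Integration.integral_cong) (auto simp: z_def w_def inner_vec_def[of "f n _"] residual_def)
      finally show ?thesis .
    qed
    note tl = truncated_inner_limits[OF fM hi lim wm wle, folded T_def]
    have le2: "J (z k) + (\<integral>\<omega>. (if \<omega> \<in> T k then 0 else h \<omega> \<bullet> w \<omega>) \<partial>M) \<le> V" for k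
    proof -
      have lV: "(\<lambda>n. V + 1 / real (Suc n)) \<longlonglongrightarrow> V + 0"
        by (intro tendsto_add tendsto_const LIMSEQ_inverse_Suc)
      have "\<And>n. J (z k) + (\<integral>\<omega>. (if \<omega> \<in> T k then 0 else f n \<omega> \<bullet> w \<omega>) \<partial>M) \<le> V + 1 / real (Suc n)"
        using fle[OF zp] unfolding pz .
      then have "J (z k) + (\<integral>\<omega>. (if \<omega> \<in> T k then 0 else h \<omega> \<bullet> w \<omega>) \<partial>M) \<le> V + 0"
        by (intro LIMSEQ_le[OF tendsto_add[OF tendsto_const tl(1)[of k]] lV]) blast
      then show ?thesis by simp
    qed
    have "AE_tendsto z x" unfolding AE_tendsto_def
    proof
      fix t show "AE \<omega> in M. (\<lambda>k. z k t \<omega>) \<longlonglongrightarrow> x t \<omega>"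
        using AE_eventually_not_exceed[OF lim, folded T_def]
      proof eventually_elim
        case (elim \<omega>)
        then show ?case by (intro tendsto_eventually) (erule eventually_mono, simp add: z_def)
      qed
    qed
    then have "(\<lambda>k. J (z k)) \<longlonglongrightarrow> J x" using concave_continuousD(2)[OF J x zp] by simp
    from LIMSEQ_le_const2[OF tendsto_add[OF this tl(2)]] le2
    have "J x + (\<integral>\<omega>. h \<omega> \<bullet> w \<omega> \<partial>M) \<le> V" by blast
    moreover have "(\<integral>\<omega>. h \<omega> \<bullet> w \<omega> \<partial>M) = (\<integral>\<omega>. (\<Sum>t\<in>UNIV. q \<omega> $ t \<bullet> residual x t \<omega>) \<partial>M)"
    proof (rule integral_cong_AE)
      show "AE \<omega> in M. h \<omega> \<bullet> w \<omega> = (\<Sum>t\<in>UNIV. q \<omega> $ t \<bullet> residual x t \<omega>)"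
        using qh by eventually_elim (simp add: w_def inner_vec_def[where 'b='t])
      show "(\<lambda>\<omega>. h \<omega> \<bullet> w \<omega>) \<in> borel_measurable M" using hi wm by (intro borel_measurable_inner) auto
      show "(\<lambda>\<omega>. \<Sum>t\<in>UNIV. q \<omega> $ t \<bullet> residual x t \<omega>) \<in> borel_measurable M"
        using residual_inner_integrable[OF integrable_nth[OF qi] x] by (intro borel_measurable_sum) auto
    qed
    ultimately show ?thesis using residual_inner_integrable[OF integrable_nth[OF qi] x] by simp
  qed
  then show ?thesis using q(2) integrable_nth[OF qi]
    by (intro exI[of _ "\<lambda>t \<omega>. q \<omega> $ t"]) auto
qed

section \<open>The optimum and the Lagrangian\<close>

lemma feasible_eq_feasible_on: "feasible D = feasible_on UNIV"
  by (auto simp: feasible_def feasible_on_def)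

lemma solution_exists: "\<exists>x. solution D x"
  using payoff_attained[OF admissible_feasible_on concave_continuous_payoff, of UNIV]
  by (auto simp: solution_def feasible_eq_feasible_on)

lemma lagrangian_eq:
  assumes x: "x \<in> programs D" and q: "\<And>t. integrable M (q t)"
  shows "lagrangian D p q x = payoff D x + (\<Sum>t\<in>UNIV. \<integral>\<omega>. p t \<omega> \<bullet> constr_at D t x \<omega> \<partial>M)
     + (\<Sum>t\<in>UNIV. \<integral>\<omega>. q t \<omega> \<bullet> residual x t \<omega> \<partial>M)"
proof -
  have "(\<integral>\<omega>. q t \<omega> \<bullet> (x t \<omega> - vec_cond_exp M (info D t) (x t) \<omega>) \<partial>M) = (\<integral>\<omega>. q t \<omega> \<bullet> residual x t \<omega> \<partial>M)" for t
  proof (rule integral_cong_AE)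
    show "AE \<omega> in M. q t \<omega> \<bullet> (x t \<omega> - vec_cond_exp M (info D t) (x t) \<omega>) = q t \<omega> \<bullet> residual x t \<omega>"
      using cproj_eq_vec_cond_exp[OF x, of t] by eventually_elim (simp add: residual_def)
    have "vec_cond_exp M (info D t) (x t) \<in> borel_measurable M"
      unfolding vec_cond_exp_def by (rule vec_lambda_measurable) auto
    then show "(\<lambda>\<omega>. q t \<omega> \<bullet> (x t \<omega> - vec_cond_exp M (info D t) (x t) \<omega>)) \<in> borel_measurable M"
      using q programD(1)[OF x] by (intro borel_measurable_inner borel_measurable_diff) auto
    show "(\<lambda>\<omega>. q t \<omega> \<bullet> residual x t \<omega>) \<in> borel_measurable M"
      using residual_inner_integrable[OF q x] by (rule borel_measurable_integrable)
  qed
  then show ?thesis by (simp add: lagrangian_def)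
qed

text \<open>\<open>V\<close> is the optimal value, which all solutions share, so one pair
  \<open>p\<close>, \<open>q\<close> serves them all. The Lagrangian is at most \<open>V\<close> at
  every program. At a solution the information terms vanish and the constraint terms are
  non-negative, so the latter sum to 0, each of them is 0, and the bound \<open>V\<close> is
  attained.\<close>

lemma multipliers_exist: "\<exists>p q. multipliers D p q"
proof -
  obtain xs where xs: "solution D xs" using solution_exists by blast
  define V where "V = payoff D xs"
  have V: "payoff D x \<le> V" if "x \<in> feasible D" for x
    using xs that by (auto simp: solution_def V_def)
  obtain p where p: "\<And>t. p t \<in> borel_measurable (info D t)" "\<And>t. integrable M (p t)"
     "\<And>t \<omega>. \<omega> \<in> space M \<Longrightarrow> p t \<omega> \<in> Wsp D t \<and> 0 \<le> p t \<omega>"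
    and pV: "\<And>x. x \<in> adapted D \<Longrightarrow> payoff D x + (\<Sum>t\<in>UNIV. \<integral>\<omega>. p t \<omega> \<bullet> constr_at D t x \<omega> \<partial>M) \<le> V"
    using constraint_multipliers[of V] V by blast
  have "concave_continuous (\<lambda>x. payoff D x + (\<Sum>t\<in>UNIV. \<integral>\<omega>. p t \<omega> \<bullet> constr_at D t x \<omega> \<partial>M))"
    using p by (intro concave_continuous_add_constrs concave_continuous_payoff) auto
  from information_multiplier[OF this pV]
  obtain q where q: "\<And>t. integrable M (q t)" "\<And>t \<omega>. \<omega> \<in> space M \<Longrightarrow> q t \<omega> \<in> Vsp D t"
    and qV: "\<And>x. x \<in> programs D \<Longrightarrow> payoff D x + (\<Sum>t\<in>UNIV. \<integral>\<omega>. p t \<omega> \<bullet> constr_at D t x \<omega> \<partial>M)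
      + (\<Sum>t\<in>UNIV. \<integral>\<omega>. q t \<omega> \<bullet> residual x t \<omega> \<partial>M) \<le> V" by blast
  have LV: "lagrangian D p q x \<le> V" if "x \<in> programs D" for x
    using qV[OF that] lagrangian_eq[OF that q(1)] by simp
  have "lagrangian D p q x \<le> lagrangian D p q z \<and> (\<forall>t. (\<integral>\<omega>. p t \<omega> \<bullet> constr_at D t z \<omega> \<partial>M) = 0)"
    if x: "x \<in> programs D" and z: "solution D z" for x z
  proof -
    have zf: "z \<in> feasible D" and zV: "payoff D z = V"
      using z xs by (auto simp: solution_def V_def intro: antisym)
    then have za: "z \<in> adapted D" and zc: "\<And>t. AE \<omega> in M. 0 \<le> constr_at D t z \<omega>"
      by (auto simp: feasible_def)
    note zp = adapted_program[OF za]
    have p0: "0 \<le> (\<integral>\<omega>. p t \<omega> \<bullet> constr_at D t z \<omega> \<partial>M)" for t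
    proof (rule integral_nonneg_AE)
      show "AE \<omega> in M. 0 \<le> p t \<omega> \<bullet> constr_at D t z \<omega>"
        using zc[of t] AE_space
      proof eventually_elim
        case (elim \<omega>)
        then show ?case using p(3) by (intro inner_nonneg_vec) auto
      qed
    qed
    have "(\<integral>\<omega>. q t \<omega> \<bullet> residual z t \<omega> \<partial>M) = 0" for t
    proof -
      have "AE \<omega> in M. q t \<omega> \<bullet> residual z t \<omega> = 0"
        using cproj_of_adapted[OF za, of t] by eventually_elim (simp add: residual_def)
      then show ?thesis by (rule integral_eq_zero_AE)
    qed
    then have Lz: "lagrangian D p q z = V + (\<Sum>t\<in>UNIV. \<integral>\<omega>. p t \<omega> \<bullet> constr_at D t z \<omega> \<partial>M)"
      using lagrangian_eq[OF zp q(1)] zV by simp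
    then have "(\<Sum>t\<in>UNIV. \<integral>\<omega>. p t \<omega> \<bullet> constr_at D t z \<omega> \<partial>M) \<le> 0" using LV[OF zp] by simp
    then have s0: "(\<Sum>t\<in>UNIV. \<integral>\<omega>. p t \<omega> \<bullet> constr_at D t z \<omega> \<partial>M) = 0"
      using sum_nonneg[of UNIV "\<lambda>t. \<integral>\<omega>. p t \<omega> \<bullet> constr_at D t z \<omega> \<partial>M"] p0 by (intro antisym) auto
    then have "\<forall>t. (\<integral>\<omega>. p t \<omega> \<bullet> constr_at D t z \<omega> \<partial>M) = 0"
      using sum_nonneg_eq_0_iff[of UNIV "\<lambda>t. \<integral>\<omega>. p t \<omega> \<bullet> constr_at D t z \<omega> \<partial>M"] p0 by auto
    then show ?thesis using LV[OF x] Lz s0 by simp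
  qed
  then have "multipliers D p q" unfolding multipliers_def using p q by auto
  then show ?thesis by blast
qed

end

theorem theorem1:
  fixes D :: "('o, 't::{finite,order}, 'v::finite, 'w::finite) team"
  assumes "team_model D"
    and "cond_A D" and "cond_B D" and "cond_C D"
    and "cond_D D" and "cond_E D" and "cond_F D"
  shows "(\<exists>x. solution D x) \<and> (\<exists>p q. multipliers D p q)"
proof -
  interpret team_problem D by unfold_locales (fact assms)+
  show ?thesis using solution_exists multipliers_exist by blast
qed

end
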